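(* Consider the bilevel problem, the regularity assumptions and the bilevel stochastic gradient (BSG) method described in the context. Suppose that there are positive constants $V_d,L_{BSG},\bar L_{LL},C_w,C_D,C_e$ such that for all $k$: (i) $\mathbb{E}_{\xi_k}[\|d(x_k,w(x_k),\xi_k)\|^2]\le V_d$; (ii) for any pair of data $(D_1)_k,(D_2)_k$, whose directions are computed with residual errors $(r_1)_k,(r_2)_k$, $\|d((D_1)_k)-d((D_2)_k)\|\le L_{BSG}(\|(D_1)_k-(D_2)_k\|+\|(r_1)_k-(r_2)_k\|)$, and moreover $\|D(x_k,w(x_k),\xi_k)-D(x_k,\tilde w_k,\xi_k)\|\le\bar L_{LL}\|w(x_k)-\tilde w_k\|$, where $\bar L_{LL}$ depends only on the Lipschitz constants of the stochastic gradients, Hessians and Jacobians; (iii) $\mathbb{E}_{\xi_k^{\rm S1}}[\|w(x_k)-\tilde w_k\|^2]\le(C_w\alpha_k)^2$; (iv) $\mathbb{E}_{\xi_k^{\rm all}}[\|D(x_k,\tilde w_k)-D(x_k,\tilde w_k,\xi_k)\|]\le C_D\alpha_k$; (v) for all realizations of the algorithm, every residual $r_k$ (either $(r_1)_k$ or $(r_2)_k$ in (ii)) satisfies $\|r_k\|\le C_e\alpha_k$. Suppose further that the sequence $\{f(x_k)\}_{k\ge0}$ is bounded below by a constant $f_{\inf}$, and that the step sizes satisfy $\sum_{k=0}^\infty\alpha_k=\infty$ and $\sum_{k=0}^\infty\alpha_k^2<\infty$. Let $A_K:=\sum_{k=0}^K\alpha_k$ and let $\mathbb{E}$ denote total expectation.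 Then $$\lim_{K\to\infty}\mathbb{E}\Big[\sum_{k=0}^K\alpha_k\|P_X\nabla f(x_k)\|^2\Big]<\infty,$$ and therefore $$\lim_{K\to\infty}\mathbb{E}\Big[\frac{1}{A_K}\sum_{k=0}^K\alpha_k\|P_X\nabla f(x_k)\|^2\Big]=0.$$
   Context: All vector and matrix norms are $\ell_2$ norms; tuples of vectors and matrices carry a fixed product norm. Gradients are columns, $\nabla g^\top$ denotes the Jacobian of a vector map $g$, and $\nabla^2_{xy}f_\ell$ is the $n\times m$ matrix of mixed second derivatives. Bilevel problem. $X\subseteq\mathbb{R}^n$ is closed and convex; $f_u:\mathbb{R}^n\times\mathbb{R}^m\to\mathbb{R}$ is continuously differentiable and $f_\ell:\mathbb{R}^n\times\mathbb{R}^m\to\mathbb{R}$ is twice continuously differentiable. The lower-level (LL) problem at $x$ is $\min_{y\in Y(x)}f_\ell(x,y)$, where either $Y(x)=\mathbb{R}^m$ (LL unconstrained case) or $Y(x)=\{y\in\mathbb{R}^m: c_i(x,y)\le0,\ i\in I;\ c_i(x,y)=0,\ i\in E\}$ with $I,E$ finite and each $c_i$ twice continuously differentiable (LL constrained case). The LL problem has a unique optimal solution $y(x)$. Set $f(x)=f_u(x,y(x))$; the bilevel problem is $\min_{x\in X}f(x)$. The result covers both cases. Unified notation. In the unconstrained case $w=y$ and $w(x)=y(x)$. In the constrained case, $c_I=(c_i)_{i\in I}$, $c_E=(c_i)_{i\in E}$, $\mathcal{L}_\ell(x,y,z)=f_\ell(x,y)+c_I(x,y)^\top z_I+c_E(x,y)^\top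 z_E$, $w=v=(y,z_I,z_E)$, $w(x)=v(x)=(y(x),z_I(x),z_E(x))$ with $z_I(x),z_E(x)$ the LL KKT multipliers, and $G(x,v)=(\nabla_y\mathcal{L}_\ell(x,y,z),\ z_I\circ c_I(x,y),\ c_E(x,y))$ ($\circ$ is the entrywise product), so $G(x,v(x))=0$; $L=(\mathbf{I}_m\ \mathbf{0})^\top$ with $\mathbf{0}$ of size $m\times(|I|+|E|)$. Data: $D=(a,b,A,B)$. Deterministic data: $D(x,w)=(\nabla_xf_u,\nabla_yf_u,\nabla^2_{xy}f_\ell,\nabla^2_{yy}f_\ell)$ at $(x,y)$ in the unconstrained case, and $D(x,w)=(\nabla_xf_u(x,y),L\nabla_yf_u(x,y),\nabla_xG(x,v),\nabla_vG(x,v))$ in the constrained case. Stochastic data $D(x,w,\xi)$: the same with stochastic estimates $g^u_x,g^u_y,H^\ell_{xy},H^\ell_{yy}$ (resp. $g^u_x,Lg^u_y,\mathcal{G}_x,\mathcal{G}_v$) depending on a random variable $\xi$. The direction associated with $D$ is $d(D)=-(a-AB^{-1}b)$, possibly computed inexactly with a residual error $r$: either $B\lambda=b$ is solved inexactly with residual $\tilde r$, giving $-(a-AB^{-1}(b+\tilde r))$, or $B^{-1}$ is replaced by a truncated Neumann series $B^{-1}-\tilde R$, giving $-(a-A(B^{-1}-\tilde R)b)$. Write $d(x,w)=d(D(x,w))$, $d(x,w,\xi)=d(D(x,w,\xi))$, and $d(x,w(x))=-\nabla f(x)$, the gradient of $f$ being $\nabla f(x)=a-AB^{-1}b$ with data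 $D(x,w(x))$. Regularity assumptions. Unconstrained case: $\nabla f_u,\nabla^2_{xy}f_\ell,\nabla^2_{yy}f_\ell$ are Lipschitz continuous; they and their stochastic estimates are bounded at all points; $\nabla_yf_\ell(x,y(x))=0$ and $\nabla^2_{yy}f_\ell$ and $H^\ell_{yy}$ are positive definite at all points; $(\nabla^2_{yy}f_\ell)^{-1}$ and $(H^\ell_{yy})^{-1}$ are uniformly bounded. Constrained case: $\nabla f_u,\nabla c_I^\top,\nabla c_E^\top,\nabla^2_{xy}f_\ell,\nabla^2_{yy}f_\ell,\nabla^2_{yx}c_i,\nabla^2_{yy}c_i$ ($i\in I\cup E$) are Lipschitz continuous; they and their stochastic estimates are uniformly bounded; the multipliers $z$ and their stochastic counterparts are uniformly bounded; $y(x)$ satisfies the LL KKT conditions with multipliers $(z_I(x),z_E(x))$ such that the linear independence constraint qualification, strict complementarity and the second-order sufficient condition hold; $(\nabla_vG)^{-1}$ and $\mathcal{G}_v^{-1}$ are uniformly bounded at all points. BSG method. Given an initial $(x_0,\tilde w_0)$ with $x_0\in X$ and positive step sizes $\{\alpha_k\}_{k\ge0}$, for $k=0,1,2,\dots$: (1) obtain an approximation $\tilde w_k$ of $w(x_k)$, using random variables $\xi_k^{\rm S1}$; (2) compute $d(x_k,\tilde w_k,\xi_k)$ using random variables $\xi_k$; (3) set $x_{k+1}=P_X(x_k+\alpha_kd(x_k,\tilde w_k,\xi_k))$, where $P_X$ is the orthogonal projection onto $X$. Put $\xi_k^{\rm all}=(\xi_k^{\rm S1},\xi_k)$, with $\xi_k^{\rm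 S1}$ and $\xi_k$ independent. $\mathbb{E}_{\xi_k},\mathbb{E}_{\xi_k^{\rm S1}},\mathbb{E}_{\xi_k^{\rm all}}$ are expectations with respect to the indicated variables given $x_k$; $\mathbb{E}$ is the expectation with respect to all of them.
   Formalization: P_X∇f(x_k) is read as the projected gradient (x_k − P_X(x_k − α_k∇f(x_k)))/α_k, equal to the literal projection of ∇f(x_k) when X is a linear subspace; read literally the claim fails, e.g. for X = {p} with p ≠ 0. *)

theory Defs
  imports "HOL-Probability.Probability"
begin

section \<open>Gradients, Jacobians, inverses\<close>

text \<open>Matrices are bounded linear maps, so that their norm is the operator norm induced by the
  Euclidean norm; tuples carry the library product norm.  Following the convention that gradients
  are columns, the gradient of a vector map is the adjoint of its derivative (the transposed
  Jacobian).\<close>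

definition grad :: "('a::real_inner \<Rightarrow> real) \<Rightarrow> 'a \<Rightarrow> 'a" where
  "grad g x = (THE D. GDERIV g x :> D)"

definition vgrad :: "('a::euclidean_space \<Rightarrow> 'b::euclidean_space) \<Rightarrow> 'a \<Rightarrow> 'b \<Rightarrow>\<^sub>L 'a" where
  "vgrad g x = Blinfun (adjoint (frechet_derivative g (at x)))"

definition C1 :: "('a::euclidean_space \<Rightarrow> 'b::euclidean_space) \<Rightarrow> bool" where
  "C1 g \<longleftrightarrow> (\<forall>x. g differentiable (at x)) \<and> continuous_on UNIV (vgrad g)"

definition C2 :: "('a::euclidean_space \<Rightarrow> real) \<Rightarrow> bool" where
  "C2 g \<longleftrightarrow> C1 g \<and> C1 (grad g)"

definition grad_x :: "('x::euclidean_space \<times> 'y::euclidean_space \<Rightarrow> real) \<Rightarrow> 'x \<Rightarrow> 'y \<Rightarrow> 'x" where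
  "grad_x g x y = grad (\<lambda>x'. g (x', y)) x"

definition grad_y :: "('x::euclidean_space \<times> 'y::euclidean_space \<Rightarrow> real) \<Rightarrow> 'x \<Rightarrow> 'y \<Rightarrow> 'y" where
  "grad_y g x y = grad (\<lambda>y'. g (x, y')) y"

text \<open>As a matrix, \<open>hess_xy g x y\<close> has entry \<open>\<partial>(\<partial>g/\<partial>y\<^sub>j)/\<partial>x\<^sub>i\<close> in row \<open>i\<close>, column \<open>j\<close>.\<close>

definition hess_xy ::
  "('x::euclidean_space \<times> 'y::euclidean_space \<Rightarrow> real) \<Rightarrow> 'x \<Rightarrow> 'y \<Rightarrow> 'y \<Rightarrow>\<^sub>L 'x" where
  "hess_xy g x y = vgrad (\<lambda>x'. grad_y g x' y) x"

definition hess_yy ::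
  "('x::euclidean_space \<times> 'y::euclidean_space \<Rightarrow> real) \<Rightarrow> 'x \<Rightarrow> 'y \<Rightarrow> 'y \<Rightarrow>\<^sub>L 'y" where
  "hess_yy g x y = vgrad (\<lambda>y'. grad_y g x y') y"

definition binv :: "('a::euclidean_space \<Rightarrow>\<^sub>L 'a) \<Rightarrow> 'a \<Rightarrow>\<^sub>L 'a" where
  "binv B = Blinfun (inv (blinfun_apply B))"

definition pos_def :: "('a::euclidean_space \<Rightarrow>\<^sub>L 'a) \<Rightarrow> bool" where
  "pos_def B \<longleftrightarrow> (\<forall>h. h \<noteq> 0 \<longrightarrow> h \<bullet> blinfun_apply B h > 0)"

definition lipschitz_map :: "('a::metric_space \<Rightarrow> 'b::metric_space) \<Rightarrow> bool" where
  "lipschitz_map g \<longleftrightarrow> (\<exists>C. C-lipschitz_on UNIV g)"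

section \<open>Projected gradient\<close>

text \<open>The projected gradient along the projection arc: a projected gradient step from \<open>x\<close> with step
  size \<open>\<alpha>\<close> and gradient \<open>g\<close> leads to \<open>x - \<alpha> *\<^sub>R proj_grad X \<alpha> x g\<close>.  Applying the projection onto
  \<open>X\<close> to the vector \<open>g\<close> itself is meaningful as a stationarity measure only if \<open>X\<close> is a subspace, and
  the two notions then agree.\<close>

definition proj_grad :: "'a::euclidean_space set \<Rightarrow> real \<Rightarrow> 'a \<Rightarrow> 'a \<Rightarrow> 'a" where
  "proj_grad X \<alpha> x g = (1 / \<alpha>) *\<^sub>R (x - closest_point X (x - \<alpha> *\<^sub>R g))"

lemma proj_grad_subspace:
  fixes X :: "'a::euclidean_space set"
  assumes X: "subspace X" and x: "x \<in> X" and \<alpha>: "\<alpha> > 0"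
  shows "proj_grad X \<alpha> x g = closest_point X g"
proof -
  let ?p = "closest_point X g"
  have cl: "closed X" and cv: "convex X"
    using X by (auto simp: closed_subspace subspace_imp_convex)
  have pX: "?p \<in> X" using cl x by (intro closest_point_in_set) auto
  have le: "dist (x - \<alpha> *\<^sub>R g) (x - \<alpha> *\<^sub>R ?p) \<le> dist (x - \<alpha> *\<^sub>R g) z" if z: "z \<in> X" for z
  proof -
    let ?u = "(1 / \<alpha>) *\<^sub>R (x - z)"
    have "?u \<in> X" using X x z by (simp add: subspace_diff subspace_scale)
    hence "dist g ?p \<le> dist g ?u" by (rule closest_point_le[OF cl])
    hence "\<alpha> * norm (g - ?p) \<le> \<alpha> * norm (g - ?u)" using \<alpha> by (simp add: dist_norm)
    moreover have "norm (\<alpha> *\<^sub>R ?p - \<alpha> *\<^sub>R g) = \<alpha> * norm (g - ?p)"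
      using \<alpha> by (simp flip: scaleR_diff_right add: norm_minus_commute)
    moreover have "norm (x - \<alpha> *\<^sub>R g - z) = \<alpha> * norm (g - ?u)"
    proof -
      have "x - \<alpha> *\<^sub>R g - z = - (\<alpha> *\<^sub>R (g - ?u))" using \<alpha> by (simp add: scaleR_diff_right)
      thus ?thesis using \<alpha> by (simp only: norm_minus_cancel norm_scaleR)
    qed
    ultimately show ?thesis by (simp add: dist_norm)
  qed
  have "x - \<alpha> *\<^sub>R ?p \<in> X" using X x pX by (simp add: subspace_diff subspace_scale)
  hence "x - \<alpha> *\<^sub>R ?p = closest_point X (x - \<alpha> *\<^sub>R g)"
    using le by (intro closest_point_unique cv cl) auto
  hence "x - closest_point X (x - \<alpha> *\<^sub>R g) = \<alpha> *\<^sub>R ?p" by (metis diff_diff_eq2 add_diff_cancel_left')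
  thus ?thesis using \<alpha> by (simp add: proj_grad_def)
qed

section \<open>Data, residuals and directions\<close>

type_synonym ('x, 'w) bdata = "'x \<times> 'w \<times> ('w \<Rightarrow>\<^sub>L 'x) \<times> ('w \<Rightarrow>\<^sub>L 'w)"

text \<open>A residual is a pair of a vector (inexact solution of the linear system) and a matrix (truncated
  Neumann series); depending on which of the two options the method uses, the other component is
  zero, so that the norm of the pair is the norm of the residual.\<close>

type_synonym 'w residual = "'w \<times> ('w \<Rightarrow>\<^sub>L 'w)"

datatype inexactness = Linear_System | Neumann_Series

fun residuals :: "inexactness \<Rightarrow> 'w::euclidean_space residual set" where
  "residuals Linear_System = {(q, R). R = 0}"
| "residuals Neumann_Series = {(q, R). q = 0}"

definition direction ::
  "('x::euclidean_space, 'w::euclidean_space) bdata \<Rightarrow> 'w residual \<Rightarrow> 'x" where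
  "direction = (\<lambda>(a, b, A, B) (q, R).
     - (a - blinfun_apply A (blinfun_apply (binv B) (b + q) - blinfun_apply R b)))"

section \<open>Lower-level problem\<close>

definition unique_LL_solution ::
  "('x \<times> 'y \<Rightarrow> real) \<Rightarrow> ('x \<Rightarrow> 'y set) \<Rightarrow> ('x \<Rightarrow> 'y) \<Rightarrow> bool" where
  "unique_LL_solution fl Y y \<longleftrightarrow>
     (\<forall>x. \<forall>u. is_arg_min (\<lambda>u'. fl (x, u')) (\<lambda>u'. u' \<in> Y x) u \<longleftrightarrow> u = y x)"

subsection \<open>Unconstrained case\<close>

definition data_u ::
  "('x::euclidean_space \<times> 'y::euclidean_space \<Rightarrow> real) \<Rightarrow> ('x \<times> 'y \<Rightarrow> real) \<Rightarrow>
   'x \<Rightarrow> 'y \<Rightarrow> ('x, 'y) bdata" where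
  "data_u fu fl x y = (grad_x fu x y, grad_y fu x y, hess_xy fl x y, hess_yy fl x y)"

definition sdata_u ::
  "('x \<Rightarrow> 'y \<Rightarrow> 't \<Rightarrow> 'x) \<Rightarrow> ('x \<Rightarrow> 'y \<Rightarrow> 't \<Rightarrow> 'y) \<Rightarrow>
   ('x \<Rightarrow> 'y \<Rightarrow> 't \<Rightarrow> 'y \<Rightarrow>\<^sub>L 'x) \<Rightarrow> ('x \<Rightarrow> 'y \<Rightarrow> 't \<Rightarrow> 'y \<Rightarrow>\<^sub>L 'y) \<Rightarrow>
   'x::euclidean_space \<Rightarrow> 'y::euclidean_space \<Rightarrow> 't \<Rightarrow> ('x, 'y) bdata" where
  "sdata_u gx gy Hxy Hyy x y \<xi> = (gx x y \<xi>, gy x y \<xi>, Hxy x y \<xi>, Hyy x y \<xi>)"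

text \<open>\<open>T\<close> is the set of values of the random variables used in the stochastic estimates.\<close>

definition regular_u ::
  "('x::euclidean_space \<times> 'y::euclidean_space \<Rightarrow> real) \<Rightarrow> ('x \<times> 'y \<Rightarrow> real) \<Rightarrow> ('x \<Rightarrow> 'y) \<Rightarrow>
   't set \<Rightarrow> ('x \<Rightarrow> 'y \<Rightarrow> 't \<Rightarrow> 'x) \<Rightarrow> ('x \<Rightarrow> 'y \<Rightarrow> 't \<Rightarrow> 'y) \<Rightarrow>
   ('x \<Rightarrow> 'y \<Rightarrow> 't \<Rightarrow> 'y \<Rightarrow>\<^sub>L 'x) \<Rightarrow> ('x \<Rightarrow> 'y \<Rightarrow> 't \<Rightarrow> 'y \<Rightarrow>\<^sub>L 'y) \<Rightarrow> bool" where
  "regular_u fu fl y T gx gy Hxy Hyy \<longleftrightarrow>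
     lipschitz_map (grad fu) \<and> bounded (range (grad fu)) \<and>
     lipschitz_map (\<lambda>(x, y). hess_xy fl x y) \<and> bounded (range (\<lambda>(x, y). hess_xy fl x y)) \<and>
     lipschitz_map (\<lambda>(x, y). hess_yy fl x y) \<and> bounded (range (\<lambda>(x, y). hess_yy fl x y)) \<and>
     bounded ((\<lambda>(x, y, \<xi>). gx x y \<xi>) ` (UNIV \<times> UNIV \<times> T)) \<and>
     bounded ((\<lambda>(x, y, \<xi>). gy x y \<xi>) ` (UNIV \<times> UNIV \<times> T)) \<and>
     bounded ((\<lambda>(x, y, \<xi>). Hxy x y \<xi>) ` (UNIV \<times> UNIV \<times> T)) \<and>
     bounded ((\<lambda>(x, y, \<xi>). Hyy x y \<xi>) ` (UNIV \<times> UNIV \<times> T)) \<and>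
     (\<forall>x. grad_y fl x (y x) = 0) \<and>
     (\<forall>x y. pos_def (hess_yy fl x y)) \<and>
     (\<forall>x y. \<forall>\<xi>\<in>T. pos_def (Hyy x y \<xi>)) \<and>
     bounded (range (\<lambda>(x, y). binv (hess_yy fl x y))) \<and>
     bounded ((\<lambda>(x, y, \<xi>). binv (Hyy x y \<xi>)) ` (UNIV \<times> UNIV \<times> T))"

subsection \<open>Constrained case\<close>

text \<open>The constraints are indexed by a finite type; \<open>I\<close> is the set of inequality constraints and \<open>- I\<close>
  the set of equality constraints (either may be empty).  The pair \<open>(z\<^sub>I, z\<^sub>E)\<close> is the single vector
  \<open>z\<close>.\<close>

definition feasible ::
  "'j set \<Rightarrow> ('j \<Rightarrow> 'x \<times> 'y \<Rightarrow> real) \<Rightarrow> 'x \<Rightarrow> 'y set" where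
  "feasible I c x = {y. (\<forall>i\<in>I. c i (x, y) \<le> 0) \<and> (\<forall>i\<in>- I. c i (x, y) = 0)}"

definition lagrangian ::
  "('x \<times> 'y \<Rightarrow> real) \<Rightarrow> ('j::finite \<Rightarrow> 'x \<times> 'y \<Rightarrow> real) \<Rightarrow> (real^'j) \<Rightarrow> 'x \<times> 'y \<Rightarrow> real" where
  "lagrangian fl c z p = fl p + (\<Sum>i\<in>UNIV. c i p * z $ i)"

definition KKT_map ::
  "'j set \<Rightarrow> ('j::finite \<Rightarrow> 'x::euclidean_space \<times> 'y::euclidean_space \<Rightarrow> real) \<Rightarrow>
   ('x \<times> 'y \<Rightarrow> real) \<Rightarrow> 'x \<Rightarrow> 'y \<times> (real^'j) \<Rightarrow> 'y \<times> (real^'j)" where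
  "KKT_map I c fl x = (\<lambda>(y, z).
     (grad_y (lagrangian fl c z) x y,
      \<chi> i. if i \<in> I then z $ i * c i (x, y) else c i (x, y)))"

definition active :: "'j set \<Rightarrow> ('j \<Rightarrow> 'x \<times> 'y \<Rightarrow> real) \<Rightarrow> 'x \<Rightarrow> 'y \<Rightarrow> 'j set" where
  "active I c x y = {i\<in>I. c i (x, y) = 0} \<union> (- I)"

definition KKT ::
  "'j set \<Rightarrow> ('j::finite \<Rightarrow> 'x::euclidean_space \<times> 'y::euclidean_space \<Rightarrow> real) \<Rightarrow>
   ('x \<times> 'y \<Rightarrow> real) \<Rightarrow> 'x \<Rightarrow> 'y \<Rightarrow> real^'j \<Rightarrow> bool" where
  "KKT I c fl x y z \<longleftrightarrow>
     grad_y (lagrangian fl c z) x y = 0 \<and> y \<in> feasible I c x \<and>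
     (\<forall>i\<in>I. 0 \<le> z $ i \<and> z $ i * c i (x, y) = 0)"

definition LICQ ::
  "'j set \<Rightarrow> ('j \<Rightarrow> 'x::euclidean_space \<times> 'y::euclidean_space \<Rightarrow> real) \<Rightarrow> 'x \<Rightarrow> 'y \<Rightarrow> bool" where
  "LICQ I c x y \<longleftrightarrow>
     inj_on (\<lambda>i. grad_y (c i) x y) (active I c x y) \<and>
     independent ((\<lambda>i. grad_y (c i) x y) ` active I c x y)"

definition strict_complementarity ::
  "'j set \<Rightarrow> ('j::finite \<Rightarrow> 'x \<times> 'y \<Rightarrow> real) \<Rightarrow> 'x \<Rightarrow> 'y \<Rightarrow> real^'j \<Rightarrow> bool" where
  "strict_complementarity I c x y z \<longleftrightarrow> (\<forall>i\<in>I. c i (x, y) = 0 \<longrightarrow> 0 < z $ i)"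

definition critical_cone ::
  "'j set \<Rightarrow> ('j::finite \<Rightarrow> 'x::euclidean_space \<times> 'y::euclidean_space \<Rightarrow> real) \<Rightarrow>
   'x \<Rightarrow> 'y \<Rightarrow> real^'j \<Rightarrow> 'y set" where
  "critical_cone I c x y z =
     {h. (\<forall>i\<in>- I. grad_y (c i) x y \<bullet> h = 0) \<and>
         (\<forall>i\<in>I. c i (x, y) = 0 \<longrightarrow>
            grad_y (c i) x y \<bullet> h \<le> 0 \<and> (0 < z $ i \<longrightarrow> grad_y (c i) x y \<bullet> h = 0))}"

definition SOSC ::
  "'j set \<Rightarrow> ('j::finite \<Rightarrow> 'x::euclidean_space \<times> 'y::euclidean_space \<Rightarrow> real) \<Rightarrow>
   ('x \<times> 'y \<Rightarrow> real) \<Rightarrow> 'x \<Rightarrow> 'y \<Rightarrow> real^'j \<Rightarrow> bool" where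
  "SOSC I c fl x y z \<longleftrightarrow>
     (\<forall>h\<in>critical_cone I c x y z.
        h \<noteq> 0 \<longrightarrow> h \<bullet> blinfun_apply (hess_yy (lagrangian fl c z) x y) h > 0)"

definition data_c ::
  "'j set \<Rightarrow> ('j::finite \<Rightarrow> 'x::euclidean_space \<times> 'y::euclidean_space \<Rightarrow> real) \<Rightarrow>
   ('x \<times> 'y \<Rightarrow> real) \<Rightarrow> ('x \<times> 'y \<Rightarrow> real) \<Rightarrow>
   'x \<Rightarrow> 'y \<times> (real^'j) \<Rightarrow> ('x, 'y \<times> (real^'j)) bdata" where
  "data_c I c fu fl x v =
     (grad_x fu x (fst v), (grad_y fu x (fst v), 0),
      vgrad (\<lambda>x'. KKT_map I c fl x' v) x, vgrad (KKT_map I c fl x) v)"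

definition sdata_c ::
  "('x \<Rightarrow> 'y \<Rightarrow> 't \<Rightarrow> 'x) \<Rightarrow> ('x \<Rightarrow> 'y \<Rightarrow> 't \<Rightarrow> 'y) \<Rightarrow>
   ('x \<Rightarrow> 'y \<times> (real^'j) \<Rightarrow> 't \<Rightarrow> ('y \<times> (real^'j)) \<Rightarrow>\<^sub>L 'x) \<Rightarrow>
   ('x \<Rightarrow> 'y \<times> (real^'j) \<Rightarrow> 't \<Rightarrow> ('y \<times> (real^'j)) \<Rightarrow>\<^sub>L ('y \<times> (real^'j))) \<Rightarrow>
   'x::euclidean_space \<Rightarrow> 'y::euclidean_space \<times> (real^'j::finite) \<Rightarrow> 't \<Rightarrow>
   ('x, 'y \<times> (real^'j)) bdata" where
  "sdata_c gx gy Gx Gv x v \<xi> = (gx x (fst v) \<xi>, (gy x (fst v) \<xi>, 0), Gx x v \<xi>, Gv x v \<xi>)"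

text \<open>\<open>P\<close> is the set of points \<open>(x, v)\<close> at which the data are formed.  The bounds that involve the
  multipliers are required on \<open>P\<close>: requiring the derivative of the KKT map to be invertible at every
  \<open>(x, v)\<close> would be contradictory as soon as an inequality constraint vanishes somewhere, because
  that derivative is singular wherever \<open>z\<^sub>i = c\<^sub>i(x, y) = 0\<close>.\<close>

definition regular_c ::
  "'j set \<Rightarrow> ('j::finite \<Rightarrow> 'x::euclidean_space \<times> 'y::euclidean_space \<Rightarrow> real) \<Rightarrow>
   ('x \<times> 'y \<Rightarrow> real) \<Rightarrow> ('x \<times> 'y \<Rightarrow> real) \<Rightarrow> ('x \<Rightarrow> 'y \<times> (real^'j)) \<Rightarrow>
   ('x \<times> ('y \<times> (real^'j))) set \<Rightarrow>
   't set \<Rightarrow> ('x \<Rightarrow> 'y \<Rightarrow> 't \<Rightarrow> 'x) \<Rightarrow> ('x \<Rightarrow> 'y \<Rightarrow> 't \<Rightarrow> 'y) \<Rightarrow>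
   ('x \<Rightarrow> 'y \<times> (real^'j) \<Rightarrow> 't \<Rightarrow> ('y \<times> (real^'j)) \<Rightarrow>\<^sub>L 'x) \<Rightarrow>
   ('x \<Rightarrow> 'y \<times> (real^'j) \<Rightarrow> 't \<Rightarrow> ('y \<times> (real^'j)) \<Rightarrow>\<^sub>L ('y \<times> (real^'j))) \<Rightarrow> bool" where
  "regular_c I c fu fl v P T gx gy Gx Gv \<longleftrightarrow>
     lipschitz_map (grad fu) \<and> bounded (range (grad fu)) \<and>
     lipschitz_map (\<lambda>(x, y). hess_xy fl x y) \<and> bounded (range (\<lambda>(x, y). hess_xy fl x y)) \<and>
     lipschitz_map (\<lambda>(x, y). hess_yy fl x y) \<and> bounded (range (\<lambda>(x, y). hess_yy fl x y)) \<and>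
     (\<forall>i. lipschitz_map (grad (c i)) \<and> bounded (range (grad (c i))) \<and>
        lipschitz_map (\<lambda>(x, y). hess_xy (c i) x y) \<and>
        bounded (range (\<lambda>(x, y). hess_xy (c i) x y)) \<and>
        lipschitz_map (\<lambda>(x, y). hess_yy (c i) x y) \<and>
        bounded (range (\<lambda>(x, y). hess_yy (c i) x y))) \<and>
     bounded ((\<lambda>(x, y, \<xi>). gx x y \<xi>) ` (UNIV \<times> UNIV \<times> T)) \<and>
     bounded ((\<lambda>(x, y, \<xi>). gy x y \<xi>) ` (UNIV \<times> UNIV \<times> T)) \<and>
     bounded ((\<lambda>((x, v), \<xi>). Gx x v \<xi>) ` (P \<times> T)) \<and>
     bounded ((\<lambda>(x, v). snd v) ` P) \<and>
     (\<forall>x. KKT I c fl x (fst (v x)) (snd (v x)) \<and> LICQ I c x (fst (v x)) \<and>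
        strict_complementarity I c x (fst (v x)) (snd (v x)) \<and>
        SOSC I c fl x (fst (v x)) (snd (v x))) \<and>
     (\<forall>(x, v)\<in>P. bij (blinfun_apply (vgrad (KKT_map I c fl x) v))) \<and>
     (\<forall>(x, v)\<in>P. \<forall>\<xi>\<in>T. bij (blinfun_apply (Gv x v \<xi>))) \<and>
     bounded ((\<lambda>(x, v). binv (vgrad (KKT_map I c fl x) v)) ` P) \<and>
     bounded ((\<lambda>((x, v), \<xi>). binv (Gv x v \<xi>)) ` (P \<times> T))"

section \<open>The bilevel stochastic gradient method\<close>

text \<open>All random objects live on one probability space.  \<open>LL_solver xs ws s\<close> is the approximation
  obtained in step 1 from the iterates \<open>xs\<close> up to the current one, the initial guess and the previous
  approximations \<open>ws\<close>, and the sample \<open>s\<close> of the step-1 random variables.  The three residual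
  processes belong to the directions computed from the stochastic data at the approximation (the
  direction used by the method), the stochastic data at \<open>w(x\<^sub>k)\<close>, and the deterministic data at the
  approximation.\<close>

record (overloaded) ('x, 'w, 's, 't, 'o) bsg_run =
  LL_space :: "'s measure"
  LL_sample :: "nat \<Rightarrow> 'o \<Rightarrow> 's"
  dir_space :: "'t measure"
  dir_sample :: "nat \<Rightarrow> 'o \<Rightarrow> 't"
  LL_solver :: "'x list \<Rightarrow> 'w list \<Rightarrow> 's \<Rightarrow> 'w"
  x_init :: 'x
  w_init :: 'w
  iterate :: "nat \<Rightarrow> 'o \<Rightarrow> 'x"
  approx :: "nat \<Rightarrow> 'o \<Rightarrow> 'w"
  res_step :: "nat \<Rightarrow> 'o \<Rightarrow> 'w residual"
  res_stoch :: "nat \<Rightarrow> 'o \<Rightarrow> 'w residual"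
  res_det :: "nat \<Rightarrow> 'o \<Rightarrow> 'w residual"

locale bsg_method = prob_space M
  for M :: "'o measure" +
  fixes X :: "'x::euclidean_space set"
    and Ds :: "'x \<Rightarrow> 'w::euclidean_space \<Rightarrow> 't \<Rightarrow> ('x, 'w) bdata"
    and mode :: inexactness
    and \<alpha> :: "nat \<Rightarrow> real"
    and R :: "('x, 'w, 's, 't, 'o) bsg_run"
  assumes step_pos: "\<And>k. 0 < \<alpha> k"
    and LL_sample_rv: "\<And>k. LL_sample R k \<in> measurable M (LL_space R)"
    and dir_sample_rv: "\<And>k. dir_sample R k \<in> measurable M (dir_space R)"
    and samples_indep:
      "\<And>k. indep_set (sets (vimage_algebra (space M) (LL_sample R k) (LL_space R)))
        (sets (vimage_algebra (space M) (dir_sample R k) (dir_space R)))"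
    and iterate_rv: "\<And>k. iterate R k \<in> borel_measurable M"
    and approx_rv: "\<And>k. approx R k \<in> borel_measurable M"
    and res_mode: "\<And>k \<omega>. \<omega> \<in> space M \<Longrightarrow>
      {res_step R k \<omega>, res_stoch R k \<omega>, res_det R k \<omega>} \<subseteq> residuals mode"
    and init: "x_init R \<in> X" "\<And>\<omega>. \<omega> \<in> space M \<Longrightarrow> iterate R 0 \<omega> = x_init R"
    and step1: "\<And>k \<omega>. \<omega> \<in> space M \<Longrightarrow>
      approx R k \<omega> = LL_solver R (map (\<lambda>j. iterate R j \<omega>) [0..<Suc k])
        (w_init R # map (\<lambda>j. approx R j \<omega>) [0..<k]) (LL_sample R k \<omega>)"
    and step23: "\<And>k \<omega>. \<omega> \<in> space M \<Longrightarrow>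
      iterate R (Suc k) \<omega> = closest_point X (iterate R k \<omega> + \<alpha> k *\<^sub>R
        direction (Ds (iterate R k \<omega>) (approx R k \<omega>) (dir_sample R k \<omega>)) (res_step R k \<omega>))"

text \<open>The data occurring in iteration \<open>k\<close>, paired with the residuals of their directions; the direction
  \<open>- \<nabla>f(x\<^sub>k)\<close> associated with the deterministic data at \<open>w(x\<^sub>k)\<close> is exact.\<close>

definition iteration_data ::
  "('x::euclidean_space \<Rightarrow> 'w) \<Rightarrow> ('x \<Rightarrow> 'w \<Rightarrow> ('x, 'w) bdata) \<Rightarrow>
   ('x \<Rightarrow> 'w::euclidean_space \<Rightarrow> 't \<Rightarrow> ('x, 'w) bdata) \<Rightarrow> ('x, 'w, 's, 't, 'o) bsg_run \<Rightarrow>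
   nat \<Rightarrow> 'o \<Rightarrow> (('x, 'w) bdata \<times> 'w residual) set" where
  "iteration_data w D Ds R k \<omega> =
     (let x = iterate R k \<omega>; u = approx R k \<omega>; \<xi> = dir_sample R k \<omega> in
      {(D x (w x), 0), (D x u, res_det R k \<omega>),
       (Ds x (w x) \<xi>, res_stoch R k \<omega>), (Ds x u \<xi>, res_step R k \<omega>)})"

text \<open>\<open>g\<close> is a random variable whose conditional expectation given \<open>Z\<close> is at most \<open>c\<close>.  The
  nonnegative conditional expectation is used (for nonnegative \<open>g\<close>) because it may be infinite,
  whereas the real-valued one is not meaningful without integrability.\<close>

definition cond_mean_le ::
  "'o measure \<Rightarrow> ('o \<Rightarrow> 'x::topological_space) \<Rightarrow> ('o \<Rightarrow> real) \<Rightarrow> real \<Rightarrow> bool" where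
  "cond_mean_le M Z g c \<longleftrightarrow> g \<in> borel_measurable M \<and>
     (AE \<omega> in M. nn_cond_exp M (vimage_algebra (space M) Z borel) (\<lambda>\<omega>. ennreal (g \<omega>)) \<omega>
        \<le> ennreal c)"

locale bsg_assumptions = bsg_method M X Ds mode \<alpha> R
  for M :: "'o measure"
    and X :: "'x::euclidean_space set"
    and Ds :: "'x \<Rightarrow> 'w::euclidean_space \<Rightarrow> 't \<Rightarrow> ('x, 'w) bdata"
    and mode \<alpha>
    and R :: "('x, 'w, 's, 't, 'o) bsg_run" +
  fixes D :: "'x \<Rightarrow> 'w \<Rightarrow> ('x, 'w) bdata" and w :: "'x \<Rightarrow> 'w" and f :: "'x \<Rightarrow> real"
    and V\<^sub>d L_BSG L_LL C\<^sub>w C\<^sub>D C\<^sub>e f_inf :: real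
  assumes constants_pos: "0 < V\<^sub>d" "0 < L_BSG" "0 < L_LL" "0 < C\<^sub>w" "0 < C\<^sub>D" "0 < C\<^sub>e"
    and second_moment: "\<And>k. cond_mean_le M (iterate R k)
      (\<lambda>\<omega>. (norm (direction (Ds (iterate R k \<omega>) (w (iterate R k \<omega>)) (dir_sample R k \<omega>))
        (res_stoch R k \<omega>)))\<^sup>2) V\<^sub>d"
    and direction_lipschitz: "\<And>k \<omega> D\<^sub>1 r\<^sub>1 D\<^sub>2 r\<^sub>2. \<omega> \<in> space M \<Longrightarrow>
      (D\<^sub>1, r\<^sub>1) \<in> iteration_data w D Ds R k \<omega> \<Longrightarrow> (D\<^sub>2, r\<^sub>2) \<in> iteration_data w D Ds R k \<omega> \<Longrightarrow>
      norm (direction D\<^sub>1 r\<^sub>1 - direction D\<^sub>2 r\<^sub>2) \<le> L_BSG * (norm (D\<^sub>1 - D\<^sub>2) + norm (r\<^sub>1 - r\<^sub>2))"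
    and data_lipschitz: "\<And>k \<omega>. \<omega> \<in> space M \<Longrightarrow>
      norm (Ds (iterate R k \<omega>) (w (iterate R k \<omega>)) (dir_sample R k \<omega>)
          - Ds (iterate R k \<omega>) (approx R k \<omega>) (dir_sample R k \<omega>))
        \<le> L_LL * norm (w (iterate R k \<omega>) - approx R k \<omega>)"
    and LL_accuracy: "\<And>k. cond_mean_le M (iterate R k)
      (\<lambda>\<omega>. (norm (w (iterate R k \<omega>) - approx R k \<omega>))\<^sup>2) ((C\<^sub>w * \<alpha> k)\<^sup>2)"
    and data_accuracy: "\<And>k. cond_mean_le M (iterate R k)
      (\<lambda>\<omega>. norm (D (iterate R k \<omega>) (approx R k \<omega>)
          - Ds (iterate R k \<omega>) (approx R k \<omega>) (dir_sample R k \<omega>))) (C\<^sub>D * \<alpha> k)"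
    and residual_bound: "\<And>k \<omega> D' r. \<omega> \<in> space M \<Longrightarrow>
      (D', r) \<in> iteration_data w D Ds R k \<omega> \<Longrightarrow> norm r \<le> C\<^sub>e * \<alpha> k"
    and bounded_below: "\<And>k \<omega>. \<omega> \<in> space M \<Longrightarrow> f_inf \<le> f (iterate R k \<omega>)"

definition weighted_sum ::
  "'x::euclidean_space set \<Rightarrow> ('x \<Rightarrow> real) \<Rightarrow> (nat \<Rightarrow> real) \<Rightarrow> (nat \<Rightarrow> 'o \<Rightarrow> 'x) \<Rightarrow> nat \<Rightarrow> 'o \<Rightarrow> real"
  where
  "weighted_sum X f \<alpha> x K \<omega> =
     (\<Sum>k\<le>K. \<alpha> k * (norm (proj_grad X (\<alpha> k) (x k \<omega>) (grad f (x k \<omega>))))\<^sup>2)"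

end

theory Submission
  imports Defs
begin

text \<open>In both cases \<open>w(x)\<close> is the zero of a map \<open>G(x, \<cdot>)\<close> whose derivative in \<open>w\<close> is invertible along
  the graph of \<open>w\<close>, with uniformly bounded inverse.  Wherever \<open>w\<close> is continuous, implicit
  differentiation gives a derivative of bounded norm.  Continuity itself is not automatic, since a
  global minimizer might escape to infinity at a limit point; but uniqueness of the minimizer closes
  the graph of \<open>w\<close>, and a Baire category argument then turns the derivative bound into a global
  Lipschitz bound.  Hence \<open>\<nabla>f = a - A B\<^sup>-\<^sup>1 b\<close> everywhere, and this map is bounded and
  Lipschitz.

  For the descent, compare \<open>x\<^sub>k\<^sub>+\<^sub>1\<close> with the exact projected gradient step: the expected
  decrease of \<open>f\<close> is at least \<open>\<alpha>\<^sub>k E\<parallel>P\<^sub>X \<nabla>f(x\<^sub>k)\<parallel>\<^sup>2\<close> up to \<open>C \<alpha>\<^sub>k E\<parallel>d\<^sub>k + \<nabla>f(x\<^sub>k)\<parallel>\<close> and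
  \<open>C \<alpha>\<^sub>k\<^sup>2 E\<parallel>d\<^sub>k\<parallel>\<^sup>2\<close>.  The bias \<open>E\<parallel>d\<^sub>k + \<nabla>f(x\<^sub>k)\<parallel>\<close> is of order \<open>\<alpha>\<^sub>k\<close> and the second moment is
  bounded, so both errors are summable, and telescoping bounds the weighted sums.\<close>

section \<open>Implicit functions with closed graph\<close>

text \<open>Differentiability of \<open>f\<close> is not a hypothesis, and \<open>grad\<close> is a
  definite description, so the weighted sums can be handled only after a derivative of
  \<open>f\<close> has been produced. Two obstacles come from the constrained case. The feasible set
  moves with \<open>x\<close>, so minimality does not simply pass to limits. And the transposed
  Jacobian in \<open>v\<close> contains the values \<open>c i (x, y)\<close>, for which only the
  gradients are bounded. This is why "bounded and Lipschitz" is kept apart from "Lipschitz": in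
  \<open>a - A B^-1 b\<close> the matrix \<open>B\<close> occurs only through its inverse, so a
  Lipschitz \<open>B\<close> with bounded inverse suffices. The bounds hold on a set
  \<open>P\<close> of pairs that need be neither open nor convex. In
  \<open>implicit_gradient\<close>, \<open>P\<close> therefore carries only Lipschitz and sup
  bounds, while \<open>F\<close> and \<open>G\<close> are differentiated at graph points. Lipschitz
  continuity on \<open>P\<close> also supplies an estimate for the deterministic data at
  \<open>w(x_k)\<close> and at its approximation, which the bias bound needs;
  \<open>data_lipschitz\<close> compares stochastic data.\<close>

text \<open>By Baire, a nonempty set \<open>S\<close> of points at which \<open>\<phi>\<close> is locally unbounded would contain a
  relatively open piece on which \<open>\<phi>\<close> is bounded.  A nearby point outside \<open>S\<close> is joined to its closest
  point of \<open>S\<close> by a segment along which \<open>\<phi>\<close> is Lipschitz, so \<open>\<phi>\<close> would be bounded near that piece.\<close>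

lemma lipschitz_if_closed_graph:
  fixes \<phi> :: "'p::euclidean_space \<Rightarrow> 'w::euclidean_space"
  assumes closed_graph: "\<And>s t p. s \<longlonglongrightarrow> t \<Longrightarrow> (\<lambda>n. \<phi> (s n)) \<longlonglongrightarrow> p \<Longrightarrow> p = \<phi> t"
    and deriv: "\<And>t. isCont \<phi> t \<Longrightarrow> \<exists>\<phi>'. (\<phi> has_derivative \<phi>') (at t) \<and> onorm \<phi>' \<le> C"
  shows "norm (\<phi> x - \<phi> y) \<le> C * norm (x - y)"
proof -
  \<comment> \<open>By compactness, bounded values have cluster points, and the closed graph allows
    only \<open>\<phi> t\<close> as one. This is the only use of
    \<open>closed_graph\<close>.\<close>
  have conv: "(\<lambda>n. \<phi> (s n)) \<longlonglongrightarrow> \<phi> t" if s: "s \<longlonglongrightarrow> t" and B: "bounded (range (\<lambda>n. \<phi> (s n)))" for s t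
  proof (rule ccontr)
    assume "\<not> ?thesis"
    then obtain e where e: "e > 0" "\<forall>N. \<exists>n\<ge>N. dist (\<phi> (s n)) (\<phi> t) \<ge> e"
      unfolding lim_sequentially by (meson not_le)
    hence "infinite {n. dist (\<phi> (s n)) (\<phi> t) \<ge> e}" by (auto simp: infinite_nat_iff_unbounded_le)
    then obtain r :: "nat \<Rightarrow> nat" where r: "strict_mono r" "\<And>n. dist (\<phi> (s (r n))) (\<phi> t) \<ge> e"
      using infinite_enumerate by blast
    have "bounded (range (\<lambda>n. \<phi> (s (r n))))" by (rule bounded_subset[OF B]) auto
    then obtain p q where q: "strict_mono q" "((\<lambda>n. \<phi> (s (r n))) \<circ> q) \<longlonglongrightarrow> p"
      using bounded_imp_convergent_subsequence by metis
    have "(\<lambda>n. s (r (q n))) \<longlonglongrightarrow> t"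
      using LIMSEQ_subseq_LIMSEQ[OF LIMSEQ_subseq_LIMSEQ[OF s r(1)] q(1)] by (simp add: o_def)
    with q have "p = \<phi> t" by (intro closed_graph) (auto simp: o_def)
    with q have "\<forall>\<^sub>F n in sequentially. dist (\<phi> (s (r (q n)))) (\<phi> t) < e"
      using e(1) by (auto simp: o_def tendsto_iff)
    thus False using r(2) by (meson eventually_sequentially le_refl not_le)
  qed
  define F where "F n = {t. norm (\<phi> t) \<le> n}" for n :: real
  have closedF: "closed (F n)" for n
  proof (unfold closed_sequential_limits, intro allI impI)
    fix s t assume st: "(\<forall>i. s i \<in> F n) \<and> s \<longlonglongrightarrow> t"
    hence "(\<lambda>i. \<phi> (s i)) \<longlonglongrightarrow> \<phi> t" by (intro conv) (auto simp: F_def bounded_iff)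
    from tendsto_norm[OF this] show "t \<in> F n"
      using st unfolding F_def mem_Collect_eq by (rule_tac LIMSEQ_le_const2) auto
  qed
  define S where "S = {t. \<forall>e>0. \<forall>n. \<exists>u\<in>ball t e. norm (\<phi> u) > n}"
  have notS: "\<exists>e>0. \<exists>n. ball t e \<subseteq> F n" if t: "t \<notin> S" for t
    proof -
    obtain e n where "e > 0" "\<forall>u\<in>ball t e. \<not> norm (\<phi> u) > n" using t unfolding S_def by blast
    thus ?thesis unfolding F_def by (intro exI[of _ e] exI[of _ n] conjI) (auto simp: not_less)
  qed
  have closedS: "closed S"
  proof (unfold closed_def open_contains_ball, intro ballI)
    fix t assume "t \<in> - S"
    then obtain e n where e: "e > 0" "ball t e \<subseteq> F n" using notS by blast
    have "ball t e \<subseteq> - S"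
    proof
      fix u assume u: "u \<in> ball t e"
      obtain d where "d > 0" "ball u d \<subseteq> ball t e"
        using openE[OF open_ball u] by blast
      with e have "norm (\<phi> v) \<le> n" if "v \<in> ball u d" for v
        using that unfolding F_def by blast
      with \<open>d > 0\<close> show "u \<in> - S" unfolding S_def using not_less by blast
    qed
    with e show "\<exists>e>0. ball t e \<subseteq> - S" by blast
  qed
  have cont: "isCont \<phi> t" if t: "t \<notin> S" for t
  proof -
    obtain e n where e: "e > 0" "ball t e \<subseteq> F n" using notS t by blast
    have "continuous_on (ball t e) \<phi>"
      unfolding continuous_on_sequentially
    proof (intro allI impI ballI)
      fix s u assume "u \<in> ball t e" "(\<forall>n. s n \<in> ball t e) \<and> s \<longlonglongrightarrow> u"
      hence "(\<lambda>n. \<phi> (s n)) \<longlonglongrightarrow> \<phi> u"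
        using e by (intro conv) (force simp: F_def bounded_iff)+
      thus "(\<phi> \<circ> s) \<longlonglongrightarrow> \<phi> u" by (simp add: o_def)
    qed
    with e show ?thesis by (simp add: continuous_on_eq_continuous_at)
  qed
  have lip: "norm (\<phi> u - \<phi> v) \<le> C * norm (u - v)"
    if U: "convex U" "U \<inter> S = {}" "u \<in> U" "v \<in> U" for U u v
  proof -
    have "\<forall>t\<in>U. \<exists>\<phi>'. (\<phi> has_derivative \<phi>') (at t) \<and> onorm \<phi>' \<le> C"
      using U deriv cont by blast
    then obtain \<phi>' where d: "\<And>t. t \<in> U \<Longrightarrow> (\<phi> has_derivative \<phi>' t) (at t) \<and> onorm (\<phi>' t) \<le> C"
      by metis
    show ?thesis
      by (rule differentiable_bound[where f' = \<phi>', OF U(1)])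
         (use U d in \<open>auto intro: has_derivative_at_withinI\<close>)
  qed
  have "S = {}"
  proof (rule ccontr)
    assume "S \<noteq> {}"
    let ?G = "range (\<lambda>n::nat. S - F (real n))"
    have empty: "\<Inter>?G = {}"
    proof (rule ccontr)
      assume "\<Inter>?G \<noteq> {}"
      then obtain t where "\<And>n::nat. t \<notin> F (real n)" by auto
      thus False using real_arch_simple[of "norm (\<phi> t)"] unfolding F_def by auto
    qed
    have ope: "openin (top_of_set S) (S - F (real n))" for n
      using closedF[of "real n"] by (metis Diff_eq closed_def openin_open_Int)
    \<comment> \<open>Otherwise all these relatively open sets are dense in \<open>S\<close>, and
      Baire makes their intersection dense in \<open>S\<close> too, although it is empty.\<close>
    obtain n :: nat where "\<not> S \<subseteq> closure (S - F (real n))"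
    proof (rule ccontr)
      assume "\<not> thesis"
      hence "\<And>n. S \<subseteq> closure (S - F (real n))" using that by blast
      hence "S \<subseteq> closure (\<Inter>?G)" by (intro Baire[OF closedS]) (auto simp: ope)
      with \<open>S \<noteq> {}\<close> show False unfolding empty by simp
    qed
    then obtain s where s: "s \<in> S" "s \<notin> closure (S - F (real n))" by blast
    then obtain e where e: "e > 0" "\<And>v. v \<in> S \<Longrightarrow> dist s v < e \<Longrightarrow> norm (\<phi> v) \<le> real n"
      unfolding closure_approachable F_def by (auto simp: dist_commute)
    \<comment> \<open>Half the radius, because the point of \<open>S\<close> nearest to
      \<open>t\<close> is then within \<open>e / 2\<close> of \<open>t\<close> and hence within
      \<open>e\<close> of \<open>s\<close>, where \<open>\<phi>\<close> is at most \<open>n\<close>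
      on \<open>S\<close>. The absolute value is there because the sign of \<open>C\<close> is not
      known.\<close>
    have "norm (\<phi> t) \<le> real n + \<bar>C\<bar> * e" if t: "t \<in> ball s (e / 2)" for t
    proof (cases "t \<in> S")
      case True
      hence "norm (\<phi> t) \<le> real n" using e t by simp
      moreover have "\<bar>C\<bar> * e \<ge> 0" using e by simp
      ultimately show ?thesis by linarith
    next
      case False
      define u where "u = closest_point S t"
      have u: "u \<in> S" unfolding u_def using closedS \<open>S \<noteq> {}\<close> by (rule closest_point_in_set)
      have tu: "dist t u \<le> dist t v" if "v \<in> S" for v
        unfolding u_def using closedS that by (rule closest_point_le)
      have tu2: "dist t u < e / 2" using tu[OF s(1)] t by (simp add: dist_commute)
      have "dist s u < e" using tu2 t dist_triangle[of s u t] by (simp add: dist_commute)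
      hence nu: "norm (\<phi> u) \<le> real n" using e u by blast
      have pos: "dist t u > 0" using False u by auto
      \<comment> \<open>The points start at \<open>t\<close> (for \<open>i = 0\<close>) and tend to
        \<open>u\<close> inside the open ball around \<open>t\<close> through \<open>u\<close>,
        which misses \<open>S\<close>; the Lipschitz bound applies to each of them but not to
        \<open>u\<close> itself.\<close>
      define q where "q i = u + (1 / (real i + 1)) *\<^sub>R (t - u)" for i
      have q_lim: "q \<longlonglongrightarrow> u"
      proof -
        have "(\<lambda>i. 1 / (real i + 1)) \<longlonglongrightarrow> 0" by real_asymp
        from tendsto_add[OF tendsto_const tendsto_scaleR[OF this tendsto_const]]
        show ?thesis unfolding q_def by simp
      qed
      have q_ball: "q i \<in> ball t (dist t u)" for i
      proof -
        have eq: "t - q i = (1 - 1 / (real i + 1)) *\<^sub>R (t - u)"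
          unfolding q_def by (simp add: algebra_simps)
        have "\<bar>1 - 1 / (real i + 1)\<bar> < 1" by (simp add: field_simps)
        hence "norm (t - q i) < norm (t - u)"
          using pos unfolding eq norm_scaleR by (simp add: dist_norm)
        thus ?thesis by (simp add: dist_norm)
      qed
      have bd: "norm (\<phi> (q i) - \<phi> t) \<le> C * norm (q i - t)" for i
        by (rule lip[of "ball t (dist t u)"]) (use q_ball[of i] pos tu in force)+
      have bd2: "norm (\<phi> (q i) - \<phi> t) \<le> \<bar>C\<bar> * e" for i
      proof -
        have "norm (q i - t) \<le> e" using q_ball[of i] tu2 e(1) by (simp add: dist_norm norm_minus_commute)
        hence "C * norm (q i - t) \<le> \<bar>C\<bar> * e" by (intro mult_mono) auto
        with bd[of i] show ?thesis by linarith
      qed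
      \<comment> \<open>Continuity at \<open>u\<close> is not known, as \<open>u\<close> lies in
        \<open>S\<close>. The Lipschitz bound keeps \<open>\<phi>\<close> bounded along
        \<open>q\<close>, and this is what \<open>conv\<close> asks for.\<close>
      have "norm (\<phi> (q i)) \<le> norm (\<phi> t) + \<bar>C\<bar> * e" for i
        using bd2[of i] norm_triangle_ineq2[of "\<phi> (q i)" "\<phi> t"] by linarith
      hence "(\<lambda>i. \<phi> (q i)) \<longlonglongrightarrow> \<phi> u" by (intro conv q_lim) (auto simp: bounded_iff)
      hence "(\<lambda>i. norm (\<phi> (q i) - \<phi> t)) \<longlonglongrightarrow> norm (\<phi> u - \<phi> t)" by (intro tendsto_intros)
      hence "norm (\<phi> u - \<phi> t) \<le> \<bar>C\<bar> * e" by (rule LIMSEQ_le_const2) (use bd2 in auto)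
      with nu norm_triangle_ineq2[of "\<phi> t" "\<phi> u"] show ?thesis by (simp add: norm_minus_commute)
    qed
    moreover have "e / 2 > 0" using e(1) by simp
    ultimately have "s \<notin> S" unfolding S_def using not_less by blast
    with s show False by blast
  qed
  thus ?thesis by (intro lip[of UNIV]) auto
qed

text \<open>As \<open>w\<close> is given and continuous at \<open>x\<close>, differentiability of
  \<open>G\<close> at the single point \<open>(x, w x)\<close> is enough: expanding
  \<open>G (p, w p) = 0\<close> there and applying \<open>H\<close> isolates
  \<open>w p - w x\<close> up to a small multiple of the total increment.\<close>

lemma implicit_function_has_derivative:
  fixes G :: "'p::real_normed_vector \<times> 'w::real_normed_vector \<Rightarrow> 'w" and w :: "'p \<Rightarrow> 'w"
  assumes zero: "\<And>p. G (p, w p) = 0"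
    and G': "(G has_derivative G') (at (x, w x))"
    and H: "bounded_linear H" "\<And>k. H (G' (0, k)) = k"
    and cont: "isCont w x"
  shows "(w has_derivative (\<lambda>h. - H (G' (h, 0)))) (at x)"
proof -
  interpret H: bounded_linear H by (rule H)
  interpret G': bounded_linear G' using G' by (rule has_derivative_bounded_linear)
  obtain K where K: "K > 0" "\<And>y. norm (H y) \<le> norm y * K" using H.pos_bounded by blast
  have lin: "bounded_linear (\<lambda>h. H (G' (h, 0)))"
    by (intro bounded_linear_compose[OF H(1)] bounded_linear_compose[OF G'.bounded_linear_axioms]
        bounded_linear_Pair bounded_linear_ident bounded_linear_zero)
  then obtain C where C: "C > 0" "\<And>h. norm (H (G' (h, 0))) \<le> norm h * C"
    using bounded_linear.pos_bounded by blast
  show ?thesis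
    unfolding has_derivative_at_alt
  proof (intro conjI allI impI)
    show "bounded_linear (\<lambda>h. - H (G' (h, 0)))" using lin by (rule bounded_linear_minus)
  next
    fix e :: real assume e: "e > 0"
    \<comment> \<open>The first bound makes \<open>K * \<epsilon> \<le> 1 / 2\<close>, so that half
      of the increment of \<open>w\<close> can be absorbed; absorption bounds the total increment by
      \<open>(2 * C + 2) * norm (p - x)\<close>, and the second bound brings the resulting error
      below \<open>e\<close>.\<close>
    define \<epsilon> where "\<epsilon> = min (1 / (2 * K)) (e / (K * (2 * C + 2)))"
    have \<epsilon>: "\<epsilon> > 0" "K * \<epsilon> \<le> 1 / 2" "K * \<epsilon> * (2 * C + 2) \<le> e"
    proof -
      show "\<epsilon> > 0" unfolding \<epsilon>_def using K C e by simp
      have "\<epsilon> \<le> 1 / (2 * K)" "\<epsilon> \<le> e / (K * (2 * C + 2))" unfolding \<epsilon>_def by auto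
      moreover have "K * (2 * C + 2) > 0" using K C by simp
      ultimately show "K * \<epsilon> \<le> 1 / 2" "K * \<epsilon> * (2 * C + 2) \<le> e"
        using K(1) by (simp_all add: pos_le_divide_eq mult_ac)
    qed
    obtain d where d: "d > 0" "\<And>q. norm (q - (x, w x)) < d \<Longrightarrow>
        norm (G q - G (x, w x) - G' (q - (x, w x))) \<le> \<epsilon> * norm (q - (x, w x))"
      using G' \<epsilon>(1) unfolding has_derivative_at_alt by blast
    obtain d' where d': "d' > 0" "\<And>p. norm (p - x) < d' \<Longrightarrow> norm (w p - w x) < d / 2"
      using cont d(1) unfolding continuous_at_eps_delta dist_norm by (meson half_gt_zero)
    show "\<exists>d>0. \<forall>y. norm (y - x) < d \<longrightarrow>
        norm (w y - w x - - H (G' (y - x, 0))) \<le> e * norm (y - x)"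
    proof (intro exI conjI allI impI)
      show "min d' (d / 2) > 0" using d d' by simp
      fix p assume p: "norm (p - x) < min d' (d / 2)"
      let ?h = "p - x" and ?k = "w p - w x"
      have n: "norm (?h, ?k) \<le> norm ?h + norm ?k" by (rule norm_Pair_le)
      have eq: "(p, w p) - (x, w x) = (?h, ?k)" by simp
      have "norm ?h + norm ?k < d" using p d'(2)[of p] by simp
      hence "norm (G' (?h, ?k)) \<le> \<epsilon> * norm (?h, ?k)"
        using d(2)[of "(p, w p)"] n unfolding eq zero by simp
      also have "\<dots> \<le> \<epsilon> * (norm ?h + norm ?k)" using n \<epsilon>(1) by simp
      finally have r: "norm (G' (?h, ?k)) \<le> \<epsilon> * (norm ?h + norm ?k)" .
      have "G' (?h, ?k) = G' (?h, 0) + G' (0, ?k)" using G'.add[of "(?h, 0)" "(0, ?k)"] by simp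
      hence "H (G' (?h, ?k)) = H (G' (?h, 0)) + ?k" by (simp add: H.add H(2))
      moreover have "norm (H (G' (?h, ?k))) \<le> \<epsilon> * (norm ?h + norm ?k) * K"
        using K(2)[of "G' (?h, ?k)"] mult_right_mono[OF r, of K] K(1) by linarith
      ultimately have m: "norm (?k + H (G' (?h, 0))) \<le> K * \<epsilon> * (norm ?h + norm ?k)"
        by (simp add: mult_ac add.commute)
      have "K * \<epsilon> * (norm ?h + norm ?k) \<le> 1 / 2 * (norm ?h + norm ?k)"
        using \<epsilon>(2) by (intro mult_right_mono) auto
      moreover have "norm ?k \<le> norm (?k + H (G' (?h, 0))) + norm (H (G' (?h, 0)))"
        using norm_triangle_ineq4[of "?k + H (G' (?h, 0))" "H (G' (?h, 0))"] by simp
      ultimately have "norm ?h + norm ?k \<le> (2 * C + 2) * norm ?h"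
        using m C(2)[of ?h] by (simp add: algebra_simps)
      hence "K * \<epsilon> * (norm ?h + norm ?k) \<le> K * \<epsilon> * ((2 * C + 2) * norm ?h)"
        using K \<epsilon> by (intro mult_left_mono) auto
      also have "\<dots> \<le> e * norm ?h"
        using mult_right_mono[OF \<epsilon>(3), of "norm ?h"] by (simp add: mult_ac)
      finally show "norm (w p - w x - - H (G' (p - x, 0))) \<le> e * norm (p - x)" using m by simp
    qed
  qed
qed

section \<open>Bounded Lipschitz maps\<close>

text \<open>Boundedness is included because products of Lipschitz maps are again Lipschitz when both
  factors are bounded; the class is then closed under sums and bounded bilinear products.\<close>

definition lip_bdd :: "'a::metric_space set \<Rightarrow> ('a \<Rightarrow> 'b::real_normed_vector) \<Rightarrow> bool" where
  "lip_bdd S F \<longleftrightarrow> (\<exists>L. L-lipschitz_on S F) \<and> bounded (F ` S)"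

lemma lip_bddI:
  assumes "\<And>p q. p \<in> S \<Longrightarrow> q \<in> S \<Longrightarrow> norm (F p - F q) \<le> L * dist p q" "\<And>p. p \<in> S \<Longrightarrow> norm (F p) \<le> C"
  shows "lip_bdd S F"
proof -
  have "\<bar>L\<bar>-lipschitz_on S F"
  proof (rule lipschitz_onI)
    fix p q assume "p \<in> S" "q \<in> S"
    with assms(1) have "dist (F p) (F q) \<le> L * dist p q" by (simp add: dist_norm)
    also have "\<dots> \<le> \<bar>L\<bar> * dist p q" by (intro mult_right_mono) auto
    finally show "dist (F p) (F q) \<le> \<bar>L\<bar> * dist p q" .
  qed auto
  thus ?thesis using assms(2) unfolding lip_bdd_def by (auto simp: bounded_iff)
qed

lemma lip_bddE:
  assumes "lip_bdd S F"
  obtains L C where "L \<ge> 0" "C \<ge> 0" "\<And>p q. p \<in> S \<Longrightarrow> q \<in> S \<Longrightarrow> norm (F p - F q) \<le> L * dist p q"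
    "\<And>p. p \<in> S \<Longrightarrow> norm (F p) \<le> C"
proof -
  obtain L where L: "L-lipschitz_on S F" using assms unfolding lip_bdd_def by blast
  obtain C where C: "C > 0" "\<And>p. p \<in> S \<Longrightarrow> norm (F p) \<le> C"
    using assms unfolding lip_bdd_def bounded_pos by auto
  show ?thesis
    by (rule that[of L C]) (use L C lipschitz_on_nonneg lipschitz_onD[OF L] in \<open>auto simp: dist_norm\<close>)
qed

lemma lip_bdd_lipschitz: "lip_bdd S F \<Longrightarrow> \<exists>L. L-lipschitz_on S F"
  by (simp add: lip_bdd_def)

lemma lip_bdd_const: "lip_bdd S (\<lambda>p. c)"
  unfolding lip_bdd_def using lipschitz_on_constant by (auto simp: bounded_iff)

lemma lip_bdd_add:
  assumes "lip_bdd S F" "lip_bdd S G" shows "lip_bdd S (\<lambda>p. F p + G p)"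
  using assms unfolding lip_bdd_def by (auto intro: lipschitz_on_add bounded_plus_comp)

lemma lip_bdd_sum:
  "(\<And>i. i \<in> I \<Longrightarrow> lip_bdd S (F i)) \<Longrightarrow> lip_bdd S (\<lambda>p. \<Sum>i\<in>I. F i p)"
  by (induction I rule: infinite_finite_induct) (auto intro: lip_bdd_add lip_bdd_const)

lemma lip_bdd_bilinear:
  assumes "bounded_bilinear pr" and F: "lip_bdd S F" and G: "lip_bdd S G"
  shows "lip_bdd S (\<lambda>p. pr (F p) (G p))"
proof -
  interpret bounded_bilinear pr by fact
  obtain K where K: "K \<ge> 0" "\<And>a b. norm (pr a b) \<le> norm a * norm b * K" using nonneg_bounded by blast
  obtain L\<^sub>F C\<^sub>F where F: "L\<^sub>F \<ge> 0" "C\<^sub>F \<ge> 0" "\<And>p q. p \<in> S \<Longrightarrow> q \<in> S \<Longrightarrow> norm (F p - F q) \<le> L\<^sub>F * dist p q"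
    "\<And>p. p \<in> S \<Longrightarrow> norm (F p) \<le> C\<^sub>F" using F by (rule lip_bddE) blast
  obtain L\<^sub>G C\<^sub>G where G: "L\<^sub>G \<ge> 0" "C\<^sub>G \<ge> 0" "\<And>p q. p \<in> S \<Longrightarrow> q \<in> S \<Longrightarrow> norm (G p - G q) \<le> L\<^sub>G * dist p q"
    "\<And>p. p \<in> S \<Longrightarrow> norm (G p) \<le> C\<^sub>G" using G by (rule lip_bddE) blast
  show ?thesis
  proof (rule lip_bddI[where L = "(L\<^sub>F * C\<^sub>G + C\<^sub>F * L\<^sub>G) * K" and C = "C\<^sub>F * C\<^sub>G * K"])
    fix p q assume pq: "p \<in> S" "q \<in> S"
    have "pr (F p) (G p) - pr (F q) (G q) = pr (F p - F q) (G p) + pr (F q) (G p - G q)"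
      by (simp add: diff_left diff_right)
    also have "norm \<dots> \<le> norm (F p - F q) * norm (G p) * K + norm (F q) * norm (G p - G q) * K"
      by (intro norm_triangle_le add_mono K)
    also have "\<dots> \<le> (L\<^sub>F * dist p q) * C\<^sub>G * K + C\<^sub>F * (L\<^sub>G * dist p q) * K"
      using F G K pq by (intro add_mono mult_mono mult_right_mono) auto
    finally show "norm (pr (F p) (G p) - pr (F q) (G q)) \<le> (L\<^sub>F * C\<^sub>G + C\<^sub>F * L\<^sub>G) * K * dist p q"
      by (simp add: algebra_simps)
  next
    fix p assume "p \<in> S"
    hence "norm (F p) * norm (G p) * K \<le> C\<^sub>F * C\<^sub>G * K"
      using F G K by (intro mult_mono mult_right_mono) auto
    thus "norm (pr (F p) (G p)) \<le> C\<^sub>F * C\<^sub>G * K" using K(2)[of "F p" "G p"] by linarith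
  qed
qed

lemma lip_bdd_linear:
  assumes "bounded_linear T" "lip_bdd S F" shows "lip_bdd S (\<lambda>p. T (F p))"
proof -
  interpret T: bounded_linear T by fact
  obtain K where K: "\<And>y. norm (T y) \<le> norm y * K" "K \<ge> 0" using T.nonneg_bounded by blast
  obtain L C where F: "L \<ge> 0" "C \<ge> 0" "\<And>p q. p \<in> S \<Longrightarrow> q \<in> S \<Longrightarrow> norm (F p - F q) \<le> L * dist p q"
    "\<And>p. p \<in> S \<Longrightarrow> norm (F p) \<le> C" using assms(2) by (rule lip_bddE) blast
  show ?thesis
  proof (rule lip_bddI[where L = "L * K" and C = "C * K"])
    fix p q assume pq: "p \<in> S" "q \<in> S"
    have "norm (T (F p) - T (F q)) \<le> norm (F p - F q) * K" using K by (simp flip: T.diff)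
    also have "\<dots> \<le> L * dist p q * K" using F(3)[OF pq] K by (intro mult_right_mono) auto
    finally show "norm (T (F p) - T (F q)) \<le> L * K * dist p q" by (simp add: mult_ac)
  next
    fix p assume "p \<in> S"
    hence "norm (F p) * K \<le> C * K" using F K by (intro mult_right_mono) auto
    thus "norm (T (F p)) \<le> C * K" using K(1)[of "F p"] by linarith
  qed
qed

lemma lip_bdd_uminus: "lip_bdd S F \<Longrightarrow> lip_bdd S (\<lambda>p. - F p)"
  by (rule lip_bdd_linear) (auto intro: bounded_linear_minus bounded_linear_ident)

lemma lip_bdd_compose:
  assumes F: "lip_bdd S F" and w: "K-lipschitz_on T w" "w ` T \<subseteq> S"
  shows "lip_bdd T (\<lambda>x. F (w x))"
proof -
  obtain L where "L-lipschitz_on S F" using F unfolding lip_bdd_def by blast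
  hence "(L * K)-lipschitz_on T (\<lambda>x. F (w x))"
    using w by (intro lipschitz_on_compose2) (auto intro: lipschitz_on_subset)
  moreover have "bounded ((\<lambda>x. F (w x)) ` T)"
    by (rule bounded_subset[of "F ` S"]) (use F w in \<open>auto simp: lip_bdd_def\<close>)
  ultimately show ?thesis unfolding lip_bdd_def by blast
qed

lemma binv_works:
  fixes B :: "'a::euclidean_space \<Rightarrow>\<^sub>L 'a"
  assumes "bij (blinfun_apply B)"
  shows "blinfun_apply (binv B) (blinfun_apply B h) = h" "blinfun_apply B (blinfun_apply (binv B) h) = h"
proof -
  have "linear (inv (blinfun_apply B))"
    using assms by (intro inj_linear_imp_inv_linear) (auto simp: bij_def intro: bounded_linear.linear blinfun.bounded_linear_right)
  hence "blinfun_apply (binv B) = inv (blinfun_apply B)"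
    unfolding binv_def by (intro bounded_linear_Blinfun_apply) (simp add: linear_conv_bounded_linear)
  thus "blinfun_apply (binv B) (blinfun_apply B h) = h" "blinfun_apply B (blinfun_apply (binv B) h) = h"
    using assms by (simp_all add: bij_is_inj bij_is_surj surj_f_inv_f)
qed

section \<open>The gradient of an implicitly defined objective\<close>

text \<open>\<open>B\<close> is the adjoint of the partial derivative
  \<open>k \<mapsto> G' (0, k)\<close>. If this map kills \<open>k\<close>, pairing with the
  \<open>B\<close>-preimage of \<open>k\<close> gives \<open>k \<bullet> k = 0\<close>; injectivity
  then gives a two-sided inverse by equality of dimensions.\<close>

lemma partial_derivative_inverse:
  fixes G' :: "'x::euclidean_space \<times> 'w::euclidean_space \<Rightarrow> 'w"
  assumes G': "linear G'"
    "\<And>h k l. l \<bullet> G' (h, k) = blinfun_apply A l \<bullet> h + blinfun_apply B l \<bullet> k"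
    and bij: "bij (blinfun_apply B)"
  obtains H where "bounded_linear H" "\<And>k. H (G' (0, k)) = k" "\<And>y. G' (0, H y) = y"
proof -
  define T where "T k = G' (0, k)" for k
  have Tl: "l \<bullet> T k = blinfun_apply B l \<bullet> k" for l k unfolding T_def G'(2) by simp
  have linT: "linear T"
    by (rule linearI; rule vector_eq_ldot[THEN iffD1]) (auto simp: Tl inner_add_right)
  have "inj T"
  proof (subst linear_injective_0[OF linT], intro allI impI)
    fix k assume "T k = 0"
    hence "blinfun_apply B (blinfun_apply (binv B) k) \<bullet> k = 0"
      using Tl[of "blinfun_apply (binv B) k" k] by simp
    thus "k = 0" by (simp add: binv_works[OF bij])
  qed
  then obtain H where H: "linear H" "H \<circ> T = id"
    using linear_injective_left_inverse[OF linT] by blast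
  hence "T \<circ> H = id" using linear_inverse_left[OF H(1) linT] by simp
  with H show ?thesis
    by (intro that[of H]) (auto simp: linear_conv_bounded_linear T_def fun_eq_iff)
qed

text \<open>The resolvent identity \<open>B^-1 - C^-1 = B^-1 (C - B) C^-1\<close>. The map
  \<open>B\<close> itself may be unbounded.\<close>

lemma lip_bdd_binv:
  fixes B :: "'a::metric_space \<Rightarrow> 'w::euclidean_space \<Rightarrow>\<^sub>L 'w"
  assumes L: "L-lipschitz_on S B" and bij: "\<And>p. p \<in> S \<Longrightarrow> bij (blinfun_apply (B p))"
    and bd: "bounded ((\<lambda>p. binv (B p)) ` S)"
  shows "lip_bdd S (\<lambda>p. binv (B p))"
proof -
  obtain C where C: "C > 0" "\<And>p. p \<in> S \<Longrightarrow> norm (binv (B p)) \<le> C"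
    using bd unfolding bounded_pos by auto
  show ?thesis
  proof (rule lip_bddI[where L = "C * L * C" and C = C])
    fix p q assume pq: "p \<in> S" "q \<in> S"
    have "binv (B p) - binv (B q) = binv (B p) o\<^sub>L (B q - B p) o\<^sub>L binv (B q)"
      by (rule blinfun_eqI) (simp add: blinfun.diff_left blinfun.diff_right binv_works bij pq)
    also have "norm \<dots> \<le> norm (binv (B p)) * norm (B q - B p) * norm (binv (B q))"
      by (intro order_trans[OF norm_blinfun_compose] mult_right_mono norm_blinfun_compose norm_ge_zero)
    also have "\<dots> \<le> C * (L * dist p q) * C"
      using C pq lipschitz_onD[OF L pq] lipschitz_on_nonneg[OF L]
      by (intro mult_mono) (auto simp: dist_norm norm_minus_commute)
    finally show "norm (binv (B p) - binv (B q)) \<le> C * L * C * dist p q" by (simp add: mult_ac)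
  qed (use C in auto)
qed

text \<open>The chain rule gives the gradient \<open>a\<close> plus the adjoint of \<open>w'\<close>
  applied to \<open>b\<close>. Because \<open>A\<close> and \<open>B\<close> are transposed
  Jacobians, that adjoint is \<open>- A B^-1\<close>, the transpose of the usual implicit
  derivative. Its norm is bounded uniformly, so \<open>w\<close> is globally Lipschitz and composing
  with \<open>x \<mapsto> (x, w x)\<close> preserves \<open>lip_bdd\<close>.\<close>

lemma implicit_gradient:
  fixes w :: "'x::euclidean_space \<Rightarrow> 'w::euclidean_space" and P :: "('x \<times> 'w) set"
    and a :: "'x \<times> 'w \<Rightarrow> 'x" and b :: "'x \<times> 'w \<Rightarrow> 'w"
    and A :: "'x \<times> 'w \<Rightarrow> 'w \<Rightarrow>\<^sub>L 'x" and B :: "'x \<times> 'w \<Rightarrow> 'w \<Rightarrow>\<^sub>L 'w"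
    and F :: "'x \<times> 'w \<Rightarrow> real" and G :: "'x \<times> 'w \<Rightarrow> 'w"
  assumes graph: "\<And>x. (x, w x) \<in> P"
    and F: "\<And>x. GDERIV F (x, w x) :> (a (x, w x), b (x, w x))"
    and zero: "\<And>x. G (x, w x) = 0"
    and G: "\<And>x. \<exists>G'. (G has_derivative G') (at (x, w x)) \<and>
      (\<forall>h k l. l \<bullet> G' (h, k) = blinfun_apply (A (x, w x)) l \<bullet> h + blinfun_apply (B (x, w x)) l \<bullet> k)"
    and bij: "\<And>p. p \<in> P \<Longrightarrow> bij (blinfun_apply (B p))"
    and regular: "lip_bdd P a" "lip_bdd P b" "lip_bdd P A" "L\<^sub>B-lipschitz_on P B"
      "bounded ((\<lambda>p. binv (B p)) ` P)"
    and closed_graph: "\<And>s x p. s \<longlonglongrightarrow> x \<Longrightarrow> (\<lambda>n. w (s n)) \<longlonglongrightarrow> p \<Longrightarrow> p = w x"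
  defines "g \<equiv> \<lambda>x. a (x, w x) - blinfun_apply (A (x, w x)) (blinfun_apply (binv (B (x, w x))) (b (x, w x)))"
  shows "GDERIV (\<lambda>x. F (x, w x)) x :> g x" and "lip_bdd UNIV g"
proof -
  have binv: "lip_bdd P (\<lambda>p. binv (B p))" by (rule lip_bdd_binv[OF regular(4) bij regular(5)])
  obtain L\<^sub>A C\<^sub>A where A: "C\<^sub>A \<ge> 0" "\<And>p. p \<in> P \<Longrightarrow> norm (A p) \<le> C\<^sub>A"
    using regular(3) by (rule lip_bddE) blast
  obtain L\<^sub>i C\<^sub>i where Bi: "C\<^sub>i \<ge> 0" "\<And>p. p \<in> P \<Longrightarrow> norm (binv (B p)) \<le> C\<^sub>i"
    using binv by (rule lip_bddE) blast
  have wderiv: "\<exists>w'. (w has_derivative w') (at x) \<and> onorm w' \<le> C\<^sub>A * C\<^sub>i \<and>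
      (\<forall>h l. w' h \<bullet> l = - (blinfun_apply (A (x, w x)) (blinfun_apply (binv (B (x, w x))) l) \<bullet> h))"
    if cont: "isCont w x" for x
  proof -
    let ?A = "blinfun_apply (A (x, w x))" and ?B = "blinfun_apply (B (x, w x))"
    let ?Bi = "blinfun_apply (binv (B (x, w x)))"
    note inv = binv_works[OF bij[OF graph[of x]]]
    obtain G' where G': "(G has_derivative G') (at (x, w x))"
      "\<And>h k l. l \<bullet> G' (h, k) = ?A l \<bullet> h + ?B l \<bullet> k" using G[of x] by blast
    have "linear G'" using has_derivative_linear[OF G'(1)] .
    then obtain H where H: "bounded_linear H" "\<And>k. H (G' (0, k)) = k" "\<And>y. G' (0, H y) = y"
      using partial_derivative_inverse[OF _ G'(2) bij[OF graph]] by blast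
    define w' where "w' h = - H (G' (h, 0))" for h
    have der: "(w has_derivative w') (at x)"
      unfolding w'_def
      by (rule implicit_function_has_derivative[OF zero G'(1) H(1,2) cont])
    have inner: "w' h \<bullet> l = - (?A (?Bi l) \<bullet> h)" for h l
    proof -
      have "H y \<bullet> l = ?Bi l \<bullet> y" for y
        using G'(2)[of "?Bi l" 0 "H y"] by (simp add: inv H(3) inner_commute)
      thus ?thesis unfolding w'_def by (simp add: G'(2))
    qed
    \<comment> \<open>The adjoint identity bounds \<open>w'\<close> through \<open>A B^-1\<close>:
      test it with \<open>l = w' h\<close> and cancel one factor \<open>norm (w' h)\<close>.\<close>
    have "onorm w' \<le> C\<^sub>A * C\<^sub>i"
    proof (rule onorm_bound)
      fix h
      have "norm (w' h) * norm (w' h) = - (?A (?Bi (w' h)) \<bullet> h)"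
        using inner[of h "w' h"] by (simp add: power2_norm_eq_inner flip: power2_eq_square)
      also have "\<dots> \<le> norm (?A (?Bi (w' h))) * norm h"
        using Cauchy_Schwarz_ineq2[of "?A (?Bi (w' h))" h] by linarith
      also have "norm (?A (?Bi (w' h))) \<le> C\<^sub>A * (C\<^sub>i * norm (w' h))"
        by (rule order_trans[OF norm_blinfun], rule mult_mono[OF _ order_trans[OF norm_blinfun]])
           (use A Bi graph in \<open>auto intro!: mult_right_mono\<close>)
      finally have "norm (w' h) * norm (w' h) \<le> (C\<^sub>A * C\<^sub>i * norm h) * norm (w' h)"
        by (simp add: mult_ac mult_left_mono mult_right_mono)
      thus "norm (w' h) \<le> C\<^sub>A * C\<^sub>i * norm h"
        using A(1) Bi(1) by (cases "w' h = 0") auto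
    qed (use A Bi in simp)
    with der inner show ?thesis by blast
  qed
  have wlip: "norm (w x - w y) \<le> C\<^sub>A * C\<^sub>i * norm (x - y)" for x y
    by (rule lipschitz_if_closed_graph[OF closed_graph]) (use wderiv in blast)+
  hence lip: "(C\<^sub>A * C\<^sub>i)-lipschitz_on UNIV w"
    using A Bi by (intro lipschitz_onI) (auto simp: dist_norm)
  have cont: "isCont w x" for x
    using lipschitz_on_continuous_on[OF lip] by (simp add: continuous_on_eq_continuous_at)
  obtain w' where w': "(w has_derivative w') (at x)"
    "\<And>h l. w' h \<bullet> l = - (blinfun_apply (A (x, w x)) (blinfun_apply (binv (B (x, w x))) l) \<bullet> h)"
    using wderiv[OF cont] by blast
  have "((\<lambda>x. (x, w x)) has_derivative (\<lambda>h. (h, w' h))) (at x)"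
    by (intro has_derivative_Pair w' has_derivative_ident)
  hence "((\<lambda>x. F (x, w x)) has_derivative (\<lambda>h. (h, w' h) \<bullet> (a (x, w x), b (x, w x)))) (at x)"
    using F[of x, unfolded gderiv_def] by (rule has_derivative_compose)
  thus "GDERIV (\<lambda>x. F (x, w x)) x :> g x"
    unfolding gderiv_def g_def by (simp add: w'(2) inner_diff_right inner_commute)
  have "lip_bdd P (\<lambda>p. a p - blinfun_apply (A p) (blinfun_apply (binv (B p)) (b p)))"
    unfolding diff_conv_add_uminus
    by (intro lip_bdd_add lip_bdd_uminus lip_bdd_bilinear[OF bounded_bilinear_blinfun_apply] regular binv)
  thus "lip_bdd UNIV g" unfolding g_def
    by (rule lip_bdd_compose[where w = "\<lambda>x. (x, w x)"])
       (use graph lip in \<open>auto intro!: lipschitz_on_Pair lipschitz_on_id\<close>)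
qed

section \<open>Descent of the stochastic gradient method\<close>

lemma GDERIV_unique:
  assumes "GDERIV f x :> D" "GDERIV f x :> D'" shows "D = D'"
proof -
  have "(\<lambda>h. h \<bullet> D) = (\<lambda>h. h \<bullet> D')"
    using assms unfolding gderiv_def by (rule has_derivative_unique)
  thus ?thesis by (metis vector_eq_ldot)
qed

lemma grad_eqI: "GDERIV f x :> D \<Longrightarrow> grad f x = D"
  unfolding grad_def using GDERIV_unique by (blast intro: the_equality)

text \<open>The tower property, in the form of \<open>nn_cond_exp_intg\<close> with constant weight
  1. Working with nonnegative integrals gives a finite bound first, so integrability comes out as a
  conclusion.\<close>

lemma cond_mean_le_expectation:
  assumes M: "prob_space M" and Z: "Z \<in> borel_measurable M"
    and g: "cond_mean_le M Z g c" "\<And>\<omega>. g \<omega> \<ge> 0" and c: "c \<ge> 0"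
  shows "integrable M g" and "(\<integral>\<omega>. g \<omega> \<partial>M) \<le> c"
proof -
  interpret prob_space M by fact
  let ?F = "vimage_algebra (space M) Z borel"
  have [measurable]: "g \<in> borel_measurable M" using g(1) unfolding cond_mean_le_def by blast
  have "subalgebra M ?F"
    unfolding subalgebra_def using Z by (auto simp: sets_vimage_algebra2 measurable_def)
  then interpret finite_measure_subalgebra M ?F by unfold_locales
  have "(\<integral>\<^sup>+ \<omega>. ennreal (g \<omega>) \<partial>M) = (\<integral>\<^sup>+ \<omega>. 1 * ennreal (g \<omega>) \<partial>M)" by simp
  also have "\<dots> = (\<integral>\<^sup>+ \<omega>. 1 * nn_cond_exp M ?F (\<lambda>\<omega>. ennreal (g \<omega>)) \<omega> \<partial>M)"
    by (rule nn_cond_exp_intg[symmetric]) auto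
  also have "\<dots> \<le> (\<integral>\<^sup>+ \<omega>. ennreal c \<partial>M)"
    using g(1) unfolding cond_mean_le_def by (intro nn_integral_mono_AE) auto
  finally have le: "(\<integral>\<^sup>+ \<omega>. ennreal (g \<omega>) \<partial>M) \<le> ennreal c" by (simp add: emeasure_space_1)
  thus int: "integrable M g"
    using g(2) by (intro integrableI_nonneg) (auto intro: order_le_less_trans)
  have "ennreal (\<integral>\<omega>. g \<omega> \<partial>M) \<le> ennreal c"
    using le nn_integral_eq_integral[OF int] g(2) by simp
  thus "(\<integral>\<omega>. g \<omega> \<partial>M) \<le> c" using c by (simp add: ennreal_le_iff)
qed

section \<open>Deterministic estimates for one projected step\<close>

lemma GDERIV_mvt:
  assumes "\<And>z. GDERIV f z :> g z"
  obtains z where "z \<in> closed_segment x y" "f y - f x = (y - x) \<bullet> g z"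
proof -
  define h where "h t = x + t *\<^sub>R (y - x)" for t :: real
  have "\<exists>t\<in>{0..1}. f (h 1) - f (h 0) = ((1 - 0) *\<^sub>R (y - x)) \<bullet> g (h t)"
  proof (rule mvt_very_simple)
    fix t :: real
    have "(h has_derivative (\<lambda>s. s *\<^sub>R (y - x))) (at t within {0..1})"
      unfolding h_def by (auto intro!: derivative_eq_intros)
    moreover have "(f has_derivative (\<lambda>k. k \<bullet> g (h t))) (at (h t))"
      using assms unfolding gderiv_def by blast
    ultimately show "((\<lambda>t. f (h t)) has_derivative (\<lambda>s. (s *\<^sub>R (y - x)) \<bullet> g (h t))) (at t within {0..1})"
      by (rule has_derivative_compose)
  qed simp
  then obtain t where t: "0 \<le> t" "t \<le> 1" "f y - f x = (y - x) \<bullet> g (h t)"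
    unfolding h_def by auto
  have "h t = (1 - t) *\<^sub>R x + t *\<^sub>R y" unfolding h_def by (simp add: algebra_simps)
  with t that show ?thesis unfolding in_segment by blast
qed

text \<open>The constant is \<open>L\<close> rather than \<open>L / 2\<close> because the gradient
  is evaluated at one intermediate point instead of being integrated along the segment; the size of
  the constant does not matter for summability.\<close>

lemma lipschitz_gradient_upper_bound:
  assumes g: "\<And>z. GDERIV f z :> g z" and L: "\<And>y z. norm (g y - g z) \<le> L * norm (y - z)" "L \<ge> 0"
  shows "f y \<le> f x + g x \<bullet> (y - x) + L * (norm (y - x))\<^sup>2"
proof -
  obtain z where z: "z \<in> closed_segment x y" "f y - f x = (y - x) \<bullet> g z"
    using g by (rule GDERIV_mvt)
  have "(y - x) \<bullet> (g z - g x) \<le> norm (y - x) * norm (g z - g x)" by (rule norm_cauchy_schwarz)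
  also have "\<dots> \<le> norm (y - x) * (L * norm (z - x))" by (intro mult_left_mono L) auto
  also have "\<dots> \<le> norm (y - x) * (L * norm (y - x))"
    using segment_bound(1)[OF z(1)] L(2) by (intro mult_left_mono) auto
  finally show ?thesis using z(2) by (simp add: inner_diff_right inner_commute power2_eq_square mult_ac)
qed

text \<open>The exact projected step \<open>y\<close> is the reference point. The variational
  inequality of the projection, tested with \<open>x\<close>, gives
  \<open>g x \<bullet> (x - y)\<close> at least \<open>\<alpha>\<close> times the squared projected
  gradient. Nonexpansiveness bounds \<open>x' - y\<close> by \<open>\<alpha>\<close> times the
  direction error, so an error in \<open>d\<close> costs only a first-order term weighted by
  \<open>\<Gamma>\<close>.\<close>

lemma projected_step_decrease:
  fixes X :: "'x::euclidean_space set" and d :: 'x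
  assumes X: "closed X" "convex X" "x \<in> X" and \<alpha>: "\<alpha> > 0"
    and f: "\<And>z. GDERIV f z :> g z" "\<And>y z. norm (g y - g z) \<le> L * norm (y - z)" "L \<ge> 0"
    and \<Gamma>: "norm (g x) \<le> \<Gamma>"
  defines "x' \<equiv> closest_point X (x + \<alpha> *\<^sub>R d)"
  shows "\<alpha> * (norm (proj_grad X \<alpha> x (g x)))\<^sup>2
      \<le> f x - f x' + \<Gamma> * \<alpha> * norm (d + g x) + L * \<alpha>\<^sup>2 * (norm d)\<^sup>2"
    and "norm (x' - x) \<le> \<alpha> * norm d"
proof -
  have ne: "X \<noteq> {}" using X by auto
  note nonexp = closest_point_lipschitz[OF X(2,1) ne, unfolded dist_norm]
  define y where "y = closest_point X (x - \<alpha> *\<^sub>R g x)"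
  have y: "y \<in> X" unfolding y_def by (rule closest_point_in_set[OF X(1) ne])
  have "norm (closest_point X (x + \<alpha> *\<^sub>R d) - closest_point X x) \<le> norm (x + \<alpha> *\<^sub>R d - x)"
    by (rule nonexp)
  thus step: "norm (x' - x) \<le> \<alpha> * norm d"
    using closest_point_self[OF X(3)] \<alpha> unfolding x'_def by simp
  have "(x - \<alpha> *\<^sub>R g x - y) \<bullet> (x - y) \<le> 0"
    unfolding y_def by (rule closest_point_dot[OF X(2,1,3)])
  hence "(norm (x - y))\<^sup>2 \<le> \<alpha> * (g x \<bullet> (x - y))"
    unfolding power2_norm_eq_inner by (simp add: inner_diff_left algebra_simps)
  moreover have "x - y = \<alpha> *\<^sub>R proj_grad X \<alpha> x (g x)"
    unfolding proj_grad_def y_def using \<alpha> by simp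
  hence "(norm (x - y))\<^sup>2 = \<alpha> * (\<alpha> * (norm (proj_grad X \<alpha> x (g x)))\<^sup>2)"
    by (simp add: power_mult_distrib power2_eq_square)
  ultimately have p: "\<alpha> * (norm (proj_grad X \<alpha> x (g x)))\<^sup>2 \<le> g x \<bullet> (x - y)" using \<alpha> by simp
  have "norm (x' - y) \<le> norm (x + \<alpha> *\<^sub>R d - (x - \<alpha> *\<^sub>R g x))"
    unfolding x'_def y_def by (rule nonexp)
  also have "x + \<alpha> *\<^sub>R d - (x - \<alpha> *\<^sub>R g x) = \<alpha> *\<^sub>R (d + g x)" by (simp add: algebra_simps)
  finally have d: "norm (x' - y) \<le> \<alpha> * norm (d + g x)" using \<alpha> by simp
  have "g x \<bullet> (x' - y) \<le> norm (g x) * norm (x' - y)" by (rule norm_cauchy_schwarz)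
  also have "\<dots> \<le> \<Gamma> * (\<alpha> * norm (d + g x))"
    using \<Gamma> d order_trans[OF norm_ge_zero \<Gamma>] by (intro mult_mono) auto
  finally have q: "g x \<bullet> (x' - y) \<le> \<Gamma> * (\<alpha> * norm (d + g x))" .
  have "(norm (x' - x))\<^sup>2 \<le> (\<alpha> * norm d)\<^sup>2" using step by (rule power_mono) simp
  hence "L * (norm (x' - x))\<^sup>2 \<le> L * (\<alpha> * norm d)\<^sup>2" using f(3) by (rule mult_left_mono)
  hence "f x' \<le> f x + g x \<bullet> (x' - x) + L * (\<alpha> * norm d)\<^sup>2"
    using lipschitz_gradient_upper_bound[OF f, of x' x] by linarith
  moreover have "g x \<bullet> (x' - x) = g x \<bullet> (x' - y) - g x \<bullet> (x - y)"
    by (simp add: inner_diff_right)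
  ultimately show "\<alpha> * (norm (proj_grad X \<alpha> x (g x)))\<^sup>2
      \<le> f x - f x' + \<Gamma> * \<alpha> * norm (d + g x) + L * \<alpha>\<^sup>2 * (norm d)\<^sup>2"
    using p q by (simp add: power_mult_distrib mult_ac)
qed

text \<open>Only total expectations enter: the descent inequality holds pathwise with random
  majorants \<open>e k\<close> of the direction error and \<open>q k\<close> of the squared
  direction norm, whose means are at most \<open>C\<^sub>1 * \<alpha> k\<close> and
  \<open>C\<^sub>2\<close>.\<close>

lemma (in bsg_assumptions) bsg_convergence:
  assumes X: "closed X" "convex X"
    and steps: "filterlim (\<lambda>K. \<Sum>k\<le>K. \<alpha> k) at_top sequentially" "summable (\<lambda>k. (\<alpha> k)\<^sup>2)"
    and grad_f: "\<And>x. GDERIV f x :> - direction (D x (w x)) 0"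
    and grad_regular: "lip_bdd UNIV (\<lambda>x. - direction (D x (w x)) 0)"
    and D_lipschitz: "\<And>k \<omega>. \<omega> \<in> space M \<Longrightarrow>
      norm (D (iterate R k \<omega>) (approx R k \<omega>) - D (iterate R k \<omega>) (w (iterate R k \<omega>)))
        \<le> L\<^sub>D * norm (w (iterate R k \<omega>) - approx R k \<omega>)"
  shows "integrable M (weighted_sum X f \<alpha> (iterate R) K)" (is "?thesis1")
    and "convergent (\<lambda>K. \<integral>\<omega>. weighted_sum X f \<alpha> (iterate R) K \<omega> \<partial>M)" (is "?thesis2")
    and "(\<lambda>K. \<integral>\<omega>. (1 / (\<Sum>k\<le>K. \<alpha> k)) * weighted_sum X f \<alpha> (iterate R) K \<omega> \<partial>M) \<longlonglongrightarrow> 0" (is "?thesis3")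
proof -
  define g where "g x = - direction (D x (w x)) 0" for x
  have g: "GDERIV f x :> g x" for x unfolding g_def by (rule grad_f)
  have grad_eq: "grad f = g" using grad_eqI[OF g] by blast
  obtain L \<Gamma> where L: "L \<ge> 0" "\<Gamma> \<ge> 0" "\<And>y z. norm (g y - g z) \<le> L * norm (y - z)" "\<And>z. norm (g z) \<le> \<Gamma>"
    using grad_regular by (rule lip_bddE) (auto simp: g_def dist_norm)
  have f_lip: "\<bar>f y - f x\<bar> \<le> \<Gamma> * norm (y - x)" for x y
  proof -
    obtain z where "f y - f x = (y - x) \<bullet> g z" using g by (rule GDERIV_mvt)
    hence "\<bar>f y - f x\<bar> \<le> norm (y - x) * norm (g z)" by (simp add: Cauchy_Schwarz_ineq2)
    also have "\<dots> \<le> norm (y - x) * \<Gamma>" by (intro mult_left_mono L) auto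
    finally show ?thesis by (simp add: mult.commute)
  qed
  have f_cont: "continuous_on UNIV f"
    using g unfolding gderiv_def
    by (intro continuous_at_imp_continuous_on ballI) (auto intro: has_derivative_continuous)
  have g_cont: "continuous_on UNIV g"
    using lip_bdd_lipschitz[OF grad_regular] unfolding g_def by (auto intro: lipschitz_on_continuous_on)
  have X_ne: "X \<noteq> {}" using init(1) by blast
  have iter_X: "iterate R k \<omega> \<in> X" if "\<omega> \<in> space M" for k \<omega>
    using that init closest_point_in_set[OF X(1) X_ne] by (cases k) (auto simp: step23)
  have \<alpha>0: "\<alpha> k > 0" for k by (rule step_pos)
  note pos = constants_pos
  define d where "d k \<omega> = direction (Ds (iterate R k \<omega>) (approx R k \<omega>) (dir_sample R k \<omega>)) (res_step R k \<omega>)" for k \<omega>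
  define V where "V k \<omega> = (norm (direction (Ds (iterate R k \<omega>) (w (iterate R k \<omega>)) (dir_sample R k \<omega>))
        (res_stoch R k \<omega>)))\<^sup>2" for k \<omega>
  define U where "U k \<omega> = norm (w (iterate R k \<omega>) - approx R k \<omega>)" for k \<omega>
  define E where "E k \<omega> = norm (D (iterate R k \<omega>) (approx R k \<omega>)
          - Ds (iterate R k \<omega>) (approx R k \<omega>) (dir_sample R k \<omega>))" for k \<omega>
  \<comment> \<open>The error is split at the direction of the deterministic data at the
    approximation: \<open>E\<close> is the sampling error there and \<open>U\<close> the lower-level
    error. Each of the two comparisons is charged two residuals of size
    \<open>C\<^sub>e * \<alpha> k\<close>, hence the factor 4.\<close>
  define e where "e k \<omega> = L_BSG * (E k \<omega> + \<bar>L\<^sub>D\<bar> * U k \<omega> + 4 * (C\<^sub>e * \<alpha> k))" for k \<omega>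
  \<comment> \<open>The moment bound \<open>V\<close> is available at \<open>w(x_k)\<close>, so the
    direction used is compared with the stochastic direction there. The constants come from applying
    \<open>(s + t)^2 \<le> 2 s^2 + 2 t^2\<close> twice.\<close>
  define q where "q k \<omega> = 2 * V k \<omega> + 4 * L_BSG\<^sup>2 * (L_LL\<^sup>2 * (U k \<omega>)\<^sup>2 + 4 * (C\<^sub>e * \<alpha> k)\<^sup>2)" for k \<omega>
  have res: "norm (r\<^sub>1 - r\<^sub>2) \<le> 2 * (C\<^sub>e * \<alpha> k)"
    if "\<omega> \<in> space M" "(D\<^sub>1, r\<^sub>1) \<in> iteration_data w D Ds R k \<omega>" "(D\<^sub>2, r\<^sub>2) \<in> iteration_data w D Ds R k \<omega>"
    for k \<omega> D\<^sub>1 D\<^sub>2 r\<^sub>1 r\<^sub>2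
    using residual_bound[OF that(1,2)] residual_bound[OF that(1,3)] norm_triangle_ineq4[of r\<^sub>1 r\<^sub>2] by linarith
  have dirs: "norm (direction D\<^sub>1 r\<^sub>1 - direction D\<^sub>2 r\<^sub>2) \<le> L_BSG * (norm (D\<^sub>1 - D\<^sub>2) + 2 * (C\<^sub>e * \<alpha> k))"
    if "\<omega> \<in> space M" "(D\<^sub>1, r\<^sub>1) \<in> iteration_data w D Ds R k \<omega>" "(D\<^sub>2, r\<^sub>2) \<in> iteration_data w D Ds R k \<omega>"
    for k \<omega> D\<^sub>1 D\<^sub>2 r\<^sub>1 r\<^sub>2
    by (rule order_trans[OF direction_lipschitz[OF that]])
       (use pos res[OF that] in \<open>intro mult_left_mono add_left_mono, auto\<close>)
  have bias: "norm (d k \<omega> + g (iterate R k \<omega>)) \<le> e k \<omega>" if \<omega>: "\<omega> \<in> space M" for k \<omega>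
  proof -
    let ?x = "iterate R k \<omega>" and ?u = "approx R k \<omega>" and ?\<xi> = "dir_sample R k \<omega>"
    have "norm (d k \<omega> - direction (D ?x ?u) (res_det R k \<omega>)) \<le> L_BSG * (E k \<omega> + 2 * (C\<^sub>e * \<alpha> k))"
      using dirs[OF \<omega>, of "Ds ?x ?u ?\<xi>" "res_step R k \<omega>" k "D ?x ?u" "res_det R k \<omega>"]
      by (simp add: iteration_data_def Let_def d_def E_def norm_minus_commute)
    moreover have "norm (direction (D ?x ?u) (res_det R k \<omega>) - direction (D ?x (w ?x)) 0)
        \<le> L_BSG * (norm (D ?x ?u - D ?x (w ?x)) + 2 * (C\<^sub>e * \<alpha> k))"
      using dirs[OF \<omega>, of "D ?x ?u" "res_det R k \<omega>" k "D ?x (w ?x)" 0]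
      by (simp add: iteration_data_def Let_def)
    moreover have "norm (D ?x ?u - D ?x (w ?x)) \<le> \<bar>L\<^sub>D\<bar> * U k \<omega>"
      using D_lipschitz[OF \<omega>, of k] mult_right_mono[OF abs_ge_self[of L\<^sub>D], of "U k \<omega>"]
      unfolding U_def by simp
    hence "L_BSG * (norm (D ?x ?u - D ?x (w ?x)) + 2 * (C\<^sub>e * \<alpha> k)) \<le> L_BSG * (\<bar>L\<^sub>D\<bar> * U k \<omega> + 2 * (C\<^sub>e * \<alpha> k))"
      using pos by (intro mult_left_mono) auto
    moreover have "d k \<omega> + g ?x = (d k \<omega> - direction (D ?x ?u) (res_det R k \<omega>))
        + (direction (D ?x ?u) (res_det R k \<omega>) - direction (D ?x (w ?x)) 0)"
      unfolding g_def by simp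
    hence "norm (d k \<omega> + g ?x) \<le> norm (d k \<omega> - direction (D ?x ?u) (res_det R k \<omega>))
        + norm (direction (D ?x ?u) (res_det R k \<omega>) - direction (D ?x (w ?x)) 0)"
      by (metis norm_triangle_ineq)
    ultimately show ?thesis unfolding e_def by (simp add: algebra_simps)
  qed
  have square_add: "(s + t)\<^sup>2 \<le> 2 * s\<^sup>2 + 2 * t\<^sup>2" for s t :: real
    using sum_squares_bound[of s t] by (simp add: power2_sum)
  have moment: "(norm (d k \<omega>))\<^sup>2 \<le> q k \<omega>" if \<omega>: "\<omega> \<in> space M" for k \<omega>
  proof -
    let ?x = "iterate R k \<omega>" and ?u = "approx R k \<omega>" and ?\<xi> = "dir_sample R k \<omega>"
    let ?d = "direction (Ds ?x (w ?x) ?\<xi>) (res_stoch R k \<omega>)"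
    have "norm (?d - d k \<omega>) \<le> L_BSG * (norm (Ds ?x (w ?x) ?\<xi> - Ds ?x ?u ?\<xi>) + 2 * (C\<^sub>e * \<alpha> k))"
      using dirs[OF \<omega>, of "Ds ?x (w ?x) ?\<xi>" "res_stoch R k \<omega>" k "Ds ?x ?u ?\<xi>" "res_step R k \<omega>"]
      by (simp add: iteration_data_def Let_def d_def)
    also have "\<dots> \<le> L_BSG * (L_LL * U k \<omega> + 2 * (C\<^sub>e * \<alpha> k))"
      using data_lipschitz[OF \<omega>, of k] pos unfolding U_def by (intro mult_left_mono) auto
    finally have 1: "norm (?d - d k \<omega>) \<le> L_BSG * (L_LL * U k \<omega> + 2 * (C\<^sub>e * \<alpha> k))" .
    have "norm (d k \<omega>) \<le> norm ?d + norm (?d - d k \<omega>)"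
      using norm_triangle_ineq4[of ?d "?d - d k \<omega>"] by simp
    hence "(norm (d k \<omega>))\<^sup>2 \<le> (norm ?d + L_BSG * (L_LL * U k \<omega> + 2 * (C\<^sub>e * \<alpha> k)))\<^sup>2"
      using 1 by (intro power_mono) auto
    also have "\<dots> \<le> 2 * V k \<omega> + 2 * (L_BSG * (L_LL * U k \<omega> + 2 * (C\<^sub>e * \<alpha> k)))\<^sup>2"
      unfolding V_def by (rule square_add)
    also have "(L_BSG * (L_LL * U k \<omega> + 2 * (C\<^sub>e * \<alpha> k)))\<^sup>2 = L_BSG\<^sup>2 * (L_LL * U k \<omega> + 2 * (C\<^sub>e * \<alpha> k))\<^sup>2"
      by (rule power_mult_distrib)
    also have "\<dots> \<le> L_BSG\<^sup>2 * (2 * (L_LL * U k \<omega>)\<^sup>2 + 2 * (2 * (C\<^sub>e * \<alpha> k))\<^sup>2)"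
      by (intro mult_left_mono square_add) auto
    finally show ?thesis unfolding q_def by (simp add: power_mult_distrib algebra_simps)
  qed
  have V: "integrable M (V k)" "(\<integral>\<omega>. V k \<omega> \<partial>M) \<le> V\<^sub>d" for k
    using cond_mean_le_expectation[OF prob_space_axioms iterate_rv second_moment] pos
    unfolding V_def by auto
  have U2: "integrable M (\<lambda>\<omega>. (U k \<omega>)\<^sup>2)" "(\<integral>\<omega>. (U k \<omega>)\<^sup>2 \<partial>M) \<le> (C\<^sub>w * \<alpha> k)\<^sup>2" for k
    using cond_mean_le_expectation[OF prob_space_axioms iterate_rv LL_accuracy]
    unfolding U_def by auto
  have E: "integrable M (E k)" "(\<integral>\<omega>. E k \<omega> \<partial>M) \<le> C\<^sub>D * \<alpha> k" for k
    using cond_mean_le_expectation[OF prob_space_axioms iterate_rv data_accuracy] pos \<alpha>0[of k]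
    unfolding E_def by auto
  have U: "integrable M (U k)" "(\<integral>\<omega>. U k \<omega> \<partial>M) \<le> C\<^sub>w * \<alpha> k" for k
  proof -
    \<comment> \<open>The second moment of \<open>U\<close> yields the first through
      \<open>U \<le> U^2 / (2 c) + c / 2\<close>; with this \<open>c\<close> both halves have mean
      at most \<open>c / 2\<close>.\<close>
    define c where "c = C\<^sub>w * \<alpha> k"
    have c: "c > 0" unfolding c_def using pos \<alpha>0 by simp
    have "(\<lambda>\<omega>. sqrt ((U k \<omega>)\<^sup>2)) \<in> borel_measurable M"
      using borel_measurable_integrable[OF U2(1)] by measurable
    hence meas: "U k \<in> borel_measurable M" unfolding U_def by simp
    have le: "U k \<omega> \<le> (U k \<omega>)\<^sup>2 / (2 * c) + c / 2" for \<omega>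
      using sum_squares_bound[of "U k \<omega>" c] c by (simp add: field_simps power2_eq_square)
    have int: "integrable M (\<lambda>\<omega>. (U k \<omega>)\<^sup>2 / (2 * c) + c / 2)" using U2(1) by simp
    show "integrable M (U k)"
      by (rule Bochner_Integration.integrable_bound[OF int meas])
         (use le c in \<open>auto simp: U_def intro!: order_trans[OF le[unfolded U_def]]\<close>)
    hence "(\<integral>\<omega>. U k \<omega> \<partial>M) \<le> (\<integral>\<omega>. (U k \<omega>)\<^sup>2 / (2 * c) + c / 2 \<partial>M)"
      using int le by (rule integral_mono)
    also have "\<dots> = (\<integral>\<omega>. (U k \<omega>)\<^sup>2 \<partial>M) / (2 * c) + c / 2"
      using U2(1) by (simp add: prob_space)
    also have "\<dots> \<le> c\<^sup>2 / (2 * c) + c / 2"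
      using U2(2)[of k] c unfolding c_def[symmetric] by (intro add_mono divide_right_mono) auto
    also have "\<dots> = c" using c by (simp add: power2_eq_square)
    finally show "(\<integral>\<omega>. U k \<omega> \<partial>M) \<le> C\<^sub>w * \<alpha> k" unfolding c_def .
  qed
  define C\<^sub>1 where "C\<^sub>1 = L_BSG * (C\<^sub>D + \<bar>L\<^sub>D\<bar> * C\<^sub>w + 4 * C\<^sub>e)"
  have e: "integrable M (e k)" "(\<integral>\<omega>. e k \<omega> \<partial>M) \<le> C\<^sub>1 * \<alpha> k" for k
  proof -
    show "integrable M (e k)" unfolding e_def using E(1) U(1) by simp
    have "(\<integral>\<omega>. e k \<omega> \<partial>M) = L_BSG * ((\<integral>\<omega>. E k \<omega> \<partial>M) + \<bar>L\<^sub>D\<bar> * (\<integral>\<omega>. U k \<omega> \<partial>M) + 4 * (C\<^sub>e * \<alpha> k))"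
      unfolding e_def using E(1) U(1) by (simp add: prob_space)
    also have "\<dots> \<le> L_BSG * (C\<^sub>D * \<alpha> k + \<bar>L\<^sub>D\<bar> * (C\<^sub>w * \<alpha> k) + 4 * (C\<^sub>e * \<alpha> k))"
      using pos E(2) U(2) by (intro mult_left_mono add_mono) auto
    finally show "(\<integral>\<omega>. e k \<omega> \<partial>M) \<le> C\<^sub>1 * \<alpha> k" unfolding C\<^sub>1_def by (simp add: algebra_simps)
  qed
  \<comment> \<open>Bounding each squared step size by the whole sum makes the second-moment bound
    \<open>C\<^sub>2\<close> independent of \<open>k\<close>.\<close>
  define S where "S = (\<Sum>k. (\<alpha> k)\<^sup>2)"
  have \<alpha>S: "(\<alpha> k)\<^sup>2 \<le> S" for k
    using sum_le_suminf[OF steps(2), of "{k}"] unfolding S_def by simp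
  define C\<^sub>2 where "C\<^sub>2 = 2 * V\<^sub>d + 4 * L_BSG\<^sup>2 * (L_LL\<^sup>2 * (C\<^sub>w\<^sup>2 * S) + 4 * (C\<^sub>e\<^sup>2 * S))"
  have q: "integrable M (q k)" "(\<integral>\<omega>. q k \<omega> \<partial>M) \<le> C\<^sub>2" for k
  proof -
    show "integrable M (q k)" unfolding q_def using V(1) U2(1) by simp
    have "(\<integral>\<omega>. q k \<omega> \<partial>M) = 2 * (\<integral>\<omega>. V k \<omega> \<partial>M)
        + 4 * L_BSG\<^sup>2 * (L_LL\<^sup>2 * (\<integral>\<omega>. (U k \<omega>)\<^sup>2 \<partial>M) + 4 * (C\<^sub>e * \<alpha> k)\<^sup>2)"
      unfolding q_def using V(1) U2(1) by (simp add: prob_space)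
    also have "\<dots> \<le> 2 * V\<^sub>d + 4 * L_BSG\<^sup>2 * (L_LL\<^sup>2 * (C\<^sub>w\<^sup>2 * S) + 4 * (C\<^sub>e\<^sup>2 * S))"
    proof (intro add_mono mult_left_mono V(2))
      have "C\<^sub>w\<^sup>2 * (\<alpha> k)\<^sup>2 \<le> C\<^sub>w\<^sup>2 * S" by (intro mult_left_mono \<alpha>S) auto
      thus "(\<integral>\<omega>. (U k \<omega>)\<^sup>2 \<partial>M) \<le> C\<^sub>w\<^sup>2 * S" using U2(2)[of k] by (simp add: power_mult_distrib)
      show "(C\<^sub>e * \<alpha> k)\<^sup>2 \<le> C\<^sub>e\<^sup>2 * S" unfolding power_mult_distrib by (intro mult_left_mono \<alpha>S) auto
    qed auto
    finally show "(\<integral>\<omega>. q k \<omega> \<partial>M) \<le> C\<^sub>2" unfolding C\<^sub>2_def .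
  qed
  define F where "F k \<omega> = f (iterate R k \<omega>)" for k \<omega>
  define p where "p k \<omega> = \<alpha> k * (norm (proj_grad X (\<alpha> k) (iterate R k \<omega>) (g (iterate R k \<omega>))))\<^sup>2" for k \<omega>
  have F_meas: "F k \<in> borel_measurable M" for k
    unfolding F_def using borel_measurable_continuous_on[OF f_cont iterate_rv] .
  have descent: "p k \<omega> \<le> F k \<omega> - F (Suc k) \<omega> + \<Gamma> * \<alpha> k * e k \<omega> + L * (\<alpha> k)\<^sup>2 * q k \<omega>"
    and increment: "\<bar>F (Suc k) \<omega> - F k \<omega>\<bar> \<le> \<Gamma> * \<alpha> k * (1 + q k \<omega>)"
    if \<omega>: "\<omega> \<in> space M" for k \<omega>
  proof -
    let ?x = "iterate R k \<omega>" and ?x' = "iterate R (Suc k) \<omega>"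
    have x': "?x' = closest_point X (?x + \<alpha> k *\<^sub>R d k \<omega>)" unfolding d_def by (rule step23[OF \<omega>])
    note step = projected_step_decrease[OF X iter_X[OF \<omega>, of k] \<alpha>0[of k] g L(3,1,4), where d = "d k \<omega>",
        folded x']
    have "\<Gamma> * \<alpha> k * norm (d k \<omega> + g ?x) \<le> \<Gamma> * \<alpha> k * e k \<omega>"
      using bias[OF \<omega>] L \<alpha>0[of k] by (intro mult_left_mono) auto
    moreover have "L * (\<alpha> k)\<^sup>2 * (norm (d k \<omega>))\<^sup>2 \<le> L * (\<alpha> k)\<^sup>2 * q k \<omega>"
      using moment[OF \<omega>] L by (intro mult_left_mono) auto
    ultimately show "p k \<omega> \<le> F k \<omega> - F (Suc k) \<omega> + \<Gamma> * \<alpha> k * e k \<omega> + L * (\<alpha> k)\<^sup>2 * q k \<omega>"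
      using step(1) unfolding p_def F_def by linarith
    have "2 * norm (d k \<omega>) \<le> 1 + (norm (d k \<omega>))\<^sup>2"
      using sum_squares_bound[of 1 "norm (d k \<omega>)"] by simp
    hence "norm (d k \<omega>) \<le> 1 + (norm (d k \<omega>))\<^sup>2"
      using norm_ge_zero[of "d k \<omega>"] by linarith
    hence "norm (d k \<omega>) \<le> 1 + q k \<omega>" using moment[OF \<omega>, of k] by linarith
    hence "\<alpha> k * norm (d k \<omega>) \<le> \<alpha> k * (1 + q k \<omega>)" using \<alpha>0[of k] by (intro mult_left_mono) auto
    hence "norm (?x' - ?x) \<le> \<alpha> k * (1 + q k \<omega>)" using step(2) by linarith
    hence "\<Gamma> * norm (?x' - ?x) \<le> \<Gamma> * (\<alpha> k * (1 + q k \<omega>))" using L by (intro mult_left_mono) auto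
    thus "\<bar>F (Suc k) \<omega> - F k \<omega>\<bar> \<le> \<Gamma> * \<alpha> k * (1 + q k \<omega>)"
      using f_lip[of ?x' ?x] unfolding F_def by (simp add: mult.assoc)
  qed
  \<comment> \<open>No upper bound on \<open>f\<close> along the iterates is at hand. Integrability
    is carried from the deterministic starting value one step at a time, each increment being
    dominated by a multiple of \<open>1 + q k\<close>.\<close>
  have F_int: "integrable M (F k)" for k
  proof (induction k)
    case 0
    have "integrable M (F 0) \<longleftrightarrow> integrable M (\<lambda>_. f (x_init R))"
      by (rule Bochner_Integration.integrable_cong) (auto simp: F_def init)
    thus ?case by simp
  next
    case (Suc k)
    have "integrable M (\<lambda>\<omega>. F (Suc k) \<omega> - F k \<omega>)"
    proof (rule Bochner_Integration.integrable_bound)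
      show "integrable M (\<lambda>\<omega>. \<Gamma> * \<alpha> k * (1 + q k \<omega>))" using q(1) by simp
      show "AE \<omega> in M. norm (F (Suc k) \<omega> - F k \<omega>) \<le> norm (\<Gamma> * \<alpha> k * (1 + q k \<omega>))"
      proof (rule AE_I2)
        fix \<omega> assume "\<omega> \<in> space M"
        thus "norm (F (Suc k) \<omega> - F k \<omega>) \<le> norm (\<Gamma> * \<alpha> k * (1 + q k \<omega>))"
          using increment[of \<omega> k] abs_ge_self[of "\<Gamma> * \<alpha> k * (1 + q k \<omega>)"]
          unfolding real_norm_def by linarith
      qed
    qed (use F_meas in simp)
    from Bochner_Integration.integrable_add[OF this Suc] show ?case by simp
  qed
  have p_int: "integrable M (p k)" for k
  proof -
    \<comment> \<open>A point of \<open>X\<close> is its own projection, so nonexpansiveness bounds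
      the projected gradient by the gradient.\<close>
    have "norm (proj_grad X (\<alpha> k) x (g x)) \<le> \<Gamma>" if "x \<in> X" for x
    proof -
      have "norm (closest_point X x - closest_point X (x - \<alpha> k *\<^sub>R g x)) \<le> norm (x - (x - \<alpha> k *\<^sub>R g x))"
        using closest_point_lipschitz[OF X(2,1) X_ne, unfolded dist_norm] by blast
      hence "norm (x - closest_point X (x - \<alpha> k *\<^sub>R g x)) \<le> \<alpha> k * \<Gamma>"
        using closest_point_self[OF that] \<alpha>0[of k] L(4)[of x]
        by (simp add: order_trans[OF _ mult_left_mono])
      thus ?thesis unfolding proj_grad_def using \<alpha>0[of k] by (simp add: pos_divide_le_eq mult.commute)
    qed
    hence bd: "AE \<omega> in M. norm (p k \<omega>) \<le> \<alpha> k * \<Gamma>\<^sup>2"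
      unfolding p_def using iter_X \<alpha>0[of k] by (intro AE_I2) (auto intro!: mult_left_mono power_mono)
    have "continuous_on UNIV (\<lambda>x. \<alpha> k * (norm (proj_grad X (\<alpha> k) x (g x)))\<^sup>2)"
      unfolding proj_grad_def
      by (intro continuous_intros g_cont continuous_on_compose2[OF continuous_on_closest_point[OF X(2,1) X_ne, of UNIV]])
         auto
    from borel_measurable_continuous_on[OF this iterate_rv]
    have "p k \<in> borel_measurable M" unfolding p_def .
    thus ?thesis using bd by (intro integrable_const_bound)
  qed
  have p_nonneg: "p k \<omega> \<ge> 0" for k \<omega> unfolding p_def using \<alpha>0[of k] by simp
  have ws: "weighted_sum X f \<alpha> (iterate R) K = (\<lambda>\<omega>. \<Sum>k\<le>K. p k \<omega>)" for K
    by (rule ext) (simp add: weighted_sum_def p_def grad_eq)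
  \<comment> \<open>The bias, of order \<open>\<alpha> k\<close>, meets the step size
    \<open>\<alpha> k\<close>, and the curvature term carries its square already; both errors are
    multiples of the squared step size.\<close>
  define C where "C = \<Gamma> * C\<^sub>1 + L * C\<^sub>2"
  have p_le: "(\<integral>\<omega>. p k \<omega> \<partial>M) \<le> (\<integral>\<omega>. F k \<omega> \<partial>M) - (\<integral>\<omega>. F (Suc k) \<omega> \<partial>M) + C * (\<alpha> k)\<^sup>2" for k
  proof -
    have "(\<integral>\<omega>. p k \<omega> \<partial>M) \<le> (\<integral>\<omega>. F k \<omega> - F (Suc k) \<omega> + \<Gamma> * \<alpha> k * e k \<omega> + L * (\<alpha> k)\<^sup>2 * q k \<omega> \<partial>M)"
      using p_int F_int e(1) q(1) descent by (intro integral_mono_AE) auto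
    also have "\<dots> = (\<integral>\<omega>. F k \<omega> \<partial>M) - (\<integral>\<omega>. F (Suc k) \<omega> \<partial>M)
        + \<Gamma> * \<alpha> k * (\<integral>\<omega>. e k \<omega> \<partial>M) + L * (\<alpha> k)\<^sup>2 * (\<integral>\<omega>. q k \<omega> \<partial>M)"
      using F_int e(1) q(1) by simp
    also have "\<dots> \<le> (\<integral>\<omega>. F k \<omega> \<partial>M) - (\<integral>\<omega>. F (Suc k) \<omega> \<partial>M)
        + \<Gamma> * \<alpha> k * (C\<^sub>1 * \<alpha> k) + L * (\<alpha> k)\<^sup>2 * C\<^sub>2"
      using L \<alpha>0[of k] by (intro add_mono mult_left_mono e(2) q(2)) auto
    finally show ?thesis unfolding C_def by (simp add: algebra_simps power2_eq_square)
  qed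
  have C_nonneg: "C \<ge> 0"
  proof -
    have "S \<ge> 0" using \<alpha>S[of 0] order_trans zero_le_power2 by blast
    thus ?thesis unfolding C_def C\<^sub>1_def C\<^sub>2_def using L pos by simp
  qed
  \<comment> \<open>After telescoping, the initial value is a constant and the last one is at least
    \<open>f_inf\<close>, so the bound does not depend on \<open>n\<close>.\<close>
  have "(\<Sum>k<n. \<integral>\<omega>. p k \<omega> \<partial>M) \<le> f (x_init R) - f_inf + C * S" for n
  proof -
    have "(\<Sum>k<n. \<integral>\<omega>. p k \<omega> \<partial>M)
        \<le> (\<Sum>k<n. (\<integral>\<omega>. F k \<omega> \<partial>M) - (\<integral>\<omega>. F (Suc k) \<omega> \<partial>M) + C * (\<alpha> k)\<^sup>2)"
      by (intro sum_mono p_le)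
    also have "\<dots> = (\<integral>\<omega>. F 0 \<omega> \<partial>M) - (\<integral>\<omega>. F n \<omega> \<partial>M) + C * (\<Sum>k<n. (\<alpha> k)\<^sup>2)"
      using sum_lessThan_telescope'[of "\<lambda>k. \<integral>\<omega>. F k \<omega> \<partial>M" n]
      by (simp add: sum.distrib flip: sum_distrib_left)
    also have "(\<integral>\<omega>. F 0 \<omega> \<partial>M) = (\<integral>\<omega>. f (x_init R) \<partial>M)"
      by (intro Bochner_Integration.integral_cong) (auto simp: F_def init)
    also have "\<dots> = f (x_init R)" by (simp add: prob_space)
    also have "f (x_init R) - (\<integral>\<omega>. F n \<omega> \<partial>M) + C * (\<Sum>k<n. (\<alpha> k)\<^sup>2) \<le> f (x_init R) - f_inf + C * S"
    proof (intro add_mono diff_mono mult_left_mono C_nonneg)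
      have "(\<integral>\<omega>. f_inf \<partial>M) \<le> (\<integral>\<omega>. F n \<omega> \<partial>M)"
      proof (rule integral_mono_AE[OF _ F_int])
        show "AE \<omega> in M. f_inf \<le> F n \<omega>" unfolding F_def using bounded_below by (rule AE_I2)
      qed simp
      thus "f_inf \<le> (\<integral>\<omega>. F n \<omega> \<partial>M)" by (simp add: prob_space)
      show "(\<Sum>k<n. (\<alpha> k)\<^sup>2) \<le> S" unfolding S_def by (intro sum_le_suminf steps) auto
    qed auto
    finally show ?thesis .
  qed
  hence "summable (\<lambda>k. \<integral>\<omega>. p k \<omega> \<partial>M)"
    by (intro summableI_nonneg_bounded[where x = "f (x_init R) - f_inf + C * S"])
       (auto intro: integral_nonneg_AE p_nonneg)
  moreover have int_ws: "(\<integral>\<omega>. weighted_sum X f \<alpha> (iterate R) K \<omega> \<partial>M) = (\<Sum>k\<le>K. \<integral>\<omega>. p k \<omega> \<partial>M)" for K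
    unfolding ws using p_int by simp
  ultimately show conv: ?thesis2 by (simp add: summable_iff_convergent')
  show ?thesis1 unfolding ws using p_int by simp
  obtain l where l: "(\<lambda>K. \<integral>\<omega>. weighted_sum X f \<alpha> (iterate R) K \<omega> \<partial>M) \<longlonglongrightarrow> l"
    using conv unfolding convergent_def by blast
  have "(\<lambda>K. inverse (\<Sum>k\<le>K. \<alpha> k)) \<longlonglongrightarrow> 0"
    by (rule tendsto_inverse_0_at_top[OF steps(1)])
  from tendsto_mult[OF this l] show ?thesis3 by (simp add: inverse_eq_divide)
qed

section \<open>Derivatives of the lower-level optimality conditions\<close>

text \<open>The Riesz vector of the derivative \<open>g'\<close> is \<open>adjoint g' 1\<close>,
  which shows that the description in \<open>grad\<close> has a witness.\<close>

lemma C1_GDERIV: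
  fixes g :: "'a::euclidean_space \<Rightarrow> real"
  assumes "C1 g" shows "GDERIV g x :> grad g x"
proof -
  obtain g' where g': "(g has_derivative g') (at x)"
    using assms unfolding C1_def differentiable_def by blast
  have "g' = (\<lambda>h. h \<bullet> adjoint g' 1)"
    using adjoint_works[OF has_derivative_linear[OF g']] by auto
  with g' have "GDERIV g x :> adjoint g' 1" unfolding gderiv_def by simp
  thus ?thesis using grad_eqI by metis
qed

lemma C1_continuous: "C1 g \<Longrightarrow> continuous_on UNIV g"
  unfolding C1_def
  by (auto intro!: continuous_at_imp_continuous_on differentiable_imp_continuous_within)

lemma GDERIV_partial:
  assumes "GDERIV g (x, y) :> D"
  shows "GDERIV (\<lambda>x'. g (x', y)) x :> fst D" "GDERIV (\<lambda>y'. g (x, y')) y :> snd D"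
proof -
  have g: "(g has_derivative (\<lambda>h. h \<bullet> D)) (at (x, y))" using assms unfolding gderiv_def .
  have "((\<lambda>x'. (x', y)) has_derivative (\<lambda>h. (h, 0))) (at x)" by (auto intro!: derivative_eq_intros)
  from has_derivative_compose[OF this g] show "GDERIV (\<lambda>x'. g (x', y)) x :> fst D"
    unfolding gderiv_def by (simp add: inner_prod_def)
  have "((\<lambda>y'. (x, y')) has_derivative (\<lambda>h. (0, h))) (at y)" by (auto intro!: derivative_eq_intros)
  from has_derivative_compose[OF this g] show "GDERIV (\<lambda>y'. g (x, y')) y :> snd D"
    unfolding gderiv_def by (simp add: inner_prod_def)
qed

lemma grad_xy_eq:
  fixes g :: "'x::euclidean_space \<times> 'y::euclidean_space \<Rightarrow> real"
  assumes "C1 g"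
  shows "grad_x g x y = fst (grad g (x, y))" "grad_y g x y = snd (grad g (x, y))"
  unfolding grad_x_def grad_y_def
  using GDERIV_partial[OF C1_GDERIV[OF assms], where x = x and y = y] by (auto intro: grad_eqI)

lemma vgrad_eqI:
  assumes F: "(F has_derivative F') (at x)" and T: "\<And>l h. l \<bullet> F' h = blinfun_apply T l \<bullet> h"
  shows "vgrad F x = T"
proof -
  have "frechet_derivative F (at x) = F'" using F by (rule frechet_derivative_at[symmetric])
  moreover have "adjoint F' = blinfun_apply T"
    by (rule adjoint_unique) (use T in \<open>simp add: inner_commute\<close>)
  ultimately show ?thesis unfolding vgrad_def by (simp add: blinfun_apply_inverse)
qed

lemma vgrad_partial:
  fixes F :: "'x::euclidean_space \<times> 'y::euclidean_space \<Rightarrow> 'z::euclidean_space"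
  assumes F: "(F has_derivative F') (at (x, y))"
    and T: "\<And>l h k. l \<bullet> F' (h, k) = blinfun_apply A l \<bullet> h + blinfun_apply B l \<bullet> k"
  shows "vgrad (\<lambda>x'. F (x', y)) x = A" "vgrad (\<lambda>y'. F (x, y')) y = B"
proof -
  have "((\<lambda>x'. (x', y)) has_derivative (\<lambda>h. (h, 0))) (at x)" by (auto intro!: derivative_eq_intros)
  from has_derivative_compose[OF this F] show "vgrad (\<lambda>x'. F (x', y)) x = A"
    by (rule vgrad_eqI) (simp add: T)
  have "((\<lambda>y'. (x, y')) has_derivative (\<lambda>h. (0, h))) (at y)" by (auto intro!: derivative_eq_intros)
  from has_derivative_compose[OF this F] show "vgrad (\<lambda>y'. F (x, y')) y = B"
    by (rule vgrad_eqI) (simp add: T)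
qed

text \<open>The two components of the adjoint derivative are the partial transposed Jacobians.
  Differentiability at the point thus gives the pairing in which \<open>A\<close> and
  \<open>B\<close> enter the implicit function argument.\<close>

lemma vgrad_partial_works:
  fixes F :: "'x::euclidean_space \<times> 'y::euclidean_space \<Rightarrow> 'z::euclidean_space"
  assumes F: "(F has_derivative F') (at (x, y))"
  shows "l \<bullet> F' (h, k) = blinfun_apply (vgrad (\<lambda>x'. F (x', y)) x) l \<bullet> h
      + blinfun_apply (vgrad (\<lambda>y'. F (x, y')) y) l \<bullet> k"
proof -
  let ?A = "Blinfun (\<lambda>l. fst (adjoint F' l))" and ?B = "Blinfun (\<lambda>l. snd (adjoint F' l))"
  note lin = has_derivative_linear[OF F]
  have "bounded_linear (adjoint F')"
    using adjoint_linear[OF lin] by (simp add: linear_conv_bounded_linear)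
  hence bl: "bounded_linear (\<lambda>l. fst (adjoint F' l))" "bounded_linear (\<lambda>l. snd (adjoint F' l))"
    by (auto intro: bounded_linear_fst_comp bounded_linear_snd_comp)
  have T: "l \<bullet> F' (h, k) = blinfun_apply ?A l \<bullet> h + blinfun_apply ?B l \<bullet> k" for l h k
    using adjoint_works[OF lin, of "(h, k)" l]
    by (simp add: bounded_linear_Blinfun_apply bl inner_prod_def inner_commute)
  show ?thesis unfolding vgrad_partial[OF F T] by (rule T)
qed

lemma C2_grad_y_derivative:
  fixes g :: "'x::euclidean_space \<times> 'y::euclidean_space \<Rightarrow> real"
  assumes "C2 g"
  shows "\<exists>G'. ((\<lambda>p. grad_y g (fst p) (snd p)) has_derivative G') (at (x, y)) \<and>
    (\<forall>h k l. l \<bullet> G' (h, k) = blinfun_apply (hess_xy g x y) l \<bullet> h + blinfun_apply (hess_yy g x y) l \<bullet> k)"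
proof -
  have C1: "C1 g" "C1 (grad g)" using assms unfolding C2_def by auto
  obtain H where "(grad g has_derivative H) (at (x, y))"
    using C1(2) unfolding C1_def differentiable_def by blast
  hence "((\<lambda>p. snd (grad g p)) has_derivative (\<lambda>h. snd (H h))) (at (x, y))"
    by (rule has_derivative_snd)
  hence G': "((\<lambda>p. grad_y g (fst p) (snd p)) has_derivative (\<lambda>h. snd (H h))) (at (x, y))"
    by (simp add: grad_xy_eq[OF C1(1)])
  show ?thesis
    by (intro exI[of _ "\<lambda>h. snd (H h)"] conjI G')
       (use vgrad_partial_works[OF G'] in \<open>simp add: hess_xy_def hess_yy_def\<close>)
qed

text \<open>The factor of \<open>c i\<close> in the second block of the KKT map, which lets
  inequalities and equalities share one sum and one product rule.\<close>

definition switch :: "'j set \<Rightarrow> real^'j \<Rightarrow> 'j \<Rightarrow> real" where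
  "switch I z i = (if i \<in> I then z $ i else 1)"

text \<open>The transposed Jacobians of the KKT map in \<open>x\<close> and in \<open>v = (y, z)\<close>.\<close>

definition KKT_x ::
  "'j set \<Rightarrow> ('j::finite \<Rightarrow> 'x::euclidean_space \<times> 'y::euclidean_space \<Rightarrow> real) \<Rightarrow>
   ('x \<times> 'y \<Rightarrow> real) \<Rightarrow> 'x \<Rightarrow> 'y \<times> (real^'j) \<Rightarrow> ('y \<times> (real^'j)) \<Rightarrow>\<^sub>L 'x" where
  "KKT_x I c fl x v =
     (hess_xy fl x (fst v) o\<^sub>L fst_blinfun)
     + (\<Sum>i\<in>UNIV. snd v $ i *\<^sub>R (hess_xy (c i) x (fst v) o\<^sub>L fst_blinfun))
     + (\<Sum>i\<in>UNIV. switch I (snd v) i *\<^sub>R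
         (blinfun_scaleR_left (grad_x (c i) x (fst v)) o\<^sub>L blinfun_inner_left (0, axis i 1)))"

definition KKT_v ::
  "'j set \<Rightarrow> ('j::finite \<Rightarrow> 'x::euclidean_space \<times> 'y::euclidean_space \<Rightarrow> real) \<Rightarrow>
   ('x \<times> 'y \<Rightarrow> real) \<Rightarrow> 'x \<Rightarrow> 'y \<times> (real^'j) \<Rightarrow> ('y \<times> (real^'j)) \<Rightarrow>\<^sub>L ('y \<times> (real^'j))" where
  "KKT_v I c fl x v =
     (Blinfun (\<lambda>k. (k, 0)) o\<^sub>L
      ((hess_yy fl x (fst v) o\<^sub>L fst_blinfun)
       + (\<Sum>i\<in>UNIV. snd v $ i *\<^sub>R (hess_yy (c i) x (fst v) o\<^sub>L fst_blinfun))
       + (\<Sum>i\<in>UNIV. switch I (snd v) i *\<^sub>R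
         (blinfun_scaleR_left (grad_y (c i) x (fst v)) o\<^sub>L blinfun_inner_left (0, axis i 1)))))
     + (\<Sum>i\<in>UNIV. blinfun_scaleR_left (0, axis i 1) o\<^sub>L
         (blinfun_inner_left (grad_y (c i) x (fst v)) o\<^sub>L fst_blinfun))
     + (\<Sum>i\<in>I. c i (x, fst v) *\<^sub>R
         (blinfun_scaleR_left (0, axis i 1) o\<^sub>L blinfun_inner_left (0, axis i 1)))"

lemma KKT_x_apply:
  "blinfun_apply (KKT_x I c fl x v) (p, q) =
     blinfun_apply (hess_xy fl x (fst v)) p
     + (\<Sum>i\<in>UNIV. snd v $ i *\<^sub>R blinfun_apply (hess_xy (c i) x (fst v)) p)
     + (\<Sum>i\<in>UNIV. (switch I (snd v) i * q $ i) *\<^sub>R grad_x (c i) x (fst v))"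
  unfolding KKT_x_def
  by (simp add: blinfun.add_left blinfun.sum_left blinfun.scaleR_left blinfun_inner_left.rep_eq
      inner_axis)

lemma KKT_v_apply:
  fixes c :: "'j::finite \<Rightarrow> 'x::euclidean_space \<times> 'y::euclidean_space \<Rightarrow> real"
  shows "blinfun_apply (KKT_v I c fl x v) (p, q) =
     (blinfun_apply (hess_yy fl x (fst v)) p
     + (\<Sum>i\<in>UNIV. snd v $ i *\<^sub>R blinfun_apply (hess_yy (c i) x (fst v)) p)
     + (\<Sum>i\<in>UNIV. (switch I (snd v) i * q $ i) *\<^sub>R grad_y (c i) x (fst v)),
     (\<Sum>i\<in>UNIV. (p \<bullet> grad_y (c i) x (fst v)) *\<^sub>R axis i 1) + (\<Sum>i\<in>I. (c i (x, fst v) * q $ i) *\<^sub>R axis i 1))"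
proof -
  have bl: "bounded_linear (\<lambda>k::'y. (k, 0::real^'j))"
    by (intro bounded_linear_Pair bounded_linear_ident bounded_linear_zero)
  have sum_Pair: "(\<Sum>i\<in>J. (0::'y, f i)) = (0, \<Sum>i\<in>J. f i)" for J and f :: "'j \<Rightarrow> real^'j"
    by (simp add: prod_eq_iff fst_sum snd_sum)
  show ?thesis
    unfolding KKT_v_def
    by (simp add: blinfun.add_left blinfun.sum_left blinfun.scaleR_left blinfun_inner_left.rep_eq
        inner_axis bounded_linear_Blinfun_apply[OF bl] sum_Pair)
qed

lemma grad_y_lagrangian:
  fixes fl :: "'x::euclidean_space \<times> 'y::euclidean_space \<Rightarrow> real"
  assumes "C1 fl" "\<And>i. C1 (c i)"
  shows "grad_y (lagrangian fl c z) x y = grad_y fl x y + (\<Sum>i\<in>UNIV. z $ i *\<^sub>R grad_y (c i) x y)"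
proof -
  have 1: "GDERIV (\<lambda>y'. g (x, y')) y :> grad_y g x y" if "C1 g" for g :: "'x \<times> 'y \<Rightarrow> real"
    unfolding grad_xy_eq[OF that] by (rule GDERIV_partial[OF C1_GDERIV[OF that]])
  have "((\<lambda>y'. fl (x, y') + (\<Sum>i\<in>UNIV. c i (x, y') * z $ i)) has_derivative
      (\<lambda>h. h \<bullet> grad_y fl x y + (\<Sum>i\<in>UNIV. (h \<bullet> grad_y (c i) x y) * z $ i))) (at y)"
    using 1[OF assms(1)] 1[OF assms(2)] unfolding gderiv_def
    by (intro has_derivative_add has_derivative_sum has_derivative_mult_left)
  hence "GDERIV (\<lambda>y'. lagrangian fl c z (x, y')) y :> grad_y fl x y + (\<Sum>i\<in>UNIV. z $ i *\<^sub>R grad_y (c i) x y)"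
    unfolding gderiv_def lagrangian_def by (simp add: inner_add_right inner_sum_right mult.commute)
  thus ?thesis unfolding grad_y_def by (rule grad_eqI)
qed

lemma KKT_map_eq:
  fixes fl :: "'x::euclidean_space \<times> 'y::euclidean_space \<Rightarrow> real"
  assumes "C1 fl" "\<And>i. C1 (c i)"
  shows "KKT_map I c fl x v =
    (grad_y fl x (fst v) + (\<Sum>i\<in>UNIV. snd v $ i *\<^sub>R grad_y (c i) x (fst v)),
     \<Sum>i\<in>UNIV. (switch I (snd v) i * c i (x, fst v)) *\<^sub>R axis i 1)"
proof -
  have "(\<chi> i. if i \<in> I then snd v $ i * c i (x, fst v) else c i (x, fst v))
      = (\<Sum>i\<in>UNIV. (switch I (snd v) i * c i (x, fst v)) *\<^sub>R axis i 1)"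
    by (simp add: vec_eq_iff switch_def axis_def if_distrib sum.delta cong: if_cong)
  thus ?thesis unfolding KKT_map_def by (simp add: case_prod_unfold grad_y_lagrangian[OF assms])
qed

lemma KKT_map_derivative:
  fixes fl :: "'x::euclidean_space \<times> 'y::euclidean_space \<Rightarrow> real" and c :: "'j::finite \<Rightarrow> 'x \<times> 'y \<Rightarrow> real"
  assumes fl: "C2 fl" and c: "\<And>i. C2 (c i)"
  shows "\<exists>G'. ((\<lambda>p. KKT_map I c fl (fst p) (snd p)) has_derivative G') (at (x, v)) \<and>
    (\<forall>h k l. l \<bullet> G' (h, k) = blinfun_apply (KKT_x I c fl x v) l \<bullet> h + blinfun_apply (KKT_v I c fl x v) l \<bullet> k)"
proof -
  obtain y z where v: "v = (y, z)" by (cases v)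
  have C1: "C1 fl" "\<And>i. C1 (c i)" using fl c unfolding C2_def by auto
  \<comment> \<open>The objective and the constraints see only \<open>(x, y)\<close>, so their
    derivatives are transported along the projection that forgets the multipliers.\<close>
  have pr: "((\<lambda>p. (fst p, fst (snd p))) has_derivative (\<lambda>d. (fst d, fst (snd d)))) (at (x, v))"
    by (auto intro!: derivative_eq_intros)
  have grad: "\<exists>H. ((\<lambda>p. grad_y g (fst p) (fst (snd p))) has_derivative H) (at (x, v)) \<and>
      (\<forall>l h k. l \<bullet> H (h, k) = blinfun_apply (hess_xy g x y) l \<bullet> h + blinfun_apply (hess_yy g x y) l \<bullet> fst k)"
    if g: "C2 g" for g :: "'x \<times> 'y \<Rightarrow> real"
  proof -
    obtain G' where G': "((\<lambda>p. grad_y g (fst p) (snd p)) has_derivative G') (at (x, y))"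
      "\<And>l h k. l \<bullet> G' (h, k) = blinfun_apply (hess_xy g x y) l \<bullet> h + blinfun_apply (hess_yy g x y) l \<bullet> k"
      using C2_grad_y_derivative[OF g] by blast
    have "((\<lambda>p. grad_y g (fst p) (fst (snd p))) has_derivative (\<lambda>d. G' (fst d, fst (snd d)))) (at (x, v))"
      using has_derivative_compose[OF pr, of "\<lambda>p. grad_y g (fst p) (snd p)" G'] G'(1) by (simp add: v)
    with G'(2) show ?thesis by (intro exI[of _ "\<lambda>d. G' (fst d, fst (snd d))"]) auto
  qed
  obtain H where H: "((\<lambda>p. grad_y fl (fst p) (fst (snd p))) has_derivative H) (at (x, v))"
    "\<And>l h k. l \<bullet> H (h, k) = blinfun_apply (hess_xy fl x y) l \<bullet> h + blinfun_apply (hess_yy fl x y) l \<bullet> fst k"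
    using grad[OF fl] by blast
  have "\<forall>i. \<exists>H. ((\<lambda>p. grad_y (c i) (fst p) (fst (snd p))) has_derivative H) (at (x, v)) \<and>
      (\<forall>l h k. l \<bullet> H (h, k) = blinfun_apply (hess_xy (c i) x y) l \<bullet> h + blinfun_apply (hess_yy (c i) x y) l \<bullet> fst k)"
    using grad[OF c] by blast
  then obtain K where K: "\<And>i. ((\<lambda>p. grad_y (c i) (fst p) (fst (snd p))) has_derivative K i) (at (x, v))"
    "\<And>i l h k. l \<bullet> K i (h, k) = blinfun_apply (hess_xy (c i) x y) l \<bullet> h + blinfun_apply (hess_yy (c i) x y) l \<bullet> fst k"
    by metis
  have dc: "((\<lambda>p. c i (fst p, fst (snd p))) has_derivative
      (\<lambda>d. fst d \<bullet> grad_x (c i) x y + fst (snd d) \<bullet> grad_y (c i) x y)) (at (x, v))" for i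
    using has_derivative_compose[OF pr, of "c i" "\<lambda>h. h \<bullet> grad (c i) (x, y)"] C1_GDERIV[OF C1(2), of i "(x, y)"]
    unfolding gderiv_def grad_xy_eq[OF C1(2)] v by (simp add: inner_prod_def)
  have dz: "((\<lambda>p. snd (snd p) $ i) has_derivative (\<lambda>d. snd (snd d) $ i)) (at (x, v))" for i
    by (intro bounded_linear_imp_has_derivative bounded_linear_vec_nth[THEN bounded_linear_compose]
        bounded_linear_snd[THEN bounded_linear_compose] bounded_linear_snd)
  have ds: "((\<lambda>p. switch I (snd (snd p)) i) has_derivative (\<lambda>d. if i \<in> I then snd (snd d) $ i else 0)) (at (x, v))" for i
    unfolding switch_def using dz[of i] by (cases "i \<in> I") auto
  have d1: "((\<lambda>p. snd (snd p) $ i *\<^sub>R grad_y (c i) (fst p) (fst (snd p))) has_derivative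
      (\<lambda>d. z $ i *\<^sub>R K i d + snd (snd d) $ i *\<^sub>R grad_y (c i) x y)) (at (x, v))" for i
    using has_derivative_scaleR[OF dz K(1), of i i] by (simp add: v)
  have d2: "((\<lambda>p. switch I (snd (snd p)) i * c i (fst p, fst (snd p))) has_derivative
      (\<lambda>d. switch I z i * (fst d \<bullet> grad_x (c i) x y + fst (snd d) \<bullet> grad_y (c i) x y)
        + (if i \<in> I then snd (snd d) $ i else 0) * c i (x, y))) (at (x, v))" for i
    using has_derivative_mult[OF ds dc, of i i] by (simp add: v)
  define G' where "G' = (\<lambda>d.
    (H d + (\<Sum>i\<in>UNIV. z $ i *\<^sub>R K i d + snd (snd d) $ i *\<^sub>R grad_y (c i) x y),
     \<Sum>i\<in>UNIV. (switch I z i * (fst d \<bullet> grad_x (c i) x y + fst (snd d) \<bullet> grad_y (c i) x y)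
        + (if i \<in> I then snd (snd d) $ i else 0) * c i (x, y)) *\<^sub>R (axis i 1 :: real^'j)))"
  have "((\<lambda>p. KKT_map I c fl (fst p) (snd p)) has_derivative G') (at (x, v))"
    unfolding KKT_map_eq[OF C1] G'_def
    by (rule has_derivative_Pair[OF has_derivative_add[OF H(1) has_derivative_sum[OF d1]]
          has_derivative_sum[OF has_derivative_scaleR_left[OF d2]]])
  moreover have "l \<bullet> G' (h, k) = blinfun_apply (KKT_x I c fl x v) l \<bullet> h + blinfun_apply (KKT_v I c fl x v) l \<bullet> k" for l h k
  proof -
    obtain p q where l: "l = (p, q)" by (cases l)
    obtain u m where k: "k = (u, m)" by (cases k)
    have "l \<bullet> G' (h, k) = blinfun_apply (hess_xy fl x y) p \<bullet> h + blinfun_apply (hess_yy fl x y) p \<bullet> u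
      + (\<Sum>i\<in>UNIV. z $ i * (blinfun_apply (hess_xy (c i) x y) p \<bullet> h + blinfun_apply (hess_yy (c i) x y) p \<bullet> u)
          + m $ i * (p \<bullet> grad_y (c i) x y))
      + (\<Sum>i\<in>UNIV. (switch I z i * (h \<bullet> grad_x (c i) x y + u \<bullet> grad_y (c i) x y)
          + (if i \<in> I then m $ i else 0) * c i (x, y)) * q $ i)"
      unfolding l k G'_def inner_Pair inner_add_right inner_sum_right inner_scaleR_right
        H(2) K(2) inner_axis fst_conv snd_conv inner_real_def mult_1_right ..
    also have "\<dots> = blinfun_apply (hess_xy fl x y) p \<bullet> h
      + (\<Sum>i\<in>UNIV. z $ i * (blinfun_apply (hess_xy (c i) x y) p \<bullet> h))
      + (\<Sum>i\<in>UNIV. switch I z i * q $ i * (grad_x (c i) x y \<bullet> h))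
      + (blinfun_apply (hess_yy fl x y) p \<bullet> u
      + (\<Sum>i\<in>UNIV. z $ i * (blinfun_apply (hess_yy (c i) x y) p \<bullet> u))
      + (\<Sum>i\<in>UNIV. switch I z i * q $ i * (grad_y (c i) x y \<bullet> u))
      + ((\<Sum>i\<in>UNIV. (p \<bullet> grad_y (c i) x y) * m $ i)
      + (\<Sum>i\<in>UNIV. (if i \<in> I then m $ i else 0) * c i (x, y) * q $ i)))"
      by (simp only: sum.distrib distrib_left distrib_right inner_commute mult_ac add_ac)
    \<comment> \<open>The second block depends on the multipliers only in its inequality rows, so
      this part of the derivative is a sum over \<open>I\<close>.\<close>
    also have "(\<Sum>i\<in>UNIV. (if i \<in> I then m $ i else 0) * c i (x, y) * q $ i)
        = (\<Sum>i\<in>I. c i (x, y) * q $ i * m $ i)"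
      by (rule sum.mono_neutral_cong_right) auto
    finally show ?thesis
      unfolding l k v KKT_x_apply KKT_v_apply inner_Pair inner_add_left inner_sum_left
        inner_scaleR_left inner_axis' fst_conv snd_conv inner_real_def mult_1_left .
  qed
  ultimately show ?thesis by blast
qed

lemma vgrad_KKT_map:
  fixes fl :: "'x::euclidean_space \<times> 'y::euclidean_space \<Rightarrow> real" and c :: "'j::finite \<Rightarrow> 'x \<times> 'y \<Rightarrow> real"
  assumes "C2 fl" "\<And>i. C2 (c i)"
  shows "vgrad (\<lambda>x'. KKT_map I c fl x' v) x = KKT_x I c fl x v"
    "vgrad (KKT_map I c fl x) v = KKT_v I c fl x v"
proof -
  obtain G' where G': "((\<lambda>p. KKT_map I c fl (fst p) (snd p)) has_derivative G') (at (x, v))"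
    "\<And>l h k. l \<bullet> G' (h, k) = blinfun_apply (KKT_x I c fl x v) l \<bullet> h + blinfun_apply (KKT_v I c fl x v) l \<bullet> k"
    using KKT_map_derivative[where fl = fl and c = c and I = I and x = x and v = v, OF assms] by blast
  show "vgrad (\<lambda>x'. KKT_map I c fl x' v) x = KKT_x I c fl x v"
    "vgrad (KKT_map I c fl x) v = KKT_v I c fl x v"
    using vgrad_partial[OF G'] by simp_all
qed

section \<open>Closed graph of the lower-level solution\<close>

text \<open>Every fixed \<open>u\<close> competes at each \<open>s n\<close>, so minimality passes
  to the limit by continuity of \<open>fl\<close>, and uniqueness identifies the limit.\<close>

lemma unconstrained_closed_graph:
  fixes fl :: "'x::euclidean_space \<times> 'y::euclidean_space \<Rightarrow> real"
  assumes fl: "continuous_on UNIV fl" and unique: "unique_LL_solution fl (\<lambda>x. UNIV) y"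
    and s: "s \<longlonglongrightarrow> x" and p: "(\<lambda>n. y (s n)) \<longlonglongrightarrow> p"
  shows "p = y x"
proof -
  have optimal: "fl (x, y x) \<le> fl (x, u)" for x u
  proof -
    have "is_arg_min (\<lambda>u. fl (x, u)) (\<lambda>u. u \<in> UNIV) (y x)"
      using unique unfolding unique_LL_solution_def by blast
    thus ?thesis unfolding is_arg_min_def by (auto simp: not_less)
  qed
  have "fl (x, p) \<le> fl (x, u)" for u
  proof (rule LIMSEQ_le)
    show "(\<lambda>n. fl (s n, y (s n))) \<longlonglongrightarrow> fl (x, p)" "(\<lambda>n. fl (s n, u)) \<longlonglongrightarrow> fl (x, u)"
      using continuous_on_tendsto_compose[OF fl tendsto_Pair[OF s p]]
        continuous_on_tendsto_compose[OF fl tendsto_Pair[OF s tendsto_const]] by auto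
  qed (use optimal in auto)
  hence "is_arg_min (\<lambda>u. fl (x, u)) (\<lambda>u. u \<in> UNIV) p"
    unfolding is_arg_min_def by (auto simp: not_less)
  thus ?thesis using unique unfolding unique_LL_solution_def by blast
qed

text \<open>The limit is feasible by continuity, but the minimizer at \<open>x\<close> need not be
  feasible at \<open>s n\<close>, so competitors there have to be constructed. Uniqueness of the
  minimizer then settles only the \<open>y\<close> part; the multipliers are compared separately,
  through surjectivity of \<open>KKT_v\<close>.\<close>

lemma KKT_closed_graph:
  fixes fl :: "'x::euclidean_space \<times> 'y::euclidean_space \<Rightarrow> real" and c :: "'j::finite \<Rightarrow> 'x \<times> 'y \<Rightarrow> real"
    and v :: "'x \<Rightarrow> 'y \<times> (real^'j)"
  assumes fl: "C2 fl" and c: "\<And>i. C2 (c i)"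
    and unique: "unique_LL_solution fl (feasible I c) (\<lambda>x. fst (v x))"
    and KKT: "\<And>x. KKT I c fl x (fst (v x)) (snd (v x))"
    and SC: "\<And>x. strict_complementarity I c x (fst (v x)) (snd (v x))"
    and bij: "\<And>x. bij (blinfun_apply (KKT_v I c fl x (v x)))"
    and s: "s \<longlonglongrightarrow> x" and p: "(\<lambda>n. v (s n)) \<longlonglongrightarrow> p"
  shows "p = v x"
proof -
  have C1: "C1 fl" "\<And>i. C1 (c i)" using fl c unfolding C2_def by auto
  have cont_fl: "continuous_on UNIV fl" and cont_c: "continuous_on UNIV (c i)" for i
    using C1 by (auto intro: C1_continuous)
  define G where "G q = KKT_map I c fl (fst q) (snd q)" for q
  have G_deriv: "\<exists>G'. (G has_derivative G') (at (x, u)) \<and> (\<forall>h k l. l \<bullet> G' (h, k)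
      = blinfun_apply (KKT_x I c fl x u) l \<bullet> h + blinfun_apply (KKT_v I c fl x u) l \<bullet> k)" for x u
    unfolding G_def by (rule KKT_map_derivative[where fl = fl and c = c, OF fl c])
  have cont_G: "continuous_on UNIV G"
    by (intro continuous_at_imp_continuous_on ballI) (metis G_deriv has_derivative_continuous prod.collapse)
  have feas: "fst (v x) \<in> feasible I c x" for x using KKT unfolding KKT_def by blast
  have zero: "G (x, v x) = 0" for x
    using KKT[of x] unfolding G_def KKT_map_def KKT_def feasible_def
    by (auto simp: case_prod_unfold zero_prod_def vec_eq_iff)
  have optimal: "fl (x, fst (v x)) \<le> fl (x, u)" if "u \<in> feasible I c x" for x u
  proof -
    have "is_arg_min (\<lambda>u. fl (x, u)) (\<lambda>u. u \<in> feasible I c x) (fst (v x))"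
      using unique unfolding unique_LL_solution_def by blast
    with that show ?thesis unfolding is_arg_min_def by (auto simp: not_less)
  qed
  have sp: "(\<lambda>n. (s n, fst (v (s n)))) \<longlonglongrightarrow> (x, fst p)"
    by (intro tendsto_Pair tendsto_fst s p)
  have lim: "(\<lambda>n. g (s n, fst (v (s n)))) \<longlonglongrightarrow> g (x, fst p)"
    if "continuous_on UNIV g" for g :: "'x \<times> 'y \<Rightarrow> real"
    using continuous_on_tendsto_compose[OF that sp] by simp
  have p_feas: "fst p \<in> feasible I c x"
  proof -
    have "c i (x, fst p) \<le> 0" if "i \<in> I" for i
      by (rule LIMSEQ_le_const2[OF lim[OF cont_c]]) (use feas that in \<open>auto simp: feasible_def\<close>)
    moreover have "c i (x, fst p) = 0" if "i \<notin> I" for i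
    proof (rule LIMSEQ_unique[OF lim[OF cont_c]])
      have "(\<lambda>n. c i (s n, fst (v (s n)))) = (\<lambda>n. 0)" using feas that by (auto simp: feasible_def)
      thus "(\<lambda>n. c i (s n, fst (v (s n)))) \<longlonglongrightarrow> 0" by simp
    qed
    ultimately show ?thesis unfolding feasible_def by blast
  qed
  text \<open>The KKT system is an open map, so points near \<open>v x\<close> solve it at every parameter near \<open>x\<close>; by
    strict complementarity these solutions are feasible, and they bound the optimal values from
    above.\<close>
  have "fl (x, fst p) \<le> fl (x, fst (v x))"
  proof (rule ccontr)
    assume "\<not> ?thesis"
    then obtain m where m: "fl (x, fst (v x)) < m" "m < fl (x, fst p)" using dense not_le by metis
    \<comment> \<open>An open set in which zeros of \<open>G\<close> are automatically feasible:
      where \<open>c i\<close> vanishes at the solution, \<open>z $ i\<close> stays positive and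
      complementarity forces \<open>c i = 0\<close>; where \<open>c i\<close> is negative it stays
      so. The level \<open>m\<close> makes such zeros strictly better than the values near
      \<open>fl (x, fst p)\<close>.\<close>
    define T :: "('x \<times> 'y \<times> (real^'j)) set" where "T = {q. fl (fst q, fst (snd q)) < m} \<inter>
      (\<Inter>i\<in>I. if c i (x, fst (v x)) = 0 then {q. 0 < snd (snd q) $ i} else {q. c i (fst q, fst (snd q)) < 0})"
    have pr: "continuous_on UNIV (\<lambda>q::'x \<times> 'y \<times> (real^'j). (fst q, fst (snd q)))"
      by (intro continuous_intros)
    have "open T"
      unfolding T_def
      by (intro open_Int open_INT ballI)
         (auto intro!: open_Collect_less continuous_intros continuous_on_compose2[OF cont_fl pr]
           continuous_on_compose2[OF cont_c pr])
    moreover have "(x, v x) \<in> T"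
      using m(1) feas[of x] SC[of x]
      by (auto simp: T_def feasible_def strict_complementarity_def order.order_iff_strict)
    ultimately have T: "(x, v x) \<in> interior T" by (simp add: interior_open)
    obtain G' where G': "(G has_derivative G') (at (x, v x))"
      "\<And>h k l. l \<bullet> G' (h, k) = blinfun_apply (KKT_x I c fl x (v x)) l \<bullet> h
        + blinfun_apply (KKT_v I c fl x (v x)) l \<bullet> k"
      using G_deriv[of x "v x"] by blast
    note lin = has_derivative_linear[OF G'(1)]
    obtain H where H: "bounded_linear H" "\<And>k. H (G' (0, k)) = k" "\<And>y. G' (0, H y) = y"
      using partial_derivative_inverse[OF lin G'(2) bij] by blast
    \<comment> \<open>Keeping the parameter as first component makes a preimage of
      \<open>(s n, 0)\<close> a zero of \<open>G\<close> with parameter exactly \<open>s n\<close>.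
      The derivative is block triangular, with right inverse
      \<open>(h, l) \<mapsto> (h, H (l - G' (h, 0)))\<close>; the open mapping theorem asks for
      continuity and for differentiability at this one point.\<close>
    define \<Phi> where "\<Phi> q = (fst q, G q)" for q
    have "\<Phi> (x, v x) \<in> interior (\<Phi> ` T)"
    proof (rule sussmann_open_mapping[OF open_UNIV])
      show "continuous_on UNIV \<Phi>" unfolding \<Phi>_def by (intro continuous_intros cont_G)
      show "(\<Phi> has_derivative (\<lambda>q. (fst q, G' q))) (at (x, v x))"
        unfolding \<Phi>_def by (intro has_derivative_Pair G' has_derivative_fst has_derivative_ident)
      have blG: "bounded_linear G'" using lin by (simp add: linear_conv_bounded_linear)
      show "bounded_linear (\<lambda>q. (fst q, H (snd q - G' (fst q, 0))))"
        by (intro bounded_linear_Pair bounded_linear_fst bounded_linear_compose[OF H(1)]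
            bounded_linear_sub bounded_linear_snd bounded_linear_compose[OF blG] bounded_linear_zero)
      have "G' (h, H (l - G' (h, 0))) = l" for h l
        using linear_add[OF lin, of "(h, 0)" "(0, H (l - G' (h, 0)))"] by (simp add: H(3))
      thus "(\<lambda>q. (fst q, G' q)) \<circ> (\<lambda>q. (fst q, H (snd q - G' (fst q, 0)))) = id"
        by (auto simp: fun_eq_iff)
    qed (use T in auto)
    hence "\<forall>\<^sub>F n in sequentially. (s n, 0) \<in> interior (\<Phi> ` T)"
      by (intro topological_tendstoD[OF _ open_interior])
         (auto simp: \<Phi>_def zero intro!: tendsto_Pair s)
    moreover have "\<forall>\<^sub>F n in sequentially. m < fl (s n, fst (v (s n)))"
      using order_tendstoD(1)[OF lim[OF cont_fl] m(2)] .
    ultimately have "\<forall>\<^sub>F n in sequentially. (s n, 0) \<in> interior (\<Phi> ` T) \<and> m < fl (s n, fst (v (s n)))"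
      by (rule eventually_conj)
    then obtain n where n: "(s n, 0) \<in> \<Phi> ` T" "m < fl (s n, fst (v (s n)))"
      using interior_subset unfolding eventually_sequentially by blast
    then obtain q where q: "q \<in> T" "fst q = s n" "G q = 0" unfolding \<Phi>_def by auto
    obtain y z where yz: "q = (s n, y, z)" using q(2) by (cases q) auto
    have comp: "i \<in> I \<Longrightarrow> z $ i * c i (s n, y) = 0" "i \<notin> I \<Longrightarrow> c i (s n, y) = 0" for i
      using q(3) unfolding G_def KKT_map_def yz
      by (auto simp: zero_prod_def vec_eq_iff split: if_splits)
    have "c i (s n, y) \<le> 0" if "i \<in> I" for i
    proof -
      have "q \<in> (if c i (x, fst (v x)) = 0 then {q. 0 < snd (snd q) $ i} else {q. c i (fst q, fst (snd q)) < 0})"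
        using q(1) that unfolding T_def by blast
      with comp(1)[OF that] show ?thesis unfolding yz by (auto split: if_splits)
    qed
    with comp(2) have "y \<in> feasible I c (s n)" unfolding feasible_def by auto
    hence "fl (s n, fst (v (s n))) \<le> fl (s n, y)" by (rule optimal)
    moreover have "fl (s n, y) < m" using q(1) unfolding T_def yz by simp
    ultimately show False using n(2) by simp
  qed
  hence "is_arg_min (\<lambda>u. fl (x, u)) (\<lambda>u. u \<in> feasible I c x) (fst p)"
    unfolding is_arg_min_def using p_feas optimal[of _ x] by (meson not_le order_trans)
  hence y: "fst p = fst (v x)" using unique unfolding unique_LL_solution_def by blast
  have "(\<lambda>n. G (s n, v (s n))) \<longlonglongrightarrow> G (x, p)"
    using continuous_on_tendsto_compose[OF cont_G tendsto_Pair[OF s p]] by simp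
  hence Gp: "G (x, p) = 0" unfolding zero using LIMSEQ_unique tendsto_const by blast
  \<comment> \<open>Both multiplier vectors solve the KKT system with the same \<open>y\<close>, so
    \<open>(0, \<delta>)\<close> is orthogonal to the range of \<open>KKT_v\<close> at the solution.
    That range is the whole space, so \<open>(0, \<delta>)\<close> is orthogonal to itself.\<close>
  define \<delta> where "\<delta> = snd p - snd (v x)"
  have "fst (G (x, p)) - fst (G (x, v x)) = 0" using Gp zero by simp
  hence \<delta>1: "(\<Sum>i\<in>UNIV. \<delta> $ i *\<^sub>R grad_y (c i) x (fst (v x))) = 0"
    unfolding G_def KKT_map_eq[OF C1] \<delta>_def
    by (simp add: y scaleR_diff_left sum_subtractf)
  have \<delta>2: "c i (x, fst (v x)) * \<delta> $ i = 0" if "i \<in> I" for i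
  proof -
    have "snd p $ i * c i (x, fst (v x)) = 0" "snd (v x) $ i * c i (x, fst (v x)) = 0"
      using Gp zero[of x] that y unfolding G_def KKT_map_def
      by (auto simp: case_prod_unfold zero_prod_def vec_eq_iff split: if_splits)
    thus ?thesis unfolding \<delta>_def by (auto simp: algebra_simps)
  qed
  have ortho: "blinfun_apply (KKT_v I c fl x (v x)) l \<bullet> (0, \<delta>) = 0" for l
  proof -
    obtain a b where l: "l = (a, b)" by (cases l)
    have "blinfun_apply (KKT_v I c fl x (v x)) l \<bullet> (0, \<delta>)
        = (\<Sum>i\<in>UNIV. (a \<bullet> grad_y (c i) x (fst (v x))) * \<delta> $ i) + (\<Sum>i\<in>I. c i (x, fst (v x)) * b $ i * \<delta> $ i)"
      unfolding l KKT_v_apply by (simp add: inner_add_left inner_sum_left inner_axis')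
    also have "(\<Sum>i\<in>I. c i (x, fst (v x)) * b $ i * \<delta> $ i) = 0"
      using \<delta>2 by (intro sum.neutral) auto
    also have "(\<Sum>i\<in>UNIV. (a \<bullet> grad_y (c i) x (fst (v x))) * \<delta> $ i)
        = a \<bullet> (\<Sum>i\<in>UNIV. \<delta> $ i *\<^sub>R grad_y (c i) x (fst (v x)))"
      by (simp add: inner_sum_right mult.commute)
    also have "\<dots> = 0" unfolding \<delta>1 by simp
    finally show ?thesis by simp
  qed
  obtain l where "blinfun_apply (KKT_v I c fl x (v x)) l = (0, \<delta>)"
    using bij_is_surj[OF bij] by (metis surjD)
  with ortho[of l] have "\<delta> = 0" by (simp add: zero_prod_def)
  with y show ?thesis unfolding \<delta>_def by (simp add: prod_eq_iff)
qed

section \<open>Convergence in the two cases\<close>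

text \<open>The common form of both cases. \<open>P\<close> has to contain the visited pairs besides
  the graph, because the Lipschitz constant of the deterministic data is used between
  \<open>(x_k, w(x_k))\<close> and the pair formed with the approximation.\<close>

lemma (in bsg_assumptions) bsg_convergence_implicit:
  fixes P :: "('x \<times> 'w) set" and F :: "'x \<times> 'w \<Rightarrow> real" and G :: "'x \<times> 'w \<Rightarrow> 'w"
  assumes X: "closed X" "convex X"
    and steps: "filterlim (\<lambda>K. \<Sum>k\<le>K. \<alpha> k) at_top sequentially" "summable (\<lambda>k. (\<alpha> k)\<^sup>2)"
    and D: "\<And>x u. D x u = (a (x, u), b (x, u), A (x, u), B (x, u))"
    and f: "\<And>x. f x = F (x, w x)"
    and graph: "\<And>x. (x, w x) \<in> P"
    and approx: "\<And>k \<omega>. \<omega> \<in> space M \<Longrightarrow> (iterate R k \<omega>, approx R k \<omega>) \<in> P"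
    and F: "\<And>x. GDERIV F (x, w x) :> (a (x, w x), b (x, w x))"
    and zero: "\<And>x. G (x, w x) = 0"
    and G: "\<And>x. \<exists>G'. (G has_derivative G') (at (x, w x)) \<and>
      (\<forall>h k l. l \<bullet> G' (h, k) = blinfun_apply (A (x, w x)) l \<bullet> h + blinfun_apply (B (x, w x)) l \<bullet> k)"
    and bij: "\<And>p. p \<in> P \<Longrightarrow> bij (blinfun_apply (B p))"
    and regular: "lip_bdd P a" "lip_bdd P b" "lip_bdd P A" "\<exists>L. L-lipschitz_on P B"
      "bounded ((\<lambda>p. binv (B p)) ` P)"
    and closed_graph: "\<And>s x p. s \<longlonglongrightarrow> x \<Longrightarrow> (\<lambda>n. w (s n)) \<longlonglongrightarrow> p \<Longrightarrow> p = w x"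
  shows "(\<forall>K. integrable M (weighted_sum X f \<alpha> (iterate R) K)) \<and>
    convergent (\<lambda>K. \<integral>\<omega>. weighted_sum X f \<alpha> (iterate R) K \<omega> \<partial>M) \<and>
    (\<lambda>K. \<integral>\<omega>. (1 / (\<Sum>k\<le>K. \<alpha> k)) * weighted_sum X f \<alpha> (iterate R) K \<omega> \<partial>M) \<longlonglongrightarrow> 0"
proof -
  obtain L\<^sub>B where L\<^sub>B: "L\<^sub>B-lipschitz_on P B" using regular(4) by blast
  note grad = implicit_gradient[OF graph F zero G bij regular(1-3) L\<^sub>B regular(5) closed_graph]
  have f_eq: "f = (\<lambda>x. F (x, w x))" using f by (rule ext)
  have dir: "- direction (D x (w x)) 0
      = a (x, w x) - blinfun_apply (A (x, w x)) (blinfun_apply (binv (B (x, w x))) (b (x, w x)))" for x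
    unfolding direction_def D by (simp add: zero_prod_def)
  obtain L\<^sub>a L\<^sub>b L\<^sub>A where L: "L\<^sub>a-lipschitz_on P a" "L\<^sub>b-lipschitz_on P b" "L\<^sub>A-lipschitz_on P A"
    using regular(1-3) unfolding lip_bdd_def by blast
  define L\<^sub>D where "L\<^sub>D = sqrt (L\<^sub>a\<^sup>2 + (sqrt (L\<^sub>b\<^sup>2 + (sqrt (L\<^sub>A\<^sup>2 + L\<^sub>B\<^sup>2))\<^sup>2))\<^sup>2)"
  have L\<^sub>D: "L\<^sub>D-lipschitz_on P (\<lambda>p. (a p, b p, A p, B p))"
    unfolding L\<^sub>D_def by (intro lipschitz_on_Pair L L\<^sub>B)
  show ?thesis
  proof (intro conjI allI)
    have D_lip: "norm (D (iterate R k \<omega>) (approx R k \<omega>) - D (iterate R k \<omega>) (w (iterate R k \<omega>)))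
        \<le> L\<^sub>D * norm (w (iterate R k \<omega>) - approx R k \<omega>)" if "\<omega> \<in> space M" for k \<omega>
      using lipschitz_onD[OF L\<^sub>D approx[OF that] graph, of k "iterate R k \<omega>"]
      unfolding D by (simp add: dist_norm norm_Pair norm_minus_commute)
    have 1: "GDERIV f x :> - direction (D x (w x)) 0" for x unfolding f_eq dir by (rule grad(1))
    have 2: "lip_bdd UNIV (\<lambda>x. - direction (D x (w x)) 0)" unfolding dir by (rule grad(2))
    note conv = bsg_convergence[OF X steps 1 2 D_lip]
    show "integrable M (weighted_sum X f \<alpha> (iterate R) K)" for K by (rule conv(1))
    show "convergent (\<lambda>K. \<integral>\<omega>. weighted_sum X f \<alpha> (iterate R) K \<omega> \<partial>M)" by (rule conv(2))
    show "(\<lambda>K. \<integral>\<omega>. (1 / (\<Sum>k\<le>K. \<alpha> k)) * weighted_sum X f \<alpha> (iterate R) K \<omega> \<partial>M) \<longlonglongrightarrow> 0"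
      by (rule conv(3))
  qed
qed

section \<open>Lipschitz and boundedness estimates for the data\<close>

lemma lip_bdd_UNIV: "lipschitz_map g \<Longrightarrow> bounded (range g) \<Longrightarrow> lip_bdd UNIV g"
  unfolding lipschitz_map_def lip_bdd_def by blast

text \<open>The regularity hypotheses concern functions of \<open>(x, y)\<close>, while
  \<open>P\<close> consists of triples with multipliers; forgetting the multipliers is
  1-Lipschitz.\<close>

lemma lip_bdd_fst_fst_snd:
  "lip_bdd UNIV g \<Longrightarrow> lip_bdd P (\<lambda>p::'x::real_normed_vector \<times> 'y::real_normed_vector \<times> 'z::real_normed_vector.
    g (fst p, fst (snd p)))"
proof (erule lip_bdd_compose)
  show "1-lipschitz_on P (\<lambda>p. (fst p, fst (snd p)))"
  proof (rule lipschitz_onI)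
    fix p q :: "'x \<times> 'y \<times> 'z"
    have "dist (fst (snd p)) (fst (snd q)) \<le> dist (snd p) (snd q)" by (rule dist_fst_le)
    thus "dist (fst p, fst (snd p)) (fst q, fst (snd q)) \<le> 1 * dist p q"
      by (simp add: dist_prod_def power_mono)
  qed simp
qed simp

lemma lip_bdd_blinfun_compose:
  "lip_bdd S F \<Longrightarrow> lip_bdd S G \<Longrightarrow> lip_bdd S (\<lambda>p. F p o\<^sub>L G p)"
  by (rule lip_bdd_bilinear[OF bounded_bilinear_blinfun_compose])

lemma lip_bdd_scaleR:
  "lip_bdd S r \<Longrightarrow> lip_bdd S F \<Longrightarrow> lip_bdd S (\<lambda>p. r p *\<^sub>R F p)"
  by (rule lip_bdd_bilinear[OF bounded_bilinear_scaleR])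

lemma lipschitz_on_sum_exists:
  fixes F :: "'i \<Rightarrow> 'a::metric_space \<Rightarrow> 'b::real_normed_vector"
  shows "(\<And>i. i \<in> I \<Longrightarrow> \<exists>L. L-lipschitz_on S (F i)) \<Longrightarrow> \<exists>L. L-lipschitz_on S (\<lambda>p. \<Sum>i\<in>I. F i p)"
proof (induction I rule: infinite_finite_induct)
  case (insert i I)
  obtain L where L: "L-lipschitz_on S (F i)" using insert.prems[of i] by auto
  obtain L' where L': "L'-lipschitz_on S (\<lambda>p. \<Sum>i\<in>I. F i p)" using insert.IH insert.prems by auto
  have "(L + L')-lipschitz_on S (\<lambda>p. \<Sum>i\<in>insert i I. F i p)"
    using lipschitz_on_add[OF L L'] insert.hyps by simp
  thus ?case ..
qed (auto intro!: exI[of _ 0] lipschitz_on_constant)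

lemma C1_lipschitz:
  fixes g :: "'a::euclidean_space \<Rightarrow> real"
  assumes g: "C1 g" and bd: "bounded (range (grad g))"
  shows "\<exists>L. L-lipschitz_on UNIV g"
proof -
  obtain C where C: "C > 0" "\<And>x. norm (grad g x) \<le> C" using bd unfolding bounded_pos by auto
  have "C-lipschitz_on UNIV g"
  proof (rule lipschitz_onI)
    fix x y
    obtain z where "g x - g y = (x - y) \<bullet> grad g z" using C1_GDERIV[OF g] by (rule GDERIV_mvt)
    hence "\<bar>g x - g y\<bar> \<le> norm (x - y) * norm (grad g z)" by (simp add: Cauchy_Schwarz_ineq2)
    also have "\<dots> \<le> norm (x - y) * C" by (intro mult_left_mono C) auto
    finally show "dist (g x) (g y) \<le> C * dist x y" by (simp add: dist_norm mult.commute)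
  qed (use C in simp)
  thus ?thesis by blast
qed

lemma pos_def_bij:
  fixes B :: "'a::euclidean_space \<Rightarrow>\<^sub>L 'a"
  assumes "pos_def B" shows "bij (blinfun_apply B)"
proof -
  have lin: "linear (blinfun_apply B)"
    by (rule bounded_linear.linear[OF blinfun.bounded_linear_right])
  have "inj (blinfun_apply B)"
    using assms unfolding linear_injective_0[OF lin] pos_def_def
    by (metis inner_zero_right less_irrefl)
  thus ?thesis using linear_injective_imp_surjective[OF lin] unfolding bij_def by blast
qed

text \<open>The multipliers occur as factors of Hessians and gradients, so their boundedness on
  \<open>P\<close> is what keeps the products Lipschitz.\<close>

lemma lip_bdd_KKT_x:
  fixes fl :: "'x::euclidean_space \<times> 'y::euclidean_space \<Rightarrow> real" and c :: "'j::finite \<Rightarrow> 'x \<times> 'y \<Rightarrow> real"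
  assumes C1: "\<And>i. C1 (c i)"
    and z: "\<And>i. lip_bdd P (\<lambda>p. snd (snd p) $ i)"
    and fl: "lip_bdd UNIV (\<lambda>(x, y). hess_xy fl x y)"
    and c: "\<And>i. lip_bdd UNIV (grad (c i))" "\<And>i. lip_bdd UNIV (\<lambda>(x, y). hess_xy (c i) x y)"
  shows "lip_bdd P (\<lambda>p. KKT_x I c fl (fst p) (snd p))"
proof -
  have fl': "lip_bdd P (\<lambda>p. hess_xy fl (fst p) (fst (snd p)))"
    using lip_bdd_fst_fst_snd[OF fl] by simp
  have c': "lip_bdd P (\<lambda>p. hess_xy (c i) (fst p) (fst (snd p)))" for i
    using lip_bdd_fst_fst_snd[OF c(2)] by simp
  have g: "lip_bdd P (\<lambda>p. blinfun_scaleR_left (grad_x (c i) (fst p) (fst (snd p))))" for i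
    unfolding grad_xy_eq[OF C1]
    by (intro lip_bdd_linear[OF bounded_linear_blinfun_scaleR_left] lip_bdd_linear[OF bounded_linear_fst]
        lip_bdd_fst_fst_snd[OF c(1)])
  have s: "lip_bdd P (\<lambda>p. switch I (snd (snd p)) i)" for i
    unfolding switch_def using z[of i] by (cases "i \<in> I") (auto intro: lip_bdd_const)
  show ?thesis unfolding KKT_x_def
    by (intro lip_bdd_add lip_bdd_sum lip_bdd_scaleR lip_bdd_blinfun_compose lip_bdd_const fl' c' g s z)
qed

text \<open>No boundedness is claimed: the last sum contains the values \<open>c i\<close>, which
  are Lipschitz by their bounded gradients but may be unbounded. They multiply constant matrices, so
  that sum is still Lipschitz; all other terms are in \<open>lip_bdd\<close>.\<close>

lemma lipschitz_KKT_v: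
  fixes fl :: "'x::euclidean_space \<times> 'y::euclidean_space \<Rightarrow> real" and c :: "'j::finite \<Rightarrow> 'x \<times> 'y \<Rightarrow> real"
  assumes C1: "\<And>i. C1 (c i)"
    and z: "\<And>i. lip_bdd P (\<lambda>p. snd (snd p) $ i)"
    and fl: "lip_bdd UNIV (\<lambda>(x, y). hess_yy fl x y)"
    and c: "\<And>i. lip_bdd UNIV (grad (c i))" "\<And>i. lip_bdd UNIV (\<lambda>(x, y). hess_yy (c i) x y)"
  shows "\<exists>L. L-lipschitz_on P (\<lambda>p. KKT_v I c fl (fst p) (snd p))"
proof -
  have fl': "lip_bdd P (\<lambda>p. hess_yy fl (fst p) (fst (snd p)))"
    using lip_bdd_fst_fst_snd[OF fl] by simp
  have c': "lip_bdd P (\<lambda>p. hess_yy (c i) (fst p) (fst (snd p)))" for i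
    using lip_bdd_fst_fst_snd[OF c(2)] by simp
  have g: "lip_bdd P (\<lambda>p. grad_y (c i) (fst p) (fst (snd p)))" for i
    unfolding grad_xy_eq[OF C1]
    by (intro lip_bdd_linear[OF bounded_linear_snd] lip_bdd_fst_fst_snd[OF c(1)])
  have s: "lip_bdd P (\<lambda>p. switch I (snd (snd p)) i)" for i
    unfolding switch_def using z[of i] by (cases "i \<in> I") (auto intro: lip_bdd_const)
  have "lip_bdd P (\<lambda>p. (Blinfun (\<lambda>k. (k, 0)) o\<^sub>L
      ((hess_yy fl (fst p) (fst (snd p)) o\<^sub>L fst_blinfun)
       + (\<Sum>i\<in>UNIV. snd (snd p) $ i *\<^sub>R (hess_yy (c i) (fst p) (fst (snd p)) o\<^sub>L fst_blinfun))
       + (\<Sum>i\<in>UNIV. switch I (snd (snd p)) i *\<^sub>R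
         (blinfun_scaleR_left (grad_y (c i) (fst p) (fst (snd p))) o\<^sub>L blinfun_inner_left (0, axis i 1)))))
     + (\<Sum>i\<in>UNIV. blinfun_scaleR_left (0, axis i 1) o\<^sub>L
         (blinfun_inner_left (grad_y (c i) (fst p) (fst (snd p))) o\<^sub>L fst_blinfun))
      :: ('y \<times> (real^'j)) \<Rightarrow>\<^sub>L ('y \<times> (real^'j)))"
    by (intro lip_bdd_add lip_bdd_sum lip_bdd_scaleR lip_bdd_blinfun_compose lip_bdd_const fl' c' s z
        lip_bdd_linear[OF bounded_linear_blinfun_scaleR_left g] lip_bdd_linear[OF bounded_linear_blinfun_inner_left g])
  then obtain L where L: "L-lipschitz_on P (\<lambda>p. (Blinfun (\<lambda>k. (k, 0)) o\<^sub>L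
      ((hess_yy fl (fst p) (fst (snd p)) o\<^sub>L fst_blinfun)
       + (\<Sum>i\<in>UNIV. snd (snd p) $ i *\<^sub>R (hess_yy (c i) (fst p) (fst (snd p)) o\<^sub>L fst_blinfun))
       + (\<Sum>i\<in>UNIV. switch I (snd (snd p)) i *\<^sub>R
         (blinfun_scaleR_left (grad_y (c i) (fst p) (fst (snd p))) o\<^sub>L blinfun_inner_left (0, axis i 1)))))
     + (\<Sum>i\<in>UNIV. blinfun_scaleR_left (0, axis i 1) o\<^sub>L
         (blinfun_inner_left (grad_y (c i) (fst p) (fst (snd p))) o\<^sub>L fst_blinfun))
      :: ('y \<times> (real^'j)) \<Rightarrow>\<^sub>L ('y \<times> (real^'j)))"
    using lip_bdd_lipschitz by blast
  have "\<exists>L. L-lipschitz_on P (\<lambda>p. c i (fst p, fst (snd p)) *\<^sub>R T)" for i and T :: "('y \<times> (real^'j)) \<Rightarrow>\<^sub>L ('y \<times> (real^'j))"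
  proof -
    obtain C where C: "C-lipschitz_on UNIV (c i)"
      using C1_lipschitz[OF C1] c(1) unfolding lip_bdd_def by blast
    have "(C * norm T)-lipschitz_on P (\<lambda>p. c i (fst p, fst (snd p)) *\<^sub>R T)"
    proof (rule lipschitz_onI)
      fix p q :: "'x \<times> 'y \<times> (real^'j)"
      have "dist (c i (fst p, fst (snd p))) (c i (fst q, fst (snd q))) \<le> C * dist (fst p, fst (snd p)) (fst q, fst (snd q))"
        by (rule lipschitz_onD[OF C]) auto
      also have "dist (fst p, fst (snd p)) (fst q, fst (snd q)) \<le> dist p q"
        using dist_fst_le[of "snd p" "snd q"] by (simp add: dist_prod_def power_mono)
      hence "C * dist (fst p, fst (snd p)) (fst q, fst (snd q)) \<le> C * dist p q"
        using lipschitz_on_nonneg[OF C] by (rule mult_left_mono)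
      finally have "\<bar>c i (fst p, fst (snd p)) - c i (fst q, fst (snd q))\<bar> * norm T \<le> C * dist p q * norm T"
        unfolding dist_real_def by (intro mult_right_mono) auto
      thus "dist (c i (fst p, fst (snd p)) *\<^sub>R T) (c i (fst q, fst (snd q)) *\<^sub>R T) \<le> C * norm T * dist p q"
        by (simp add: dist_norm mult_ac flip: scaleR_diff_left)
    qed (use lipschitz_on_nonneg[OF C] in simp)
    thus ?thesis by blast
  qed
  hence "\<exists>L. L-lipschitz_on P (\<lambda>p. \<Sum>i\<in>I. c i (fst p, fst (snd p)) *\<^sub>R
      (blinfun_scaleR_left (0, axis i 1) o\<^sub>L blinfun_inner_left (0, axis i 1)
        :: ('y \<times> (real^'j)) \<Rightarrow>\<^sub>L ('y \<times> (real^'j))))"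
    by (intro lipschitz_on_sum_exists)
  then obtain L' where "L'-lipschitz_on P (\<lambda>p. \<Sum>i\<in>I. c i (fst p, fst (snd p)) *\<^sub>R
      (blinfun_scaleR_left (0, axis i 1) o\<^sub>L blinfun_inner_left (0, axis i 1)
        :: ('y \<times> (real^'j)) \<Rightarrow>\<^sub>L ('y \<times> (real^'j))))" ..
  from lipschitz_on_add[OF L this] have "(L + L')-lipschitz_on P (\<lambda>p. KKT_v I c fl (fst p) (snd p))"
    unfolding KKT_v_def .
  thus ?thesis ..
qed

theorem theorem4p3:
  fixes X :: "(real^'n) set"
    and fu fl :: "(real^'n) \<times> (real^'m) \<Rightarrow> real"
    and c :: "'j::finite \<Rightarrow> (real^'n) \<times> (real^'m) \<Rightarrow> real" and I :: "'j set"
    and y :: "real^'n \<Rightarrow> real^'m"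
    and v :: "real^'n \<Rightarrow> (real^'m) \<times> (real^'j)"
    and gx :: "real^'n \<Rightarrow> real^'m \<Rightarrow> 't \<Rightarrow> real^'n"
    and gy :: "real^'n \<Rightarrow> real^'m \<Rightarrow> 't \<Rightarrow> real^'m"
    and Hxy :: "real^'n \<Rightarrow> real^'m \<Rightarrow> 't \<Rightarrow> (real^'m) \<Rightarrow>\<^sub>L (real^'n)"
    and Hyy :: "real^'n \<Rightarrow> real^'m \<Rightarrow> 't \<Rightarrow> (real^'m) \<Rightarrow>\<^sub>L (real^'m)"
    and Gx :: "real^'n \<Rightarrow> (real^'m) \<times> (real^'j) \<Rightarrow> 't \<Rightarrow> ((real^'m) \<times> (real^'j)) \<Rightarrow>\<^sub>L (real^'n)"
    and Gv :: "real^'n \<Rightarrow> (real^'m) \<times> (real^'j) \<Rightarrow> 't \<Rightarrow>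
      ((real^'m) \<times> (real^'j)) \<Rightarrow>\<^sub>L ((real^'m) \<times> (real^'j))"
    and \<alpha> :: "nat \<Rightarrow> real" and mode :: inexactness and M :: "'o measure"
    and Ru :: "(real^'n, real^'m, 's, 't, 'o) bsg_run"
    and Rc :: "(real^'n, (real^'m) \<times> (real^'j), 's, 't, 'o) bsg_run"
    and V\<^sub>d L_BSG L_LL C\<^sub>w C\<^sub>D C\<^sub>e f_inf :: real
  assumes X: "closed X" "convex X"
    and smooth: "C1 fu" "C2 fl"
    and steps: "filterlim (\<lambda>K. \<Sum>k\<le>K. \<alpha> k) at_top sequentially" "summable (\<lambda>k. (\<alpha> k)\<^sup>2)"
  shows
    "(unique_LL_solution fl (\<lambda>x. UNIV) y \<and>
      regular_u fu fl y (space (dir_space Ru)) gx gy Hxy Hyy \<and>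
      bsg_assumptions M X (sdata_u gx gy Hxy Hyy) mode \<alpha> Ru (data_u fu fl) y
        (\<lambda>x. fu (x, y x))
        V\<^sub>d L_BSG L_LL C\<^sub>w C\<^sub>D C\<^sub>e f_inf
      \<longrightarrow>
      (\<forall>K. integrable M (weighted_sum X (\<lambda>x. fu (x, y x)) \<alpha> (iterate Ru) K)) \<and>
      convergent (\<lambda>K. \<integral>\<omega>. weighted_sum X (\<lambda>x. fu (x, y x)) \<alpha> (iterate Ru) K \<omega> \<partial>M) \<and>
      (\<lambda>K. \<integral>\<omega>. (1 / (\<Sum>k\<le>K. \<alpha> k)) *
        weighted_sum X (\<lambda>x. fu (x, y x)) \<alpha> (iterate Ru) K \<omega> \<partial>M) \<longlonglongrightarrow> 0)
     \<and>
     ((\<forall>i. C2 (c i)) \<and> unique_LL_solution fl (feasible I c) (\<lambda>x. fst (v x)) \<and>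
      regular_c I c fu fl v
        (range (\<lambda>x. (x, v x)) \<union> {(iterate Rc k \<omega>, approx Rc k \<omega>) |k \<omega>. \<omega> \<in> space M})
        (space (dir_space Rc)) gx gy Gx Gv \<and>
      bsg_assumptions M X (sdata_c gx gy Gx Gv) mode \<alpha> Rc (data_c I c fu fl) v
        (\<lambda>x. fu (x, fst (v x)))
        V\<^sub>d L_BSG L_LL C\<^sub>w C\<^sub>D C\<^sub>e f_inf
      \<longrightarrow>
      (\<forall>K. integrable M (weighted_sum X (\<lambda>x. fu (x, fst (v x))) \<alpha> (iterate Rc) K)) \<and>
      convergent (\<lambda>K. \<integral>\<omega>. weighted_sum X (\<lambda>x. fu (x, fst (v x))) \<alpha> (iterate Rc) K \<omega> \<partial>M) \<and>
      (\<lambda>K. \<integral>\<omega>. (1 / (\<Sum>k\<le>K. \<alpha> k)) *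
        weighted_sum X (\<lambda>x. fu (x, fst (v x))) \<alpha> (iterate Rc) K \<omega> \<partial>M) \<longlonglongrightarrow> 0)"
proof (rule conjI; rule impI; elim conjE)
  have C1_fl: "C1 fl" using smooth(2) unfolding C2_def by blast
  have fu_deriv: "GDERIV fu (x, u) :> (grad_x fu x u, grad_y fu x u)" for x u
    using C1_GDERIV[OF smooth(1), of "(x, u)"] by (simp add: grad_xy_eq[OF smooth(1)])
  {
    assume unique: "unique_LL_solution fl (\<lambda>x. UNIV) y"
      and regular: "regular_u fu fl y (space (dir_space Ru)) gx gy Hxy Hyy"
      and bsg: "bsg_assumptions M X (sdata_u gx gy Hxy Hyy) mode \<alpha> Ru (data_u fu fl) y
        (\<lambda>x. fu (x, y x)) V\<^sub>d L_BSG L_LL C\<^sub>w C\<^sub>D C\<^sub>e f_inf"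
    have grad_fu: "lip_bdd UNIV (grad fu)"
      and hess: "lip_bdd UNIV (\<lambda>(x, y). hess_xy fl x y)" "lip_bdd UNIV (\<lambda>(x, y). hess_yy fl x y)"
      using regular unfolding regular_u_def by - (elim conjE, intro lip_bdd_UNIV, assumption, assumption)+
    have zero: "\<And>x. grad_y fl x (y x) = 0" and pos: "\<And>x y. pos_def (hess_yy fl x y)"
      and inv: "bounded (range (\<lambda>(x, y). binv (hess_yy fl x y)))"
      using regular unfolding regular_u_def by - (elim conjE, blast)+
    interpret bsg_assumptions M X "sdata_u gx gy Hxy Hyy" mode \<alpha> Ru "data_u fu fl" y
      "\<lambda>x. fu (x, y x)" V\<^sub>d L_BSG L_LL C\<^sub>w C\<^sub>D C\<^sub>e f_inf by (rule bsg)
    show "(\<forall>K. integrable M (weighted_sum X (\<lambda>x. fu (x, y x)) \<alpha> (iterate Ru) K)) \<and>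
      convergent (\<lambda>K. \<integral>\<omega>. weighted_sum X (\<lambda>x. fu (x, y x)) \<alpha> (iterate Ru) K \<omega> \<partial>M) \<and>
      (\<lambda>K. \<integral>\<omega>. (1 / (\<Sum>k\<le>K. \<alpha> k)) *
        weighted_sum X (\<lambda>x. fu (x, y x)) \<alpha> (iterate Ru) K \<omega> \<partial>M) \<longlonglongrightarrow> 0"
    \<comment> \<open>The implicit equation is the first-order condition. The bounds hold at all
      points, which allows \<open>P = UNIV\<close>, and positive definiteness makes the Hessian
      bijective.\<close>
    proof (rule bsg_convergence_implicit[where P = UNIV and F = fu
          and G = "\<lambda>p. grad_y fl (fst p) (snd p)"
          and a = "\<lambda>p. grad_x fu (fst p) (snd p)" and b = "\<lambda>p. grad_y fu (fst p) (snd p)"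
          and A = "\<lambda>p. hess_xy fl (fst p) (snd p)" and B = "\<lambda>p. hess_yy fl (fst p) (snd p)"])
      show "\<exists>G'. ((\<lambda>p. grad_y fl (fst p) (snd p)) has_derivative G') (at (x, y x)) \<and>
          (\<forall>h k l. l \<bullet> G' (h, k) = blinfun_apply (hess_xy fl (fst (x, y x)) (snd (x, y x))) l \<bullet> h
            + blinfun_apply (hess_yy fl (fst (x, y x)) (snd (x, y x))) l \<bullet> k)" for x
        unfolding fst_conv snd_conv by (rule C2_grad_y_derivative[OF smooth(2)])
      show "lip_bdd UNIV (\<lambda>p. grad_x fu (fst p) (snd p))" "lip_bdd UNIV (\<lambda>p. grad_y fu (fst p) (snd p))"
        using lip_bdd_linear[OF bounded_linear_fst grad_fu] lip_bdd_linear[OF bounded_linear_snd grad_fu]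
        by (simp_all add: grad_xy_eq[OF smooth(1)])
      show "lip_bdd UNIV (\<lambda>p. hess_xy fl (fst p) (snd p))"
        "\<exists>L. L-lipschitz_on UNIV (\<lambda>p. hess_yy fl (fst p) (snd p))"
        using hess lip_bdd_lipschitz by (auto simp: case_prod_unfold)
      show "bounded (range (\<lambda>p. binv (hess_yy fl (fst p) (snd p))))"
        using inv by (simp add: case_prod_unfold)
      show "p = y x" if "s \<longlonglongrightarrow> x" "(\<lambda>n. y (s n)) \<longlonglongrightarrow> p" for s x p
        by (rule unconstrained_closed_graph[OF C1_continuous[OF C1_fl] unique that])
    qed (use X steps fu_deriv zero pos in \<open>auto simp: data_u_def intro: pos_def_bij\<close>)
  next
    let ?P = "range (\<lambda>x. (x, v x)) \<union> {(iterate Rc k \<omega>, approx Rc k \<omega>) |k \<omega>. \<omega> \<in> space M}"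
    assume "\<forall>i. C2 (c i)" and unique: "unique_LL_solution fl (feasible I c) (\<lambda>x. fst (v x))"
      and regular: "regular_c I c fu fl v ?P (space (dir_space Rc)) gx gy Gx Gv"
      and bsg: "bsg_assumptions M X (sdata_c gx gy Gx Gv) mode \<alpha> Rc (data_c I c fu fl) v
        (\<lambda>x. fu (x, fst (v x))) V\<^sub>d L_BSG L_LL C\<^sub>w C\<^sub>D C\<^sub>e f_inf"
    hence c: "\<And>i. C2 (c i)" by blast
    hence C1_c: "\<And>i. C1 (c i)" unfolding C2_def by blast
    have vgrad_x: "vgrad (\<lambda>x'. KKT_map I c fl x' u) x = KKT_x I c fl x u" for x u
      using vgrad_KKT_map(1)[where fl = fl and c = c, OF smooth(2) c] .
    have vgrad_v: "vgrad (KKT_map I c fl x) u = KKT_v I c fl x u" for x u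
      using vgrad_KKT_map(2)[where fl = fl and c = c, OF smooth(2) c] .
    have grad_fu: "lip_bdd UNIV (grad fu)"
      and hess: "lip_bdd UNIV (\<lambda>(x, y). hess_xy fl x y)" "lip_bdd UNIV (\<lambda>(x, y). hess_yy fl x y)"
      using regular unfolding regular_c_def by - (elim conjE, intro lip_bdd_UNIV, assumption, assumption)+
    have hess_c: "lip_bdd UNIV (grad (c i))" "lip_bdd UNIV (\<lambda>(x, y). hess_xy (c i) x y)"
      "lip_bdd UNIV (\<lambda>(x, y). hess_yy (c i) x y)" for i
      using regular unfolding regular_c_def
      by - (elim conjE, drule spec[of _ i], elim conjE, intro lip_bdd_UNIV, assumption, assumption)+
    have z_bdd: "bounded ((\<lambda>(x, v). snd v) ` ?P)" using regular unfolding regular_c_def by (elim conjE)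
    have KKT: "KKT I c fl x (fst (v x)) (snd (v x))"
      and SC: "strict_complementarity I c x (fst (v x)) (snd (v x))" for x
      using regular unfolding regular_c_def by - (elim conjE, blast)+
    have bij: "bij (blinfun_apply (KKT_v I c fl (fst p) (snd p)))" if "p \<in> ?P" for p
    proof -
      have "\<forall>(x, v)\<in>?P. bij (blinfun_apply (KKT_v I c fl x v))"
        using regular unfolding regular_c_def vgrad_v by (elim conjE)
      from bspec[OF this that] show ?thesis by (simp add: case_prod_unfold)
    qed
    have inv: "bounded ((\<lambda>(x, v). binv (KKT_v I c fl x v)) ` ?P)"
      using regular unfolding regular_c_def vgrad_v by (elim conjE)
    \<comment> \<open>The multipliers are coordinates of the pairs in \<open>?P\<close>, hence
      1-Lipschitz; their bound is the one assumed on that set.\<close>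
    have z: "lip_bdd ?P (\<lambda>p. snd (snd p) $ i)" for i
    proof -
      obtain C where "\<forall>q\<in>(\<lambda>p. snd (snd p)) ` ?P. norm q \<le> C"
        using z_bdd unfolding bounded_iff case_prod_unfold by blast
      hence C: "norm (snd (snd p)) \<le> C" if "p \<in> ?P" for p using that by blast
      show ?thesis
      proof (rule lip_bddI[where L = 1 and C = C])
        show "norm (snd (snd p) $ i) \<le> C" if "p \<in> ?P" for p
          using C[OF that] component_le_norm_cart[of "snd (snd p)" i] by simp
        fix p q :: "(real^'n) \<times> (real^'m) \<times> (real^'j)"
        have "norm (snd (snd p) $ i - snd (snd q) $ i) \<le> norm (snd (snd p) - snd (snd q))"
          using component_le_norm_cart[of "snd (snd p) - snd (snd q)" i] by simp
        also have "\<dots> \<le> dist (snd p) (snd q)" using dist_snd_le[of "snd p" "snd q"] by (simp add: dist_norm)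
        also have "\<dots> \<le> dist p q" by (rule dist_snd_le)
        finally show "norm (snd (snd p) $ i - snd (snd q) $ i) \<le> 1 * dist p q" by simp
      qed
    qed
    interpret bsg_assumptions M X "sdata_c gx gy Gx Gv" mode \<alpha> Rc "data_c I c fu fl" v
      "\<lambda>x. fu (x, fst (v x))" V\<^sub>d L_BSG L_LL C\<^sub>w C\<^sub>D C\<^sub>e f_inf by (rule bsg)
    show "(\<forall>K. integrable M (weighted_sum X (\<lambda>x. fu (x, fst (v x))) \<alpha> (iterate Rc) K)) \<and>
      convergent (\<lambda>K. \<integral>\<omega>. weighted_sum X (\<lambda>x. fu (x, fst (v x))) \<alpha> (iterate Rc) K \<omega> \<partial>M) \<and>
      (\<lambda>K. \<integral>\<omega>. (1 / (\<Sum>k\<le>K. \<alpha> k)) *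
        weighted_sum X (\<lambda>x. fu (x, fst (v x))) \<alpha> (iterate Rc) K \<omega> \<partial>M) \<longlonglongrightarrow> 0"
    \<comment> \<open>The upper-level objective is extended to be constant in the multipliers, hence
      the zero block in \<open>b\<close>, and the implicit equation is the KKT system.\<close>
    proof (rule bsg_convergence_implicit[where P = ?P and F = "\<lambda>p. fu (fst p, fst (snd p))"
          and G = "\<lambda>p. KKT_map I c fl (fst p) (snd p)"
          and a = "\<lambda>p. grad_x fu (fst p) (fst (snd p))" and b = "\<lambda>p. (grad_y fu (fst p) (fst (snd p)), 0)"
          and A = "\<lambda>p. KKT_x I c fl (fst p) (snd p)" and B = "\<lambda>p. KKT_v I c fl (fst p) (snd p)"])
      show "data_c I c fu fl x u = (grad_x fu (fst (x, u)) (fst (snd (x, u))),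
          (grad_y fu (fst (x, u)) (fst (snd (x, u))), 0), KKT_x I c fl (fst (x, u)) (snd (x, u)),
          KKT_v I c fl (fst (x, u)) (snd (x, u)))" for x u
        unfolding data_c_def vgrad_x vgrad_v by simp
      show "GDERIV (\<lambda>p. fu (fst p, fst (snd p))) (x, v x) :> (grad_x fu (fst (x, v x)) (fst (snd (x, v x))),
          (grad_y fu (fst (x, v x)) (fst (snd (x, v x))), 0))" for x
      proof -
        have "((\<lambda>p. (fst p, fst (snd p))) has_derivative (\<lambda>d. (fst d, fst (snd d)))) (at (x, v x))"
          by (auto intro!: derivative_eq_intros)
        from has_derivative_compose[OF this, of fu "\<lambda>h. h \<bullet> (grad_x fu x (fst (v x)), grad_y fu x (fst (v x)))"]
        show ?thesis using fu_deriv[of x "fst (v x)"] unfolding gderiv_def by (simp add: inner_prod_def)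
      qed
      show "KKT_map I c fl (fst (x, v x)) (snd (x, v x)) = 0" for x
        using KKT[of x] unfolding KKT_map_def KKT_def feasible_def
        by (auto simp: case_prod_unfold zero_prod_def vec_eq_iff)
      show "\<exists>G'. ((\<lambda>p. KKT_map I c fl (fst p) (snd p)) has_derivative G') (at (x, v x)) \<and>
          (\<forall>h k l. l \<bullet> G' (h, k) = blinfun_apply (KKT_x I c fl (fst (x, v x)) (snd (x, v x))) l \<bullet> h
            + blinfun_apply (KKT_v I c fl (fst (x, v x)) (snd (x, v x))) l \<bullet> k)" for x
        unfolding fst_conv snd_conv by (rule KKT_map_derivative[where fl = fl and c = c, OF smooth(2) c])
      show "lip_bdd ?P (\<lambda>p. grad_x fu (fst p) (fst (snd p)))"
        unfolding grad_xy_eq[OF smooth(1)]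
        by (intro lip_bdd_linear[OF bounded_linear_fst] lip_bdd_fst_fst_snd grad_fu)
      have "bounded_linear (\<lambda>k::real^'m. (k, 0::real^'j))"
        by (intro bounded_linear_Pair bounded_linear_ident bounded_linear_zero)
      moreover have "lip_bdd ?P (\<lambda>p. grad_y fu (fst p) (fst (snd p)))"
        unfolding grad_xy_eq[OF smooth(1)]
        by (intro lip_bdd_linear[OF bounded_linear_snd] lip_bdd_fst_fst_snd grad_fu)
      ultimately show "lip_bdd ?P (\<lambda>p. (grad_y fu (fst p) (fst (snd p)), 0::real^'j))"
        by (rule lip_bdd_linear)
      show "lip_bdd ?P (\<lambda>p. KKT_x I c fl (fst p) (snd p))"
        by (rule lip_bdd_KKT_x[where fl = fl and c = c, OF C1_c z hess(1) hess_c(1,2)])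
      show "\<exists>L. L-lipschitz_on ?P (\<lambda>p. KKT_v I c fl (fst p) (snd p))"
        by (rule lipschitz_KKT_v[where fl = fl and c = c, OF C1_c z hess(2) hess_c(1,3)])
      show "bounded ((\<lambda>p. binv (KKT_v I c fl (fst p) (snd p))) ` ?P)"
        using inv by (simp add: case_prod_unfold)
      show "bij (blinfun_apply (KKT_v I c fl (fst p) (snd p)))" if "p \<in> ?P" for p
        by (rule bij[OF that])
      have bij': "bij (blinfun_apply (KKT_v I c fl x (v x)))" for x
        using bij[of "(x, v x)"] by simp
      show "p = v x" if "s \<longlonglongrightarrow> x" "(\<lambda>n. v (s n)) \<longlonglongrightarrow> p" for s x p
        by (rule KKT_closed_graph[where fl = fl and c = c, OF smooth(2) c unique KKT SC bij' that])
    qed (use X steps in auto)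
  }
qed

end
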